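(* Let $\Lambda$ be an artin algebra and let $\mathfrak{A}$ be a strong idempotent ideal of $\Lambda$ such that the projective dimension of $\Lambda/\mathfrak{A}$ as a left $\Lambda$-module is finite. Then: (a) $\phi_l^{\Lambda/\mathfrak{A}}(X)\le \phi_l^{\Lambda}(X)$ for all $X\in \mathrm{mod}\,\Lambda/\mathfrak{A}$. (b) $\phi_l\dim(\Lambda/\mathfrak{A})\le \phi_l\dim(\Lambda)$.
   Context: For an artin algebra $\Lambda$, $\mathrm{mod}\,\Lambda$ is the category of finitely generated left $\Lambda$-modules; $\mathrm{mod}\,\Lambda/\mathfrak{A}$ is regarded as a full subcategory of $\mathrm{mod}\,\Lambda$. Strong idempotent ideal: a two-sided idempotent ideal $\mathfrak{A}$ ($\mathfrak{A}^2=\mathfrak{A}$) of $\Lambda$ such that the morphism $\mathrm{Ext}^i_{\Lambda/\mathfrak{A}}(X,Y)\to \mathrm{Ext}^i_{\Lambda}(X,Y)$ induced by the canonical isomorphism $\mathrm{Hom}_{\Lambda/\mathfrak{A}}(X,Y)\to\mathrm{Hom}_\Lambda(X,Y)$ is an isomorphism for all $i\ge 0$ and all $X,Y\in\mathrm{mod}\,\Lambda/\mathfrak{A}$. Igusa-Todorov function $\phi_l^{\Lambda}$: let $K_0$ be the abelian group generated by symbols $[M]$, $M\in\mathrm{mod}\,\Lambda$, modulo $[C]=[A]+[B]$ if $C\simeq A\oplus B$ and $[Q]=0$ if $Q$ is projective; let $\Omega:K_0\to K_0$ be the homomorphism $\Omega([M])=[\Omega(M)]$ induced by the syzygy; let $\langle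 \mathrm{add}\,M\rangle$ be the subgroup of $K_0$ generated by the indecomposable summands of $M$. Then $\phi_l^\Lambda(M)$ is the smallest non-negative integer $n$ such that $\Omega:\Omega^s(\langle\mathrm{add}\,M\rangle)\to\Omega^{s+1}(\langle\mathrm{add}\,M\rangle)$ is an isomorphism for all $s\ge n$. Finally $\phi_l\dim(\Lambda)=\sup\{\phi^\Lambda_l(M): M\in\mathrm{mod}\,\Lambda\}$ (possibly $\infty$), and similarly for $\Lambda/\mathfrak{A}$. *)

theory Defs
  imports
    "HOL-Algebra.Module" "HOL-Algebra.QuotRing" "HOL-Algebra.Ideal_Product"
    "HOL-Algebra.Generated_Groups" "HOL-Algebra.Free_Abelian_Groups"
    "HOL-Library.Extended_Nat"
begin

section \<open>Left modules over rings that need not be commutative\<close>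

text \<open>
  The library locale \<^locale>\<open>Module.module\<close> presupposes a commutative ring of scalars. The axioms below
  are the same, over an arbitrary ring and with scalars acting on the left. The record type
  \<^typ>\<open>('a, 'm) module\<close> inherits multiplication and unit fields from the ring record. They play no
  role for modules, and every notion below that depends on a module ignores them.
\<close>

locale left_module = R?: ring R + M?: abelian_group M for R :: "('a, 'c) ring_scheme" (structure) and M :: "('a, 'm) module" (structure) +
  assumes smult_closed:
      "\<lbrakk> a \<in> carrier R; x \<in> carrier M \<rbrakk> \<Longrightarrow> a \<odot>\<^bsub>M\<^esub> x \<in> carrier M"
    and smult_l_distr:
      "\<lbrakk> a \<in> carrier R; b \<in> carrier R; x \<in> carrier M \<rbrakk> \<Longrightarrow>
        (a \<oplus> b) \<odot>\<^bsub>M\<^esub> x = a \<odot>\<^bsub>M\<^esub> x \<oplus>\<^bsub>M\<^esub> b \<odot>\<^bsub>M\<^esub> x"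
    and smult_r_distr:
      "\<lbrakk> a \<in> carrier R; x \<in> carrier M; y \<in> carrier M \<rbrakk> \<Longrightarrow>
        a \<odot>\<^bsub>M\<^esub> (x \<oplus>\<^bsub>M\<^esub> y) = a \<odot>\<^bsub>M\<^esub> x \<oplus>\<^bsub>M\<^esub> a \<odot>\<^bsub>M\<^esub> y"
    and smult_assoc1:
      "\<lbrakk> a \<in> carrier R; b \<in> carrier R; x \<in> carrier M \<rbrakk> \<Longrightarrow>
        (a \<otimes> b) \<odot>\<^bsub>M\<^esub> x = a \<odot>\<^bsub>M\<^esub> (b \<odot>\<^bsub>M\<^esub> x)"
    and smult_one:
      "x \<in> carrier M \<Longrightarrow> \<one> \<odot>\<^bsub>M\<^esub> x = x"

definition fg_module :: "('a, 'c) ring_scheme \<Rightarrow> ('a, 'm) module \<Rightarrow> bool"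
  where "fg_module R M \<longleftrightarrow> left_module R M \<and>
    (\<exists>B. finite B \<and> B \<subseteq> carrier M \<and> (\<forall>N. submodule N R M \<and> B \<subseteq> N \<longrightarrow> N = carrier M))"

text \<open>Homomorphisms are extensional functions, so that equality of homomorphisms is equality in HOL.\<close>

definition mod_hom :: "('a, 'c) ring_scheme \<Rightarrow> ('a, 'm) module \<Rightarrow> ('a, 'n) module \<Rightarrow> ('m \<Rightarrow> 'n) set"
  where "mod_hom R M N = {f \<in> carrier M \<rightarrow>\<^sub>E carrier N.
    (\<forall>x \<in> carrier M. \<forall>y \<in> carrier M. f (x \<oplus>\<^bsub>M\<^esub> y) = f x \<oplus>\<^bsub>N\<^esub> f y) \<and>
    (\<forall>a \<in> carrier R. \<forall>x \<in> carrier M. f (a \<odot>\<^bsub>M\<^esub> x) = a \<odot>\<^bsub>N\<^esub> f x)}"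

definition mod_isomorphic :: "('a, 'c) ring_scheme \<Rightarrow> ('a, 'm) module \<Rightarrow> ('a, 'n) module \<Rightarrow> bool"
  where "mod_isomorphic R M N \<longleftrightarrow> (\<exists>f \<in> mod_hom R M N. bij_betw f (carrier M) (carrier N))"

definition direct_sum :: "('a, 'm) module \<Rightarrow> ('a, 'n) module \<Rightarrow> ('a, 'm \<times> 'n) module"
  where "direct_sum M N =
    \<lparr>carrier = carrier M \<times> carrier N, monoid.mult = (\<lambda>_ _. undefined), one = undefined,
     ring.zero = (\<zero>\<^bsub>M\<^esub>, \<zero>\<^bsub>N\<^esub>), add = (\<lambda>(x, y) (x', y'). (x \<oplus>\<^bsub>M\<^esub> x', y \<oplus>\<^bsub>N\<^esub> y')),
     smult = (\<lambda>a (x, y). (a \<odot>\<^bsub>M\<^esub> x, a \<odot>\<^bsub>N\<^esub> y))\<rparr>"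

definition regular_module :: "('a, 'c) ring_scheme \<Rightarrow> ('a, 'a) module"
  where "regular_module R =
    \<lparr>carrier = carrier R, monoid.mult = monoid.mult R, one = one R, ring.zero = ring.zero R, add = add R,
     smult = monoid.mult R\<rparr>"

text \<open>A module over the quotient of \<open>R\<close> by \<open>I\<close>, viewed as a module over \<open>R\<close>.\<close>

definition restrict_scalars ::
    "('a, 'c) ring_scheme \<Rightarrow> 'a set \<Rightarrow> ('a set, 'm) module \<Rightarrow> ('a, 'm) module"
  where "restrict_scalars R I X =
    \<lparr>carrier = carrier X, monoid.mult = monoid.mult X, one = one X, ring.zero = ring.zero X, add = add X,
     smult = (\<lambda>a x. (I +>\<^bsub>R\<^esub> a) \<odot>\<^bsub>X\<^esub> x)\<rparr>"


section \<open>The category of finitely generated modules\<close>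

text \<open>
  Every finitely generated left module over a ring with elements in \<open>'a\<close> is a quotient of some
  finite power of the ring, so it is isomorphic to one with elements in the type below, whatever
  the type of its own elements is (lemma \<open>fg_module_representative\<close>). Thus \<open>mod_cat R\<close> is a
  set of objects that represents the category of all finitely generated left \<open>R\<close>-modules.
\<close>

type_synonym 'a univ = "(nat \<Rightarrow> 'a) set"

definition mod_cat :: "('a, 'c) ring_scheme \<Rightarrow> ('a, 'a univ) module set"
  where "mod_cat R = {M. fg_module R M}"

primrec lin_comb :: "('a, 'm) module \<Rightarrow> 'm list \<Rightarrow> (nat \<Rightarrow> 'a) \<Rightarrow> 'm"
  where
    "lin_comb M [] c = \<zero>\<^bsub>M\<^esub>"
  | "lin_comb M (b # bs) c = c 0 \<odot>\<^bsub>M\<^esub> b \<oplus>\<^bsub>M\<^esub> lin_comb M bs (\<lambda>i. c (Suc i))"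

context left_module
begin

lemma smult_zero: "a \<in> carrier R \<Longrightarrow> a \<odot>\<^bsub>M\<^esub> \<zero>\<^bsub>M\<^esub> = \<zero>\<^bsub>M\<^esub>"
proof -
  assume a: "a \<in> carrier R"
  have "a \<odot>\<^bsub>M\<^esub> \<zero>\<^bsub>M\<^esub> \<oplus>\<^bsub>M\<^esub> a \<odot>\<^bsub>M\<^esub> \<zero>\<^bsub>M\<^esub> = a \<odot>\<^bsub>M\<^esub> \<zero>\<^bsub>M\<^esub>"
    using smult_r_distr[OF a M.zero_closed M.zero_closed] by simp
  then show ?thesis
    using smult_closed[OF a M.zero_closed] by (metis M.add.r_cancel_one')
qed

lemma zero_smult: "x \<in> carrier M \<Longrightarrow> \<zero> \<odot>\<^bsub>M\<^esub> x = \<zero>\<^bsub>M\<^esub>"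
proof -
  assume x: "x \<in> carrier M"
  have "\<zero> \<odot>\<^bsub>M\<^esub> x \<oplus>\<^bsub>M\<^esub> \<zero> \<odot>\<^bsub>M\<^esub> x = \<zero> \<odot>\<^bsub>M\<^esub> x"
    using smult_l_distr[OF R.zero_closed R.zero_closed x] by simp
  then show ?thesis
    using smult_closed[OF R.zero_closed x] by (metis M.add.r_cancel_one')
qed

lemma minus_smult: "x \<in> carrier M \<Longrightarrow> (\<ominus> \<one>) \<odot>\<^bsub>M\<^esub> x = \<ominus>\<^bsub>M\<^esub> x"
proof -
  assume x: "x \<in> carrier M"
  have "(\<ominus> \<one>) \<odot>\<^bsub>M\<^esub> x \<oplus>\<^bsub>M\<^esub> x = (\<ominus> \<one> \<oplus> \<one>) \<odot>\<^bsub>M\<^esub> x"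
    using smult_l_distr[of "\<ominus> \<one>" \<one> x] smult_one[OF x] x by simp
  also have "\<dots> = \<zero>\<^bsub>M\<^esub>" using x by (simp add: R.l_neg zero_smult)
  finally show ?thesis
    using x smult_closed[of "\<ominus> \<one>" x] by (simp add: M.minus_equality)
qed

lemma lin_comb_closed:
  "set bs \<subseteq> carrier M \<Longrightarrow> range c \<subseteq> carrier R \<Longrightarrow> lin_comb M bs c \<in> carrier M"
proof (induction bs arbitrary: c)
  case (Cons b bs)
  have "range (\<lambda>i. c (Suc i)) \<subseteq> carrier R" "c 0 \<in> carrier R" using Cons.prems by auto
  then show ?case using Cons by (simp add: smult_closed)
qed simp

lemma lin_comb_add:
  "set bs \<subseteq> carrier M \<Longrightarrow> range c \<subseteq> carrier R \<Longrightarrow> range d \<subseteq> carrier R \<Longrightarrow>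
    lin_comb M bs c \<oplus>\<^bsub>M\<^esub> lin_comb M bs d = lin_comb M bs (\<lambda>i. c i \<oplus> d i)"
proof (induction bs arbitrary: c d)
  case (Cons b bs)
  let ?c = "\<lambda>i. c (Suc i)" and ?d = "\<lambda>i. d (Suc i)"
  have r: "range ?c \<subseteq> carrier R" "range ?d \<subseteq> carrier R" "c 0 \<in> carrier R" "d 0 \<in> carrier R"
    using Cons.prems by auto
  have b: "b \<in> carrier M" "set bs \<subseteq> carrier M" using Cons.prems by auto
  have cl: "lin_comb M bs ?c \<in> carrier M" "lin_comb M bs ?d \<in> carrier M"
    "c 0 \<odot>\<^bsub>M\<^esub> b \<in> carrier M" "d 0 \<odot>\<^bsub>M\<^esub> b \<in> carrier M"
    using r b by (simp_all add: lin_comb_closed smult_closed)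
  have "lin_comb M (b # bs) c \<oplus>\<^bsub>M\<^esub> lin_comb M (b # bs) d =
      (c 0 \<odot>\<^bsub>M\<^esub> b \<oplus>\<^bsub>M\<^esub> d 0 \<odot>\<^bsub>M\<^esub> b) \<oplus>\<^bsub>M\<^esub> (lin_comb M bs ?c \<oplus>\<^bsub>M\<^esub> lin_comb M bs ?d)"
    using cl by (simp add: M.a_ac)
  also have "\<dots> = lin_comb M (b # bs) (\<lambda>i. c i \<oplus> d i)"
    using Cons.IH[OF b(2) r(1,2)] smult_l_distr r b by simp
  finally show ?case .
qed simp

lemma lin_comb_smult:
  "a \<in> carrier R \<Longrightarrow> set bs \<subseteq> carrier M \<Longrightarrow> range c \<subseteq> carrier R \<Longrightarrow>
    a \<odot>\<^bsub>M\<^esub> lin_comb M bs c = lin_comb M bs (\<lambda>i. a \<otimes> c i)"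
proof (induction bs arbitrary: c)
  case (Cons b bs)
  let ?c = "\<lambda>i. c (Suc i)"
  have r: "range ?c \<subseteq> carrier R" "c 0 \<in> carrier R" using Cons.prems by auto
  have b: "b \<in> carrier M" "set bs \<subseteq> carrier M" using Cons.prems by auto
  have "a \<odot>\<^bsub>M\<^esub> lin_comb M (b # bs) c = a \<odot>\<^bsub>M\<^esub> (c 0 \<odot>\<^bsub>M\<^esub> b) \<oplus>\<^bsub>M\<^esub> a \<odot>\<^bsub>M\<^esub> lin_comb M bs ?c"
    using r b Cons.prems(1) by (simp add: lin_comb_closed smult_closed smult_r_distr)
  also have "\<dots> = lin_comb M (b # bs) (\<lambda>i. a \<otimes> c i)"
    using Cons.IH[OF Cons.prems(1) b(2) r(1)] smult_assoc1 r b Cons.prems(1) by simp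
  finally show ?case .
qed (simp add: smult_zero)

lemma lin_comb_zero:
  "set bs \<subseteq> carrier M \<Longrightarrow> lin_comb M bs (\<lambda>_. \<zero>) = \<zero>\<^bsub>M\<^esub>"
  by (induction bs) (simp_all add: zero_smult)

lemma lin_comb_generator:
  "set bs \<subseteq> carrier M \<Longrightarrow> b \<in> set bs \<Longrightarrow> \<exists>c. range c \<subseteq> carrier R \<and> lin_comb M bs c = b"
proof (induction bs)
  case (Cons x bs)
  show ?case
  proof (cases "b = x")
    case True
    let ?c = "\<lambda>i::nat. if i = 0 then \<one> else \<zero>"
    have "lin_comb M (x # bs) ?c = b"
      using Cons.prems True by (simp add: lin_comb_zero smult_one)
    moreover have "range ?c \<subseteq> carrier R" by auto
    ultimately show ?thesis by blast
  next
    case False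
    then obtain c where c: "range c \<subseteq> carrier R" "lin_comb M bs c = b"
      using Cons by auto
    let ?c = "case_nat \<zero> c"
    have "lin_comb M (x # bs) ?c = b"
      using Cons.prems c False by (auto simp add: zero_smult)
    moreover have "range ?c \<subseteq> carrier R" using c(1) by (auto simp: range_subsetD split: nat.splits)
    ultimately show ?thesis by blast
  qed
qed simp

lemma submodule_lin_comb:
  assumes bs: "set bs \<subseteq> carrier M"
  shows "submodule {lin_comb M bs c |c. range c \<subseteq> carrier R} R M" (is "submodule ?S R M")
proof -
  have smult: "a \<odot>\<^bsub>M\<^esub> x \<in> ?S" if ax: "a \<in> carrier R" "x \<in> ?S" for a x
  proof -
    obtain c where c: "range c \<subseteq> carrier R" "x = lin_comb M bs c" using ax(2) by auto
    have "range (\<lambda>i. a \<otimes> c i) \<subseteq> carrier R" using c ax(1) by auto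
    then show ?thesis using lin_comb_smult[OF ax(1) bs c(1)] c(2) by auto
  qed
  have "subgroup ?S (add_monoid M)"
  proof (rule M.add.subgroupI)
    show "?S \<subseteq> carrier M" using lin_comb_closed[OF bs] by auto
    have "range (\<lambda>_::nat. \<zero>) \<subseteq> carrier R" by auto
    then show "?S \<noteq> {}" by blast
  next
    fix x assume x: "x \<in> ?S"
    have xM: "x \<in> carrier M" using x lin_comb_closed[OF bs] by auto
    show "\<ominus>\<^bsub>M\<^esub> x \<in> ?S"
      using smult[of "\<ominus> \<one>" x] x minus_smult[OF xM] by simp
  next
    fix x y assume "x \<in> ?S" "y \<in> ?S"
    then obtain c d where c: "range c \<subseteq> carrier R" "x = lin_comb M bs c"
      and d: "range d \<subseteq> carrier R" "y = lin_comb M bs d" by auto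
    have "range (\<lambda>i. c i \<oplus> d i) \<subseteq> carrier R" using c d by auto
    then show "x \<oplus>\<^bsub>M\<^esub> y \<in> ?S" using lin_comb_add[OF bs c(1) d(1)] c(2) d(2) by auto
  qed
  then show ?thesis using smult by (auto simp: submodule_def submodule_axioms_def)
qed

end

lemma fg_module_representative:
  fixes R :: "('a, 'c) ring_scheme" and M :: "('a, 'm) module"
  assumes fg: "fg_module R M"
  shows "\<exists>N \<in> mod_cat R. mod_isomorphic R M N"
proof -
  interpret left_module R M using fg by (simp add: fg_module_def)
  obtain B where B: "finite B" "B \<subseteq> carrier M"
    and gen: "\<And>N. submodule N R M \<Longrightarrow> B \<subseteq> N \<Longrightarrow> N = carrier M"
    using fg by (auto simp: fg_module_def)
  obtain bs where bs: "set bs = B" using finite_list[OF B(1)] by blast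
  define g where "g x = {c. range c \<subseteq> carrier R \<and> lin_comb M bs c = x}" for x
  have span: "{lin_comb M bs c |c. range c \<subseteq> carrier R} = carrier M"
  proof (rule gen)
    show "submodule {lin_comb M bs c |c. range c \<subseteq> carrier R} R M"
      using submodule_lin_comb bs B by simp
    show "B \<subseteq> {lin_comb M bs c |c. range c \<subseteq> carrier R}"
      using lin_comb_generator[of bs] bs B by blast
  qed
  have inj: "inj_on g (carrier M)"
  proof (rule inj_onI)
    fix x y assume x: "x \<in> carrier M" and "y \<in> carrier M" and gxy: "g x = g y"
    from x obtain c where "range c \<subseteq> carrier R" "lin_comb M bs c = x"
      unfolding span[symmetric] by auto
    then have "c \<in> g x" by (simp add: g_def)
    then have "c \<in> g x" "c \<in> g y" using gxy by simp_all
    then show "x = y" by (simp add: g_def)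
  qed
  define h where "h = inv_into (carrier M) g"
  have hg [simp]: "h (g x) = x" if "x \<in> carrier M" for x
    using inj that by (simp add: h_def)
  define N :: "('a, 'a univ) module" where
    "N = \<lparr>carrier = g ` carrier M, monoid.mult = undefined, one = undefined, ring.zero = g \<zero>\<^bsub>M\<^esub>,
      add = (\<lambda>u v. g (h u \<oplus>\<^bsub>M\<^esub> h v)), smult = (\<lambda>a u. g (a \<odot>\<^bsub>M\<^esub> h u))\<rparr>"
  have N [simp]: "carrier N = g ` carrier M" "\<zero>\<^bsub>N\<^esub> = g \<zero>\<^bsub>M\<^esub>"
    "u \<oplus>\<^bsub>N\<^esub> v = g (h u \<oplus>\<^bsub>M\<^esub> h v)" "a \<odot>\<^bsub>N\<^esub> u = g (a \<odot>\<^bsub>M\<^esub> h u)" for u v a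
    by (simp_all add: N_def)
  have "abelian_group N"
  proof (rule abelian_groupI)
    fix x assume "x \<in> carrier N"
    then obtain y where y: "y \<in> carrier M" "x = g y" by auto
    then have "g (\<ominus>\<^bsub>M\<^esub> y) \<oplus>\<^bsub>N\<^esub> x = \<zero>\<^bsub>N\<^esub>" by (simp add: M.l_neg)
    then show "\<exists>y \<in> carrier N. y \<oplus>\<^bsub>N\<^esub> x = \<zero>\<^bsub>N\<^esub>" using y by auto
  qed (auto simp: M.a_ac)
  then have lmN: "left_module R N"
    by (intro left_module.intro left_module_axioms.intro)
      (auto simp: R.ring_axioms smult_closed smult_l_distr smult_r_distr smult_assoc1 smult_one)
  have "fg_module R N"
    unfolding fg_module_def
  proof (intro conjI exI allI impI)
    show "left_module R N" by (rule lmN)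
    show "finite (g ` B)" "g ` B \<subseteq> carrier N" using B by auto
    fix K assume K: "submodule K R N \<and> g ` B \<subseteq> K"
    interpret N: left_module R N by (rule lmN)
    interpret K: submodule K R N using K by simp
    have KN: "K \<subseteq> g ` carrier M" using K.subset by simp
    let ?L = "{x \<in> carrier M. g x \<in> K}"
    have sm: "a \<odot>\<^bsub>M\<^esub> x \<in> ?L" if "a \<in> carrier R" "x \<in> ?L" for a x
      using K.smult_closed[of a "g x"] that by (simp add: smult_closed)
    have "subgroup ?L (add_monoid M)"
    proof (rule M.add.subgroupI)
      show "?L \<noteq> {}" using K.one_closed by auto
      fix x assume x: "x \<in> ?L"
      then show "\<ominus>\<^bsub>M\<^esub> x \<in> ?L"
        using sm[of "\<ominus>\<^bsub>R\<^esub> \<one>\<^bsub>R\<^esub>" x] minus_smult[of x] by simp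
    next
      fix x y assume "x \<in> ?L" "y \<in> ?L"
      then show "x \<oplus>\<^bsub>M\<^esub> y \<in> ?L" using K.m_closed[of "g x" "g y"] by simp
    qed auto
    then have "submodule ?L R M" using sm by (auto simp: submodule_def submodule_axioms_def)
    then have "?L = carrier M" using gen[of ?L] K B by auto
    then show "K = carrier N" using KN by auto
  qed
  moreover have "restrict g (carrier M) \<in> mod_hom R M N"
    by (auto simp: mod_hom_def smult_closed)
  moreover have "bij_betw (restrict g (carrier M)) (carrier M) (carrier N)"
    using inj by (simp add: bij_betw_def inj_on_restrict_eq)
  ultimately show ?thesis unfolding mod_cat_def mod_isomorphic_def by blast
qed


section \<open>Artin algebras\<close>

definition artinian_cring :: "('r, 'c) ring_scheme \<Rightarrow> bool"
  where "artinian_cring R \<longleftrightarrow> cring R \<and>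
    (\<forall>I :: nat \<Rightarrow> 'r set. (\<forall>n. ideal (I n) R \<and> I (Suc n) \<subseteq> I n) \<longrightarrow> (\<exists>n. \<forall>m\<ge>n. I m = I n))"

text \<open>
  The library locale \<^locale>\<open>Module.algebra\<close> only covers commutative algebras, hence the explicit
  compatibility conditions, which say that scalars act centrally.
\<close>

definition artin_algebra :: "('r, 'c) ring_scheme \<Rightarrow> ('r, 'a) module \<Rightarrow> bool"
  where "artin_algebra R \<Lambda> \<longleftrightarrow> artinian_cring R \<and> ring \<Lambda> \<and> Module.module R \<Lambda> \<and>
    (\<forall>r \<in> carrier R. \<forall>x \<in> carrier \<Lambda>. \<forall>y \<in> carrier \<Lambda>.
      (r \<odot>\<^bsub>\<Lambda>\<^esub> x) \<otimes>\<^bsub>\<Lambda>\<^esub> y = r \<odot>\<^bsub>\<Lambda>\<^esub> (x \<otimes>\<^bsub>\<Lambda>\<^esub> y) \<and>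
      x \<otimes>\<^bsub>\<Lambda>\<^esub> (r \<odot>\<^bsub>\<Lambda>\<^esub> y) = r \<odot>\<^bsub>\<Lambda>\<^esub> (x \<otimes>\<^bsub>\<Lambda>\<^esub> y)) \<and>
    fg_module R \<Lambda>"


section \<open>Projective modules, resolutions and projective dimension\<close>

text \<open>
  The lifting property is required against epimorphisms of \<open>mod_cat R\<close> only. For finitely generated
  \<open>P\<close>, the only case used below, this is projectivity in the usual sense.
\<close>

definition projective :: "('a, 'c) ring_scheme \<Rightarrow> ('a, 'm) module \<Rightarrow> bool"
  where "projective R P \<longleftrightarrow>
    (\<forall>M \<in> mod_cat R. \<forall>N \<in> mod_cat R. \<forall>g \<in> mod_hom R M N. \<forall>f \<in> mod_hom R P N.
      g ` carrier M = carrier N \<longrightarrow> (\<exists>h \<in> mod_hom R P M. \<forall>x \<in> carrier P. g (h x) = f x))"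

text \<open>
  \<open>proj_resolution R X P d e\<close>: the sequence
  \<open>\<dots> \<rightarrow> P 1 \<rightarrow> P 0 \<rightarrow> X \<rightarrow> 0\<close> is exact, with \<open>P i\<close> finitely generated projective,
  differentials \<open>d i : P (i + 1) \<rightarrow> P i\<close> and augmentation \<open>e : P 0 \<rightarrow> X\<close>.
\<close>

definition proj_resolution ::
    "('a, 'c) ring_scheme \<Rightarrow> ('a, 'm) module \<Rightarrow> (nat \<Rightarrow> ('a, 'a univ) module) \<Rightarrow>
      (nat \<Rightarrow> 'a univ \<Rightarrow> 'a univ) \<Rightarrow> ('a univ \<Rightarrow> 'm) \<Rightarrow> bool"
  where "proj_resolution R X P d e \<longleftrightarrow>
    (\<forall>i. P i \<in> mod_cat R \<and> projective R (P i)) \<and>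
    e \<in> mod_hom R (P 0) X \<and> e ` carrier (P 0) = carrier X \<and>
    (\<forall>i. d i \<in> mod_hom R (P (Suc i)) (P i)) \<and>
    d 0 ` carrier (P 1) = {x \<in> carrier (P 0). e x = \<zero>\<^bsub>X\<^esub>} \<and>
    (\<forall>i. d (Suc i) ` carrier (P (Suc (Suc i))) =
      {x \<in> carrier (P (Suc i)). d i x = \<zero>\<^bsub>P i\<^esub>})"

definition proj_dim :: "('a, 'c) ring_scheme \<Rightarrow> ('a, 'm) module \<Rightarrow> enat"
  where "proj_dim R M = Inf {enat n |n.
    \<exists>P d e. proj_resolution R M P d e \<and> (\<forall>i>n. carrier (P i) = {\<zero>\<^bsub>P i\<^esub>})}"


section \<open>Ext groups\<close>

text \<open>\<open>Ext i R X Y\<close> is the cohomology of \<open>Hom R (P, Y)\<close> for a fixed choice \<open>P\<close> of a projective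
  resolution of \<open>X\<close>.\<close>

definition chosen_resolution ::
    "('a, 'c) ring_scheme \<Rightarrow> ('a, 'm) module \<Rightarrow>
      (nat \<Rightarrow> ('a, 'a univ) module) \<times> (nat \<Rightarrow> 'a univ \<Rightarrow> 'a univ) \<times> ('a univ \<Rightarrow> 'm)"
  where "chosen_resolution R X = (SOME (P, d, e). proj_resolution R X P d e)"

abbreviation res_obj where "res_obj R X \<equiv> fst (chosen_resolution R X)"
abbreviation res_diff where "res_diff R X \<equiv> fst (snd (chosen_resolution R X))"
abbreviation res_aug where "res_aug R X \<equiv> snd (snd (chosen_resolution R X))"

definition hom_group ::
    "('a, 'c) ring_scheme \<Rightarrow> ('a, 'm) module \<Rightarrow> ('a, 'n) module \<Rightarrow> ('m \<Rightarrow> 'n) monoid"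
  where "hom_group R M N =
    \<lparr>carrier = mod_hom R M N,
     monoid.mult = (\<lambda>f g. \<lambda>x \<in> carrier M. f x \<oplus>\<^bsub>N\<^esub> g x),
     one = (\<lambda>x \<in> carrier M. \<zero>\<^bsub>N\<^esub>)\<rparr>"

definition cocycles ::
    "nat \<Rightarrow> ('a, 'c) ring_scheme \<Rightarrow> ('a, 'm) module \<Rightarrow> ('a, 'n) module \<Rightarrow> ('a univ \<Rightarrow> 'n) set"
  where "cocycles i R X Y = {f \<in> mod_hom R (res_obj R X i) Y.
    \<forall>x \<in> carrier (res_obj R X (Suc i)). f (res_diff R X i x) = \<zero>\<^bsub>Y\<^esub>}"

definition coboundaries ::
    "nat \<Rightarrow> ('a, 'c) ring_scheme \<Rightarrow> ('a, 'm) module \<Rightarrow> ('a, 'n) module \<Rightarrow> ('a univ \<Rightarrow> 'n) set"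
  where "coboundaries i R X Y = (case i of
      0 \<Rightarrow> {\<lambda>x \<in> carrier (res_obj R X 0). \<zero>\<^bsub>Y\<^esub>}
    | Suc j \<Rightarrow> (\<lambda>f. compose (carrier (res_obj R X (Suc j))) f (res_diff R X j)) `
        mod_hom R (res_obj R X j) Y)"

definition Ext ::
    "nat \<Rightarrow> ('a, 'c) ring_scheme \<Rightarrow> ('a, 'm) module \<Rightarrow> ('a, 'n) module \<Rightarrow> ('a univ \<Rightarrow> 'n) set monoid"
  where "Ext i R X Y =
    ((hom_group R (res_obj R X i) Y)\<lparr>carrier := cocycles i R X Y\<rparr>) Mod (coboundaries i R X Y)"

text \<open>
  For \<open>X\<close> and \<open>Y\<close> over \<open>R Quot I\<close>, let \<open>P\<close> be the chosen resolution of \<open>X\<close> over \<open>R\<close> and \<open>Q\<close> the one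
  over \<open>R Quot I\<close>. Take a chain map \<open>P \<rightarrow> Q\<close> of \<open>R\<close>-modules over the identity of \<open>X\<close>. Then
  \<open>Hom (Q, Y)\<close> over \<open>R Quot I\<close>, which is also \<open>Hom (Q, Y)\<close> over \<open>R\<close> by the canonical isomorphism,
  maps to \<open>Hom (P, Y)\<close> over \<open>R\<close> by precomposition. \<open>Ext_map\<close> is the induced map on cohomology. It does
  not depend on the chain map, since any two are homotopic. The canonical isomorphism is the
  identity on functions and so does not show up in the formula.
\<close>

definition comparison_map ::
    "('a, 'c) ring_scheme \<Rightarrow> 'a set \<Rightarrow> ('a set, 'm) module \<Rightarrow> nat \<Rightarrow> 'a univ \<Rightarrow> 'a set univ"
  where "comparison_map R I X = (SOME f.
    let X' = restrict_scalars R I X; S = R Quot I in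
      (\<forall>i. f i \<in> mod_hom R (res_obj R X' i) (restrict_scalars R I (res_obj S X i))) \<and>
      (\<forall>x \<in> carrier (res_obj R X' 0). res_aug S X (f 0 x) = res_aug R X' x) \<and>
      (\<forall>i. \<forall>x \<in> carrier (res_obj R X' (Suc i)).
        res_diff S X i (f (Suc i) x) = f i (res_diff R X' i x)))"

definition Ext_map ::
    "nat \<Rightarrow> ('a, 'c) ring_scheme \<Rightarrow> 'a set \<Rightarrow> ('a set, 'm) module \<Rightarrow> ('a set, 'n) module \<Rightarrow>
      ('a set univ \<Rightarrow> 'n) set \<Rightarrow> ('a univ \<Rightarrow> 'n) set"
  where "Ext_map i R I X Y = (\<lambda>C.
    let X' = restrict_scalars R I X; Y' = restrict_scalars R I Y; P = res_obj R X' i in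
      the_elem ((\<lambda>g. coboundaries i R X' Y' #>\<^bsub>hom_group R P Y'\<^esub>
        compose (carrier P) g (comparison_map R I X i)) ` C))"

definition strong_idempotent_ideal :: "'a set \<Rightarrow> ('a, 'c) ring_scheme \<Rightarrow> bool"
  where "strong_idempotent_ideal I R \<longleftrightarrow> ideal I R \<and> I \<cdot>\<^bsub>R\<^esub> I = I \<and>
    (\<forall>i. \<forall>X \<in> mod_cat (R Quot I). \<forall>Y \<in> mod_cat (R Quot I).
      Ext_map i R I X Y \<in>
        iso (Ext i (R Quot I) X Y) (Ext i R (restrict_scalars R I X) (restrict_scalars R I Y)))"


section \<open>Syzygies and the Igusa-Todorov function\<close>

definition projective_cover ::
    "('a, 'c) ring_scheme \<Rightarrow> ('a, 'm) module \<Rightarrow> ('a, 'p) module \<Rightarrow> ('p \<Rightarrow> 'm) \<Rightarrow> bool"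
  where "projective_cover R M P p \<longleftrightarrow> projective R P \<and>
    p \<in> mod_hom R P M \<and> p ` carrier P = carrier M \<and>
    (\<forall>L. submodule L R P \<and> p ` L = carrier M \<longrightarrow> L = carrier P)"

text \<open>The kernel of a projective cover, which is unique up to isomorphism.\<close>

definition syzygy :: "('a, 'c) ring_scheme \<Rightarrow> ('a, 'm) module \<Rightarrow> ('a, 'a univ) module"
  where "syzygy R M = (case (SOME (P, p). P \<in> mod_cat R \<and> projective_cover R M P p) of
    (P, p) \<Rightarrow> P\<lparr>carrier := {x \<in> carrier P. p x = \<zero>\<^bsub>M\<^esub>}\<rparr>)"

definition K0_relations :: "('a, 'c) ring_scheme \<Rightarrow> (('a, 'a univ) module \<Rightarrow>\<^sub>0 int) set"
  where "K0_relations R = generate (free_Abelian_group (mod_cat R))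
    ({frag_of C - (frag_of A + frag_of B) |A B C.
        A \<in> mod_cat R \<and> B \<in> mod_cat R \<and> C \<in> mod_cat R \<and> mod_isomorphic R C (direct_sum A B)} \<union>
     {frag_of Q |Q. Q \<in> mod_cat R \<and> projective R Q})"

definition K0 :: "('a, 'c) ring_scheme \<Rightarrow> (('a, 'a univ) module \<Rightarrow>\<^sub>0 int) set monoid"
  where "K0 R = free_Abelian_group (mod_cat R) Mod K0_relations R"

definition K0_of ::
    "('a, 'c) ring_scheme \<Rightarrow> (('a, 'a univ) module \<Rightarrow>\<^sub>0 int) \<Rightarrow> (('a, 'a univ) module \<Rightarrow>\<^sub>0 int) set"
  where "K0_of R x = K0_relations R #>\<^bsub>free_Abelian_group (mod_cat R)\<^esub> x"

text \<open>\<open>K0_syzygy R\<close> is the endomorphism \<open>\<Omega>\<close> of \<open>K0 R\<close> with \<open>\<Omega> [M] = [syzygy R M]\<close>.\<close>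

definition K0_syzygy ::
    "('a, 'c) ring_scheme \<Rightarrow> (('a, 'a univ) module \<Rightarrow>\<^sub>0 int) set \<Rightarrow>
      (('a, 'a univ) module \<Rightarrow>\<^sub>0 int) set"
  where "K0_syzygy R =
    (\<lambda>C. the_elem ((\<lambda>x. K0_of R (frag_extend (\<lambda>M. frag_of (syzygy R M)) x)) ` C))"

definition indecomposable :: "('a, 'c) ring_scheme \<Rightarrow> ('a, 'm) module \<Rightarrow> bool"
  where "indecomposable R M \<longleftrightarrow> carrier M \<noteq> {\<zero>\<^bsub>M\<^esub>} \<and>
    (\<forall>A \<in> mod_cat R. \<forall>B \<in> mod_cat R. mod_isomorphic R M (direct_sum A B) \<longrightarrow>
      carrier A = {\<zero>\<^bsub>A\<^esub>} \<or> carrier B = {\<zero>\<^bsub>B\<^esub>})"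

definition add_subgroup ::
    "('a, 'c) ring_scheme \<Rightarrow> ('a, 'm) module \<Rightarrow> (('a, 'a univ) module \<Rightarrow>\<^sub>0 int) set set"
  where "add_subgroup R M = generate (K0 R)
    {K0_of R (frag_of N) |N. N \<in> mod_cat R \<and> indecomposable R N \<and>
      (\<exists>N' \<in> mod_cat R. mod_isomorphic R M (direct_sum N N'))}"

definition IT_phi :: "('a, 'c) ring_scheme \<Rightarrow> ('a, 'm) module \<Rightarrow> nat"
  where "IT_phi R M = (LEAST n. \<forall>s\<ge>n.
    K0_syzygy R \<in> iso
      ((K0 R)\<lparr>carrier := (K0_syzygy R ^^ s) ` add_subgroup R M\<rparr>)
      ((K0 R)\<lparr>carrier := (K0_syzygy R ^^ Suc s) ` add_subgroup R M\<rparr>))"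

definition IT_phi_dim :: "('a, 'c) ring_scheme \<Rightarrow> enat"
  where "IT_phi_dim R = (SUP M \<in> mod_cat R. enat (IT_phi R M))"

end

theory Submission
  imports Defs
begin

text \<open>
  Write \<open>B\<close> for \<open>\<Lambda> Quot \<AA>\<close> and \<open>d\<close> for the projective dimension of \<open>B\<close> over \<open>\<Lambda>\<close>. Two homomorphisms between the
  stable Grothendieck groups compare the syzygy operators. By additivity of syzygies on short exact
  sequences up to terms of finite projective dimension, \<open>X \<mapsto> \<Omega>\<^sub>\<Lambda>\<^sup>d X\<close> is well defined from \<open>K\<^sub>0 B\<close>
  to \<open>K\<^sub>0 \<Lambda>\<close> and intertwines \<open>\<Omega>\<^sub>B\<close> with \<open>\<Omega>\<^sub>\<Lambda>\<close>. In the other direction, \<open>M \<mapsto> M / \<AA> M\<close> is well defined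
  from \<open>K\<^sub>0 \<Lambda>\<close> to \<open>K\<^sub>0 B\<close>. As \<open>\<AA>\<close> is strong idempotent, it takes a projective resolution of a \<open>B\<close>-module
  \<open>X\<close> over \<open>\<Lambda>\<close> to one over \<open>B\<close>, so it takes \<open>\<Omega>\<^sub>\<Lambda>\<^sup>s X\<close> to \<open>\<Omega>\<^sub>B\<^sup>s X\<close>. Let \<open>z\<close> be a combination of
  indecomposable summands of \<open>X\<close> and let \<open>s\<close> be at least the value of \<open>\<phi>\<close> for \<open>X\<close> over \<open>\<Lambda>\<close>. If
  \<open>\<Omega>\<^sub>B\<close> kills \<open>\<Omega>\<^sub>B\<^sup>s z\<close>, then the first homomorphism gives that \<open>\<Omega>\<^sub>\<Lambda>\<close> kills \<open>\<Omega>\<^sub>\<Lambda>\<^sup>s\<^sup>+\<^sup>d z\<close>, hence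
  \<open>\<Omega>\<^sub>\<Lambda>\<^sup>s z = 0\<close> by injectivity, and the second one gives \<open>\<Omega>\<^sub>B\<^sup>s z = 0\<close>.

  Over \<open>\<Lambda>\<close> the least number in the definition of \<open>\<phi>\<close> must be shown to exist: the indecomposable
  summands of a module of finite length fall into finitely many isomorphism classes, so the kernels
  of the powers of \<open>\<Omega>\<close> form an ascending chain in a finitely generated abelian group.
\<close>

section \<open>Modules and module maps\<close>

text \<open>Restriction of scalars alone need not induce a map of stable Grothendieck groups,
  because a projective module over the quotient need not be projective over the algebra. Being a
  summand of a power of the quotient, it has a class that dies after \<open>d\<close> syzygies,
  which explains the shift by \<open>d\<close>. The price is that a relation over the quotient shows
  up over the algebra only \<open>d\<close> stages later. It can be pulled back to stage
  \<open>s\<close> because \<open>\<phi>\<close> asks for an isomorphism at every stage from some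
  point on. The return by base change costs no shift: the vanishing of Tor that keeps resolutions
  exact is extracted from surjectivity on Ext in positive degrees, with base changes of syzygies as
  coefficients. Two obstacles shape the text. Sums, quotients and change of scalars alter HOL types,
  so modules enter the Grothendieck group through isomorphic copies of a fixed type, and classes are
  compared as formal sums. And \<open>artinian_cring\<close> gives only descending chains of ideals
  of the ground ring, so the ascending chain condition has to be derived before lengths are
  available.\<close>

lemma (in abelian_group) minus_eq_zero_iff:
  assumes "x \<in> carrier G" "y \<in> carrier G"
  shows "x \<ominus> y = \<zero> \<longleftrightarrow> x = y"
proof -
  have "x = (x \<ominus> y) \<oplus> y" using assms by (simp add: a_minus_def a_assoc l_neg)
  then show ?thesis using assms by (metis a_minus_def l_zero r_neg)
qed

text \<open>Additive inverses come from the scalar minus one: by \<open>distr\<close>,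
  \<open>unit\<close> and \<open>null\<close> it sends \<open>x\<close> to an inverse of
  \<open>x\<close>. Concrete modules can thus be built without exhibiting a negation.\<close>

lemma left_moduleI:
  assumes "ring R" and "\<zero>\<^bsub>M\<^esub> \<in> carrier M"
    and "\<And>x y. x \<in> carrier M \<Longrightarrow> y \<in> carrier M \<Longrightarrow> x \<oplus>\<^bsub>M\<^esub> y \<in> carrier M"
    and "\<And>x y z. x \<in> carrier M \<Longrightarrow> y \<in> carrier M \<Longrightarrow> z \<in> carrier M \<Longrightarrow>
      (x \<oplus>\<^bsub>M\<^esub> y) \<oplus>\<^bsub>M\<^esub> z = x \<oplus>\<^bsub>M\<^esub> (y \<oplus>\<^bsub>M\<^esub> z)"
    and "\<And>x y. x \<in> carrier M \<Longrightarrow> y \<in> carrier M \<Longrightarrow> x \<oplus>\<^bsub>M\<^esub> y = y \<oplus>\<^bsub>M\<^esub> x"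
    and "\<And>x. x \<in> carrier M \<Longrightarrow> \<zero>\<^bsub>M\<^esub> \<oplus>\<^bsub>M\<^esub> x = x"
    and smult_closed: "\<And>a x. a \<in> carrier R \<Longrightarrow> x \<in> carrier M \<Longrightarrow> a \<odot>\<^bsub>M\<^esub> x \<in> carrier M"
    and distr: "\<And>a b x. a \<in> carrier R \<Longrightarrow> b \<in> carrier R \<Longrightarrow> x \<in> carrier M \<Longrightarrow>
      (a \<oplus>\<^bsub>R\<^esub> b) \<odot>\<^bsub>M\<^esub> x = a \<odot>\<^bsub>M\<^esub> x \<oplus>\<^bsub>M\<^esub> b \<odot>\<^bsub>M\<^esub> x"
    and "\<And>a x y. a \<in> carrier R \<Longrightarrow> x \<in> carrier M \<Longrightarrow> y \<in> carrier M \<Longrightarrow>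
      a \<odot>\<^bsub>M\<^esub> (x \<oplus>\<^bsub>M\<^esub> y) = a \<odot>\<^bsub>M\<^esub> x \<oplus>\<^bsub>M\<^esub> a \<odot>\<^bsub>M\<^esub> y"
    and "\<And>a b x. a \<in> carrier R \<Longrightarrow> b \<in> carrier R \<Longrightarrow> x \<in> carrier M \<Longrightarrow>
      (a \<otimes>\<^bsub>R\<^esub> b) \<odot>\<^bsub>M\<^esub> x = a \<odot>\<^bsub>M\<^esub> (b \<odot>\<^bsub>M\<^esub> x)"
    and unit: "\<And>x. x \<in> carrier M \<Longrightarrow> \<one>\<^bsub>R\<^esub> \<odot>\<^bsub>M\<^esub> x = x"
    and null: "\<And>x. x \<in> carrier M \<Longrightarrow> \<zero>\<^bsub>R\<^esub> \<odot>\<^bsub>M\<^esub> x = \<zero>\<^bsub>M\<^esub>"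
  shows "left_module R M"
proof -
  interpret ring R by fact
  have "abelian_group M"
  proof (rule abelian_groupI)
    fix x assume x: "x \<in> carrier M"
    have "(\<ominus>\<^bsub>R\<^esub> \<one>\<^bsub>R\<^esub>) \<odot>\<^bsub>M\<^esub> x \<oplus>\<^bsub>M\<^esub> x = (\<ominus>\<^bsub>R\<^esub> \<one>\<^bsub>R\<^esub> \<oplus>\<^bsub>R\<^esub> \<one>\<^bsub>R\<^esub>) \<odot>\<^bsub>M\<^esub> x"
      using distr[of "\<ominus>\<^bsub>R\<^esub> \<one>\<^bsub>R\<^esub>" "\<one>\<^bsub>R\<^esub>" x] unit x by simp
    also have "\<dots> = \<zero>\<^bsub>M\<^esub>" using null x by (simp add: l_neg)
    finally show "\<exists>y \<in> carrier M. y \<oplus>\<^bsub>M\<^esub> x = \<zero>\<^bsub>M\<^esub>"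
      using x smult_closed[of "\<ominus>\<^bsub>R\<^esub> \<one>\<^bsub>R\<^esub>" x] by auto
  qed (use assms in auto)
  then show ?thesis
    using assms by (simp add: left_module_def left_module_axioms_def)
qed

text \<open>The axioms are equations and closure properties, which pass along a surjection that
  respects the operations. This is how the quotient \<open>base_change\<close> is seen to be a
  module.\<close>

lemma left_module_image:
  assumes M: "left_module R M" and surj: "f ` carrier M = carrier N"
    and add: "\<And>x y. x \<in> carrier M \<Longrightarrow> y \<in> carrier M \<Longrightarrow> f x \<oplus>\<^bsub>N\<^esub> f y = f (x \<oplus>\<^bsub>M\<^esub> y)"
    and smult: "\<And>a x. a \<in> carrier R \<Longrightarrow> x \<in> carrier M \<Longrightarrow> a \<odot>\<^bsub>N\<^esub> f x = f (a \<odot>\<^bsub>M\<^esub> x)"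
    and zero: "\<zero>\<^bsub>N\<^esub> = f \<zero>\<^bsub>M\<^esub>"
  shows "left_module R N"
proof -
  interpret M: left_module R M by fact
  show ?thesis
    by (rule left_moduleI)
      (auto simp: surj[symmetric] add smult zero M.zero_smult M.R.ring_axioms M.smult_closed
        M.smult_l_distr M.smult_r_distr M.smult_assoc1 M.smult_one M.M.a_ac)
qed

text \<open>The non-extensional counterpart of \<open>mod_hom\<close>: plain compositions and lambda
  terms qualify without being cut off outside the carrier. \<open>mod_hom_restrict\<close> and
  \<open>module_map_of_hom\<close> translate between the two.\<close>

definition module_map ::
    "('a, 'c) ring_scheme \<Rightarrow> ('a, 'm) module \<Rightarrow> ('a, 'n) module \<Rightarrow> ('m \<Rightarrow> 'n) \<Rightarrow> bool"
  where "module_map R M N f \<longleftrightarrow> (\<forall>x \<in> carrier M. f x \<in> carrier N) \<and>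
    (\<forall>x \<in> carrier M. \<forall>y \<in> carrier M. f (x \<oplus>\<^bsub>M\<^esub> y) = f x \<oplus>\<^bsub>N\<^esub> f y) \<and>
    (\<forall>a \<in> carrier R. \<forall>x \<in> carrier M. f (a \<odot>\<^bsub>M\<^esub> x) = a \<odot>\<^bsub>N\<^esub> f x)"

lemma module_mapD:
  assumes "module_map R M N f"
  shows "x \<in> carrier M \<Longrightarrow> f x \<in> carrier N"
    and "x \<in> carrier M \<Longrightarrow> y \<in> carrier M \<Longrightarrow> f (x \<oplus>\<^bsub>M\<^esub> y) = f x \<oplus>\<^bsub>N\<^esub> f y"
    and "a \<in> carrier R \<Longrightarrow> x \<in> carrier M \<Longrightarrow> f (a \<odot>\<^bsub>M\<^esub> x) = a \<odot>\<^bsub>N\<^esub> f x"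
  using assms by (auto simp: module_map_def)

lemma submodule_iff:
  assumes "left_module R M"
  shows "submodule K R M \<longleftrightarrow> K \<subseteq> carrier M \<and> \<zero>\<^bsub>M\<^esub> \<in> K \<and>
    (\<forall>x \<in> K. \<forall>y \<in> K. x \<oplus>\<^bsub>M\<^esub> y \<in> K) \<and> (\<forall>a \<in> carrier R. \<forall>x \<in> K. a \<odot>\<^bsub>M\<^esub> x \<in> K)"
    (is "?A \<longleftrightarrow> ?B")
proof
  assume ?A
  then interpret submodule K R M .
  show ?B using subset one_closed m_closed smult_closed by auto
next
  interpret M: left_module R M by fact
  assume B: ?B
  have "subgroup K (add_monoid M)"
  proof (rule M.add.subgroupI)
    fix x assume x: "x \<in> K"
    then have "x \<in> carrier M" using B by auto
    from M.minus_smult[OF this, symmetric] show "\<ominus>\<^bsub>M\<^esub> x \<in> K" using B x by auto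
  qed (use B in auto)
  then show ?A using B by (simp add: submodule_def submodule_axioms_def)
qed

lemma submoduleD:
  assumes "submodule K R M"
  shows "K \<subseteq> carrier M" and "\<zero>\<^bsub>M\<^esub> \<in> K"
    and "x \<in> K \<Longrightarrow> y \<in> K \<Longrightarrow> x \<oplus>\<^bsub>M\<^esub> y \<in> K"
    and "x \<in> K \<Longrightarrow> \<ominus>\<^bsub>M\<^esub> x \<in> K"
    and "x \<in> K \<Longrightarrow> y \<in> K \<Longrightarrow> x \<ominus>\<^bsub>M\<^esub> y \<in> K"
    and "a \<in> carrier R \<Longrightarrow> x \<in> K \<Longrightarrow> a \<odot>\<^bsub>M\<^esub> x \<in> K"
proof -
  interpret submodule K R M by fact
  show "K \<subseteq> carrier M" "\<zero>\<^bsub>M\<^esub> \<in> K" using subset one_closed by auto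
  show "x \<in> K \<Longrightarrow> y \<in> K \<Longrightarrow> x \<oplus>\<^bsub>M\<^esub> y \<in> K" using m_closed by simp
  show *: "x \<in> K \<Longrightarrow> \<ominus>\<^bsub>M\<^esub> x \<in> K" for x using m_inv_closed by (simp add: a_inv_def)
  show "x \<in> K \<Longrightarrow> y \<in> K \<Longrightarrow> x \<ominus>\<^bsub>M\<^esub> y \<in> K" using m_closed *[of y] by (simp add: a_minus_def)
  show "a \<in> carrier R \<Longrightarrow> x \<in> K \<Longrightarrow> a \<odot>\<^bsub>M\<^esub> x \<in> K" by simp
qed

lemma left_module_submodule:
  assumes "left_module R M" and "submodule K R M"
  shows "left_module R (M\<lparr>carrier := K\<rparr>)"
proof -
  interpret M: left_module R M by fact
  have K: "K \<subseteq> carrier M" by (rule submoduleD(1)[OF assms(2)])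
  show ?thesis
    by (rule left_moduleI)
      (use submoduleD[OF assms(2)] K in \<open>auto simp: subset_iff M.zero_smult M.R.ring_axioms
        M.smult_l_distr M.smult_r_distr M.smult_assoc1 M.smult_one M.M.a_ac\<close>)
qed

lemma submodule_carrier: "left_module R M \<Longrightarrow> submodule (carrier M) R M"
  by (subst submodule_iff) (auto simp: left_module_def left_module_axioms_def abelian_group_def
      abelian_monoid.zero_closed abelian_monoid.a_closed)

lemma submodule_zero:
  assumes "left_module R M"
  shows "submodule {\<zero>\<^bsub>M\<^esub>} R M"
proof -
  interpret left_module R M by fact
  show ?thesis by (subst submodule_iff[OF assms]) (auto simp: smult_zero)
qed

lemma submodule_trans:
  assumes "left_module R M" and K: "submodule K R M"
  shows "submodule L R (M\<lparr>carrier := K\<rparr>) \<longleftrightarrow> submodule L R M \<and> L \<subseteq> K"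
  using submoduleD(1)[OF K]
  by (auto simp: submodule_iff[OF assms(1)] submodule_iff[OF left_module_submodule[OF assms]])

lemma submodule_Int:
  assumes "left_module R M" and "submodule K R M" and "submodule L R M"
  shows "submodule (K \<inter> L) R M"
  using submoduleD[OF assms(2)] submoduleD[OF assms(3)] by (auto simp: submodule_iff[OF assms(1)])

context
  fixes R :: "('a, 'c) ring_scheme" and M :: "('a, 'm) module" and N :: "('a, 'n) module" and f
  assumes M: "left_module R M" and N: "left_module R N" and f: "module_map R M N f"
begin

interpretation M: left_module R M by (rule M)
interpretation N: left_module R N by (rule N)

lemma module_map_zero: "f \<zero>\<^bsub>M\<^esub> = \<zero>\<^bsub>N\<^esub>"
proof -
  have "f \<zero>\<^bsub>M\<^esub> \<oplus>\<^bsub>N\<^esub> f \<zero>\<^bsub>M\<^esub> = f \<zero>\<^bsub>M\<^esub>" using module_mapD(2)[OF f, of "\<zero>\<^bsub>M\<^esub>" "\<zero>\<^bsub>M\<^esub>"] by simp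
  then show ?thesis using module_mapD(1)[OF f M.M.zero_closed] by (metis N.M.add.r_cancel_one')
qed

lemma module_map_inv: "x \<in> carrier M \<Longrightarrow> f (\<ominus>\<^bsub>M\<^esub> x) = \<ominus>\<^bsub>N\<^esub> f x"
  using module_mapD(3)[OF f, of "\<ominus>\<^bsub>R\<^esub> \<one>\<^bsub>R\<^esub>" x] module_mapD(1)[OF f, of x]
  by (simp add: M.minus_smult N.minus_smult)

lemma module_map_minus:
  "x \<in> carrier M \<Longrightarrow> y \<in> carrier M \<Longrightarrow> f (x \<ominus>\<^bsub>M\<^esub> y) = f x \<ominus>\<^bsub>N\<^esub> f y"
  by (simp add: a_minus_def module_mapD[OF f] module_map_inv)

lemma module_map_ker: "submodule {x \<in> carrier M. f x = \<zero>\<^bsub>N\<^esub>} R M"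
  by (subst submodule_iff[OF M])
    (auto simp: module_map_zero module_mapD[OF f] M.smult_closed N.smult_zero)

lemma module_map_image:
  assumes "submodule K R M" shows "submodule (f ` K) R N"
proof -
  have "\<zero>\<^bsub>N\<^esub> \<in> f ` K" using submoduleD(2)[OF assms] module_map_zero by (metis imageI)
  then show ?thesis
    using submoduleD[OF assms]
    by (auto simp: submodule_iff[OF N] module_mapD(1)[OF f] subset_iff
        module_mapD(2)[OF f, symmetric] module_mapD(3)[OF f, symmetric])
qed

lemma module_map_vimage:
  assumes "submodule K R N" shows "submodule {x \<in> carrier M. f x \<in> K} R M"
  by (subst submodule_iff[OF M])
    (use submoduleD[OF assms] in \<open>auto simp: module_map_zero module_mapD[OF f] M.smult_closed\<close>)

lemma module_map_inj_iff:
  "inj_on f (carrier M) \<longleftrightarrow> (\<forall>x \<in> carrier M. f x = \<zero>\<^bsub>N\<^esub> \<longrightarrow> x = \<zero>\<^bsub>M\<^esub>)"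
proof (intro iffI ballI impI inj_onI)
  fix x assume "inj_on f (carrier M)" "x \<in> carrier M" "f x = \<zero>\<^bsub>N\<^esub>"
  then show "x = \<zero>\<^bsub>M\<^esub>" using module_map_zero M.M.zero_closed inj_onD by metis
next
  fix x y assume *: "\<forall>x \<in> carrier M. f x = \<zero>\<^bsub>N\<^esub> \<longrightarrow> x = \<zero>\<^bsub>M\<^esub>"
    and xy: "x \<in> carrier M" "y \<in> carrier M" "f x = f y"
  have "f (x \<ominus>\<^bsub>M\<^esub> y) = \<zero>\<^bsub>N\<^esub>" using xy by (simp add: module_map_minus module_mapD[OF f] a_minus_def[of N] N.M.r_neg)
  then have "x \<ominus>\<^bsub>M\<^esub> y = \<zero>\<^bsub>M\<^esub>" using * xy by simp
  then show "x = y" using xy by (simp add: M.M.minus_eq_zero_iff)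
qed

lemma mod_hom_restrict: "restrict f (carrier M) \<in> mod_hom R M N"
  by (auto simp: mod_hom_def module_mapD[OF f] M.smult_closed)

end

lemma module_map_of_hom: "f \<in> mod_hom R M N \<Longrightarrow> module_map R M N f"
  by (auto simp: mod_hom_def module_map_def)

lemma module_map_comp:
  "module_map R M N f \<Longrightarrow> module_map R N P g \<Longrightarrow> module_map R M P (\<lambda>x. g (f x))"
  by (simp add: module_map_def)

lemma module_map_id: "module_map R M M (\<lambda>x. x)"
  by (simp add: module_map_def)

lemma module_map_into_submodule:
  "module_map R M (N\<lparr>carrier := K\<rparr>) f \<longleftrightarrow> module_map R M N f \<and> f ` carrier M \<subseteq> K"
  if "K \<subseteq> carrier N"
  using that by (auto simp: module_map_def)

lemma module_map_on_submodule:
  "module_map R M N f \<Longrightarrow> K \<subseteq> carrier M \<Longrightarrow> module_map R (M\<lparr>carrier := K\<rparr>) N f"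
  by (auto simp: module_map_def subset_iff)

lemma module_map_add:
  assumes "left_module R M" "left_module R N" and f: "module_map R M N f" and g: "module_map R M N g"
  shows "module_map R M N (\<lambda>x. f x \<oplus>\<^bsub>N\<^esub> g x)"
proof -
  interpret M: left_module R M by fact
  interpret N: left_module R N by fact
  show ?thesis unfolding module_map_def
    using module_mapD[OF f] module_mapD[OF g] by (auto simp: N.smult_r_distr N.M.a_ac)
qed

lemma module_map_const_zero:
  assumes "left_module R N"
  shows "module_map R M N (\<lambda>x. \<zero>\<^bsub>N\<^esub>)"
proof -
  interpret N: left_module R N by fact
  show ?thesis by (auto simp: module_map_def N.smult_zero)
qed

lemma mod_isomorphic_iff:
  assumes "left_module R M" "left_module R N"
  shows "mod_isomorphic R M N \<longleftrightarrow> (\<exists>f. module_map R M N f \<and> bij_betw f (carrier M) (carrier N))"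
proof
  assume "mod_isomorphic R M N"
  then show "\<exists>f. module_map R M N f \<and> bij_betw f (carrier M) (carrier N)"
    by (auto simp: mod_isomorphic_def intro: module_map_of_hom)
next
  assume "\<exists>f. module_map R M N f \<and> bij_betw f (carrier M) (carrier N)"
  then obtain f where f: "module_map R M N f" "bij_betw f (carrier M) (carrier N)" by blast
  have "bij_betw (restrict f (carrier M)) (carrier M) (carrier N)"
    using f(2) by (simp add: bij_betw_def inj_on_restrict_eq)
  then show "mod_isomorphic R M N"
    using mod_hom_restrict[OF assms f(1)] unfolding mod_isomorphic_def by blast
qed

lemma module_map_inv_into:
  assumes M: "left_module R M" and f: "module_map R M N f" and bij: "bij_betw f (carrier M) (carrier N)"
  shows "module_map R N M (inv_into (carrier M) f)"
proof -
  interpret M: left_module R M by fact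
  let ?g = "inv_into (carrier M) f"
  have inj: "inj_on f (carrier M)" using bij by (simp add: bij_betw_def)
  have surj: "carrier N = f ` carrier M" using bij by (simp add: bij_betw_def)
  have gf: "?g (f x) = x" if "x \<in> carrier M" for x using that inj by simp
  show ?thesis unfolding module_map_def surj
    by (auto simp: gf module_mapD(2)[OF f, symmetric] module_mapD(3)[OF f, symmetric] M.smult_closed)
qed

lemma mod_isomorphic_refl: "left_module R M \<Longrightarrow> mod_isomorphic R M M"
  by (subst mod_isomorphic_iff) (auto intro!: exI[of _ "\<lambda>x. x"] module_map_id simp: bij_betw_def)

lemma mod_isomorphic_sym:
  assumes "left_module R M" "left_module R N" and "mod_isomorphic R M N"
  shows "mod_isomorphic R N M"
proof -
  from assms obtain f where f: "module_map R M N f" "bij_betw f (carrier M) (carrier N)"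
    by (auto simp: mod_isomorphic_iff)
  show ?thesis
    using module_map_inv_into[OF assms(1) f] bij_betw_inv_into[OF f(2)] assms
    by (auto simp: mod_isomorphic_iff)
qed

lemma mod_isomorphic_trans:
  assumes "left_module R M" "left_module R N" "left_module R P"
    and "mod_isomorphic R M N" "mod_isomorphic R N P"
  shows "mod_isomorphic R M P"
proof -
  from assms obtain f g where f: "module_map R M N f" "bij_betw f (carrier M) (carrier N)"
    and g: "module_map R N P g" "bij_betw g (carrier N) (carrier P)"
    by (auto simp: mod_isomorphic_iff)
  show ?thesis
    using module_map_comp[OF f(1) g(1)] bij_betw_trans[OF f(2) g(2)] assms
    by (auto simp: mod_isomorphic_iff o_def)
qed

section \<open>Direct sums\<close>

lemma direct_sum_sel [simp]:
  "carrier (direct_sum M N) = carrier M \<times> carrier N"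
  "\<zero>\<^bsub>direct_sum M N\<^esub> = (\<zero>\<^bsub>M\<^esub>, \<zero>\<^bsub>N\<^esub>)"
  "p \<oplus>\<^bsub>direct_sum M N\<^esub> q = (fst p \<oplus>\<^bsub>M\<^esub> fst q, snd p \<oplus>\<^bsub>N\<^esub> snd q)"
  "a \<odot>\<^bsub>direct_sum M N\<^esub> p = (a \<odot>\<^bsub>M\<^esub> fst p, a \<odot>\<^bsub>N\<^esub> snd p)"
  by (simp_all add: direct_sum_def case_prod_beta)

lemma left_module_direct_sum:
  assumes "left_module R M" "left_module R N"
  shows "left_module R (direct_sum M N)"
proof -
  interpret M: left_module R M by fact
  interpret N: left_module R N by fact
  show ?thesis
    by (rule left_moduleI)
      (auto simp: M.R.ring_axioms M.zero_smult M.smult_closed N.smult_closed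
        M.smult_l_distr M.smult_r_distr M.smult_assoc1 M.smult_one M.M.a_ac
        N.smult_l_distr N.smult_r_distr N.smult_assoc1 N.smult_one N.M.a_ac N.zero_smult)
qed

lemma module_map_fst: "module_map R (direct_sum M N) M fst"
  and module_map_snd: "module_map R (direct_sum M N) N snd"
  by (auto simp: module_map_def)

lemma module_map_Pair_left:
  assumes "left_module R N" shows "module_map R M (direct_sum M N) (\<lambda>x. (x, \<zero>\<^bsub>N\<^esub>))"
proof -
  interpret N: left_module R N by fact
  show ?thesis by (auto simp: module_map_def N.smult_zero)
qed

lemma module_map_Pair_right:
  assumes "left_module R M" shows "module_map R N (direct_sum M N) (\<lambda>x. (\<zero>\<^bsub>M\<^esub>, x))"
proof -
  interpret M: left_module R M by fact
  show ?thesis by (auto simp: module_map_def M.smult_zero)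
qed

lemma module_map_map_prod:
  "module_map R M M' f \<Longrightarrow> module_map R N N' g \<Longrightarrow>
    module_map R (direct_sum M N) (direct_sum M' N') (map_prod f g)"
  by (auto simp: module_map_def)

lemma mod_isomorphic_direct_sum:
  assumes "left_module R M" "left_module R M'" "left_module R N" "left_module R N'"
    and "mod_isomorphic R M M'" "mod_isomorphic R N N'"
  shows "mod_isomorphic R (direct_sum M N) (direct_sum M' N')"
proof -
  from assms obtain f g where f: "module_map R M M' f" "bij_betw f (carrier M) (carrier M')"
    and g: "module_map R N N' g" "bij_betw g (carrier N) (carrier N')"
    by (auto simp: mod_isomorphic_iff)
  show ?thesis
    using module_map_map_prod[OF f(1) g(1)] bij_betw_map_prod[OF f(2) g(2)] assms(1-4)
    by (auto simp: mod_isomorphic_iff left_module_direct_sum map_prod_def)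
qed

lemma direct_sum_assoc:
  assumes "left_module R M" "left_module R N" "left_module R P"
  shows "mod_isomorphic R (direct_sum (direct_sum M N) P) (direct_sum M (direct_sum N P))"
proof -
  have "bij_betw (\<lambda>((x, y), z). (x, y, z)) ((carrier M \<times> carrier N) \<times> carrier P)
      (carrier M \<times> carrier N \<times> carrier P)"
    by (rule bij_betwI[where g = "\<lambda>(x, y, z). ((x, y), z)"]) auto
  then show ?thesis
    using assms by (subst mod_isomorphic_iff)
      (auto simp: left_module_direct_sum module_map_def intro!: exI[of _ "\<lambda>((x, y), z). (x, y, z)"])
qed

lemma direct_sum_comm:
  assumes "left_module R M" "left_module R N"
  shows "mod_isomorphic R (direct_sum M N) (direct_sum N M)"
proof -
  have "bij_betw prod.swap (carrier M \<times> carrier N) (carrier N \<times> carrier M)"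
    by (rule bij_betwI[where g = prod.swap]) auto
  then show ?thesis
    using assms by (subst mod_isomorphic_iff)
      (auto simp: left_module_direct_sum module_map_def intro!: exI[of _ prod.swap])
qed

abbreviation ker_mod ::
    "('a, 'm) module \<Rightarrow> ('m \<Rightarrow> 'n) \<Rightarrow> ('a, 'n) module \<Rightarrow> ('a, 'm) module"
  where "ker_mod M f N \<equiv> M\<lparr>carrier := {x \<in> carrier M. f x = \<zero>\<^bsub>N\<^esub>}\<rparr>"

lemma left_module_ker:
  "left_module R M \<Longrightarrow> left_module R N \<Longrightarrow> module_map R M N f \<Longrightarrow> left_module R (ker_mod M f N)"
  by (simp add: left_module_submodule module_map_ker)

text \<open>The map sending \<open>(x, y)\<close> to \<open>x + h y\<close> has the inverse that
  sends \<open>x\<close> to \<open>(x - h (g x), g x)\<close>; the latter supplies the preimage in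
  the proof of surjectivity.\<close>

lemma split_surjection:
  assumes M: "left_module R M" and N: "left_module R N" and g: "module_map R M N g" and h: "module_map R N M h"
    and gh: "\<And>y. y \<in> carrier N \<Longrightarrow> g (h y) = y"
  shows "mod_isomorphic R M (direct_sum (ker_mod M g N) N)"
proof -
  interpret M: left_module R M by fact
  interpret N: left_module R N by fact
  let ?K = "{x \<in> carrier M. g x = \<zero>\<^bsub>N\<^esub>}"
  let ?f = "\<lambda>p. fst p \<oplus>\<^bsub>M\<^esub> h (snd p)"
  have K: "left_module R (ker_mod M g N)" by (rule left_module_ker[OF M N g])
  note L = left_module_direct_sum[OF K N]
  have f: "module_map R (direct_sum (ker_mod M g N) N) M ?f"
    by (auto simp: module_map_def module_mapD[OF h] M.smult_closed M.smult_r_distr M.M.a_ac)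
  have inj: "inj_on ?f (carrier (direct_sum (ker_mod M g N) N))"
    unfolding module_map_inj_iff[OF L M f]
  proof (intro ballI impI)
    fix p assume "p \<in> carrier (direct_sum (ker_mod M g N) N)" and fp: "?f p = \<zero>\<^bsub>M\<^esub>"
    then obtain x y where p: "p = (x, y)" "x \<in> carrier M" "g x = \<zero>\<^bsub>N\<^esub>" "y \<in> carrier N" by auto
    have "g (?f p) = y" using p by (simp add: module_mapD[OF g] module_mapD[OF h] gh)
    then have "y = \<zero>\<^bsub>N\<^esub>" using fp module_map_zero[OF M N g] by simp
    then show "p = \<zero>\<^bsub>direct_sum (ker_mod M g N) N\<^esub>"
      using fp p module_map_zero[OF N M h] by simp
  qed
  have "x \<in> ?f ` (?K \<times> carrier N)" if x: "x \<in> carrier M" for x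
  proof -
    have c: "g x \<in> carrier N" "h (g x) \<in> carrier M" using x by (simp_all add: module_mapD[OF g] module_mapD[OF h])
    have "x \<ominus>\<^bsub>M\<^esub> h (g x) \<in> ?K"
      using x c by (simp add: module_map_minus[OF M N g] gh a_minus_def[of N] N.M.r_neg)
    moreover have "x = (x \<ominus>\<^bsub>M\<^esub> h (g x)) \<oplus>\<^bsub>M\<^esub> h (g x)"
      using x c by (simp add: a_minus_def M.M.a_assoc M.M.l_neg)
    ultimately show ?thesis using c by (auto intro!: image_eqI[of _ _ "(x \<ominus>\<^bsub>M\<^esub> h (g x), g x)"])
  qed
  then have "?f ` carrier (direct_sum (ker_mod M g N) N) = carrier M"
    using module_mapD(1)[OF f] by auto
  with inj f have "mod_isomorphic R (direct_sum (ker_mod M g N) N) M"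
    using L M by (auto simp: mod_isomorphic_iff bij_betw_def)
  then show ?thesis by (rule mod_isomorphic_sym[OF L M])
qed

lemma direct_sum_zero_object:
  assumes M: "left_module R M" and Z: "left_module R Z" "carrier Z = {\<zero>\<^bsub>Z\<^esub>}"
  shows "mod_isomorphic R M (direct_sum M Z)"
proof -
  have "bij_betw (\<lambda>x. (x, \<zero>\<^bsub>Z\<^esub>)) (carrier M) (carrier (direct_sum M Z))"
    by (rule bij_betwI[where g = fst]) (auto simp: Z(2))
  then show ?thesis using module_map_Pair_left[OF Z(1), of M] M Z
    by (auto simp: mod_isomorphic_iff left_module_direct_sum)
qed

text \<open>An equality of records and not just an isomorphism: passing to a kernel changes only the
  carrier, and the carriers agree because an injective \<open>f\<close> vanishes only at zero. Goals
  can be rewritten with it.\<close>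

lemma ker_mod_direct_sum:
  assumes A: "left_module R A" and B: "left_module R B" and C: "left_module R C"
    and p: "module_map R P A p" and q: "module_map R Q B q"
    and f: "module_map R (direct_sum A B) C f" and inj: "inj_on f (carrier (direct_sum A B))"
  shows "ker_mod (direct_sum P Q) (\<lambda>z. f (p (fst z), q (snd z))) C = direct_sum (ker_mod P p A) (ker_mod Q q B)"
proof -
  have f0: "f (\<zero>\<^bsub>A\<^esub>, \<zero>\<^bsub>B\<^esub>) = \<zero>\<^bsub>C\<^esub>"
    using module_map_zero[OF left_module_direct_sum[OF A B] C f] by simp
  have "f z = \<zero>\<^bsub>C\<^esub> \<longleftrightarrow> z = \<zero>\<^bsub>direct_sum A B\<^esub>" if "z \<in> carrier (direct_sum A B)" for z
    using inj that module_map_zero[OF left_module_direct_sum[OF A B] C f]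
    unfolding module_map_inj_iff[OF left_module_direct_sum[OF A B] C f] by auto
  then have "{z \<in> carrier (direct_sum P Q). f (p (fst z), q (snd z)) = \<zero>\<^bsub>C\<^esub>} =
      {x \<in> carrier P. p x = \<zero>\<^bsub>A\<^esub>} \<times> {x \<in> carrier Q. q x = \<zero>\<^bsub>B\<^esub>}"
    by (auto simp: module_mapD(1)[OF p] module_mapD(1)[OF q] f0)
  then show ?thesis by (simp add: direct_sum_def)
qed

lemma ker_mod_inj:
  assumes "left_module R M" "left_module R N" "module_map R M N f" "inj_on f (carrier M)"
  shows "carrier (ker_mod M f N) = {\<zero>\<^bsub>ker_mod M f N\<^esub>}"
proof -
  interpret left_module R M by fact
  show ?thesis using assms(4) module_map_zero[OF assms(1-3)] unfolding module_map_inj_iff[OF assms(1-3)] by auto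
qed

lemma map_direct_sum_surj:
  assumes "p ` carrier P = carrier A" "q ` carrier Q = carrier B" "f ` carrier (direct_sum A B) = carrier C"
  shows "(\<lambda>z. f (p (fst z), q (snd z))) ` carrier (direct_sum P Q) = carrier C"
proof -
  have "map_prod p q ` carrier (direct_sum P Q) = carrier (direct_sum A B)"
    using assms(1,2) by (simp add: map_prod_surj_on)
  then have "f ` map_prod p q ` carrier (direct_sum P Q) = carrier C" using assms(3) by simp
  then show ?thesis by (simp add: image_image map_prod_def case_prod_beta)
qed

lemma module_map_direct_sum_comp:
  assumes "module_map R P A p" "module_map R Q B q" "module_map R (direct_sum A B) C f"
  shows "module_map R (direct_sum P Q) C (\<lambda>z. f (p (fst z), q (snd z)))"
  using module_map_comp[OF module_map_map_prod[OF assms(1,2)] assms(3)] by (simp add: map_prod_def case_prod_beta)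

text \<open>Again a literal equality of records; it lets the target of a projective surjection be
  replaced by an isomorphic module.\<close>

lemma ker_mod_comp_inj:
  assumes M: "left_module R M" and N: "left_module R N" and p: "module_map R P M p"
    and f: "module_map R M N f" and inj: "inj_on f (carrier M)"
  shows "ker_mod P (\<lambda>x. f (p x)) N = ker_mod P p M"
proof -
  have "{x \<in> carrier P. f (p x) = \<zero>\<^bsub>N\<^esub>} = {x \<in> carrier P. p x = \<zero>\<^bsub>M\<^esub>}"
    using inj module_mapD(1)[OF p] module_map_zero[OF M N f] unfolding module_map_inj_iff[OF M N f] by auto
  then show ?thesis by simp
qed

lemma retract_of_summand:
  assumes L: "left_module R M" "left_module R N" "left_module R N'"
    and iso: "mod_isomorphic R M (direct_sum N N')"
  obtains i r where "module_map R N M i" "module_map R M N r" "\<And>x. x \<in> carrier N \<Longrightarrow> r (i x) = x"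
proof -
  obtain f where f: "module_map R M (direct_sum N N') f" "bij_betw f (carrier M) (carrier (direct_sum N N'))"
    using iso L by (auto simp: mod_isomorphic_iff left_module_direct_sum simp del: direct_sum_sel)
  interpret N': left_module R N' by fact
  let ?g = "inv_into (carrier M) f"
  have g: "module_map R (direct_sum N N') M ?g" by (rule module_map_inv_into[OF L(1) f])
  show thesis
  proof (rule that[OF module_map_comp[OF module_map_Pair_left[OF L(3)] g] module_map_comp[OF f(1) module_map_fst]])
    fix x assume "x \<in> carrier N"
    then have "f (?g (x, \<zero>\<^bsub>N'\<^esub>)) = (x, \<zero>\<^bsub>N'\<^esub>)" by (intro bij_betw_inv_into_right[OF f(2)]) simp
    then show "fst (f (?g (x, \<zero>\<^bsub>N'\<^esub>))) = x" by simp
  qed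
qed

lemma zero_iso:
  assumes "left_module R M" "left_module R N" "mod_isomorphic R M N" "carrier M = {\<zero>\<^bsub>M\<^esub>}"
  shows "carrier N = {\<zero>\<^bsub>N\<^esub>}"
  using assms module_map_zero[OF assms(1,2)] by (auto simp: mod_isomorphic_iff bij_betw_def)

lemma direct_sum_zero_right:
  assumes "left_module R M" "left_module R N" "carrier N = {\<zero>\<^bsub>N\<^esub>}"
  shows "mod_isomorphic R (direct_sum M N) M"
  by (rule mod_isomorphic_sym[OF assms(1) left_module_direct_sum[OF assms(1,2)] direct_sum_zero_object[OF assms]])

section \<open>Finite generation and finite length\<close>

lemma regular_module_sel [simp]:
  "carrier (regular_module R) = carrier R" "\<zero>\<^bsub>regular_module R\<^esub> = \<zero>\<^bsub>R\<^esub>"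
  "x \<oplus>\<^bsub>regular_module R\<^esub> y = x \<oplus>\<^bsub>R\<^esub> y" "a \<odot>\<^bsub>regular_module R\<^esub> x = a \<otimes>\<^bsub>R\<^esub> x"
  by (simp_all add: regular_module_def)

lemma left_module_regular:
  assumes "ring R" shows "left_module R (regular_module R)"
proof -
  interpret ring R by fact
  show ?thesis
    by (rule left_moduleI) (auto simp: assms a_ac l_distr r_distr m_assoc)
qed

text \<open>Tuples of all lengths share one type and are padded with zeros, so that a tuple is
  itself a coefficient function for \<open>lin_comb\<close>.\<close>

definition free_module :: "('a, 'c) ring_scheme \<Rightarrow> nat \<Rightarrow> ('a, nat \<Rightarrow> 'a) module"
  where "free_module R n =
    \<lparr>carrier = {c. range c \<subseteq> carrier R \<and> (\<forall>i\<ge>n. c i = \<zero>\<^bsub>R\<^esub>)}, monoid.mult = undefined, one = undefined,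
     ring.zero = (\<lambda>_. \<zero>\<^bsub>R\<^esub>), add = (\<lambda>c d i. c i \<oplus>\<^bsub>R\<^esub> d i), smult = (\<lambda>a c i. a \<otimes>\<^bsub>R\<^esub> c i)\<rparr>"

lemma free_module_sel [simp]:
  "carrier (free_module R n) = {c. range c \<subseteq> carrier R \<and> (\<forall>i\<ge>n. c i = \<zero>\<^bsub>R\<^esub>)}"
  "\<zero>\<^bsub>free_module R n\<^esub> = (\<lambda>_. \<zero>\<^bsub>R\<^esub>)"
  "c \<oplus>\<^bsub>free_module R n\<^esub> d = (\<lambda>i. c i \<oplus>\<^bsub>R\<^esub> d i)" "a \<odot>\<^bsub>free_module R n\<^esub> c = (\<lambda>i. a \<otimes>\<^bsub>R\<^esub> c i)"
  by (simp_all add: free_module_def)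

lemma left_module_free:
  assumes "ring R" shows "left_module R (free_module R n)"
proof -
  interpret ring R by fact
  show ?thesis
    by (rule left_moduleI)
      (auto simp: assms fun_eq_iff image_subset_iff a_ac l_distr r_distr m_assoc)
qed

lemma free_module_Suc:
  assumes "ring R"
  shows "mod_isomorphic R (free_module R (Suc n)) (direct_sum (regular_module R) (free_module R n))"
proof -
  let ?f = "\<lambda>c::nat \<Rightarrow> 'a. (c 0, \<lambda>i. c (Suc i))"
  have "bij_betw ?f (carrier (free_module R (Suc n)))
      (carrier R \<times> carrier (free_module R n))"
    by (rule bij_betwI[where g = "\<lambda>(a, c). case_nat a c"])
      (auto simp: fun_eq_iff image_subset_iff split: nat.splits)
  moreover have "module_map R (free_module R (Suc n)) (direct_sum (regular_module R) (free_module R n)) ?f"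
    by (auto simp: module_map_def image_subset_iff)
  ultimately show ?thesis
    using assms by (subst mod_isomorphic_iff)
      (auto simp: left_module_direct_sum left_module_free left_module_regular simp del: free_module_sel)
qed

lemma lin_comb_cong:
  "(\<And>i. i < length bs \<Longrightarrow> c i = d i) \<Longrightarrow> lin_comb M bs c = lin_comb M bs d"
proof (induction bs arbitrary: c d)
  case (Cons b bs)
  have "lin_comb M bs (\<lambda>i. c (Suc i)) = lin_comb M bs (\<lambda>i. d (Suc i))"
    using Cons.prems by (intro Cons.IH) simp
  then show ?case using Cons.prems[of 0] by simp
qed simp

lemma lin_comb_mem_submodule:
  "submodule N R M \<Longrightarrow> set bs \<subseteq> N \<Longrightarrow> range c \<subseteq> carrier R \<Longrightarrow> lin_comb M bs c \<in> N"
proof (induction bs arbitrary: c)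
  case (Cons b bs)
  have "range (\<lambda>i. c (Suc i)) \<subseteq> carrier R" "c 0 \<in> carrier R" using Cons.prems by auto
  then show ?case using Cons by (auto intro!: submoduleD)
qed (simp add: submoduleD)

lemma fg_module_iff_lin_comb:
  assumes "left_module R M"
  shows "fg_module R M \<longleftrightarrow>
    (\<exists>bs. set bs \<subseteq> carrier M \<and> {lin_comb M bs c |c. range c \<subseteq> carrier R} = carrier M)"
proof
  interpret left_module R M by fact
  assume "fg_module R M"
  then obtain B where B: "finite B" "B \<subseteq> carrier M"
    and gen: "\<And>N. submodule N R M \<Longrightarrow> B \<subseteq> N \<Longrightarrow> N = carrier M" by (auto simp: fg_module_def)
  obtain bs where bs: "set bs = B" using finite_list[OF B(1)] by blast
  have "{lin_comb M bs c |c. range c \<subseteq> carrier R} = carrier M"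
  proof (rule gen)
    show "B \<subseteq> {lin_comb M bs c |c. range c \<subseteq> carrier R}"
      using lin_comb_generator[of bs] bs B by blast
  qed (use submodule_lin_comb bs B in simp)
  then show "\<exists>bs. set bs \<subseteq> carrier M \<and> {lin_comb M bs c |c. range c \<subseteq> carrier R} = carrier M"
    using bs B by blast
next
  assume "\<exists>bs. set bs \<subseteq> carrier M \<and> {lin_comb M bs c |c. range c \<subseteq> carrier R} = carrier M"
  then obtain bs where bs: "set bs \<subseteq> carrier M" "{lin_comb M bs c |c. range c \<subseteq> carrier R} = carrier M"
    by blast
  have "N = carrier M" if N: "submodule N R M" "set bs \<subseteq> N" for N
  proof
    show "carrier M \<subseteq> N" unfolding bs(2)[symmetric] using lin_comb_mem_submodule[OF N] by auto
  qed (use submoduleD(1)[OF N(1)] in blast)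
  then show "fg_module R M" using assms bs(1) unfolding fg_module_def
    by (intro conjI exI[of _ "set bs"]) auto
qed

lemma fg_module_image:
  assumes fg: "fg_module R M" and N: "left_module R N" and f: "module_map R M N f"
    and surj: "f ` carrier M = carrier N"
  shows "fg_module R N"
proof -
  have M: "left_module R M" using fg by (simp add: fg_module_def)
  obtain B where B: "finite B" "B \<subseteq> carrier M"
    and gen: "\<And>N. submodule N R M \<Longrightarrow> B \<subseteq> N \<Longrightarrow> N = carrier M" using fg by (auto simp: fg_module_def)
  have "L = carrier N" if L: "submodule L R N" "f ` B \<subseteq> L" for L
  proof -
    have all: "{x \<in> carrier M. f x \<in> L} = carrier M"
      by (rule gen) (use L B module_map_vimage[OF M N f] in auto)
    show ?thesis
    proof
      show "carrier N \<subseteq> L" unfolding surj[symmetric] using all by auto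
    qed (rule submoduleD(1)[OF L(1)])
  qed
  then show ?thesis using B surj N unfolding fg_module_def
    by (intro conjI exI[of _ "f ` B"]) auto
qed

lemma fg_module_left_module: "fg_module R M \<Longrightarrow> left_module R M"
  by (simp add: fg_module_def)

lemma fg_module_iso:
  assumes "fg_module R M" "left_module R N" "mod_isomorphic R M N"
  shows "fg_module R N"
  using assms fg_module_image[OF assms(1,2)]
  by (auto simp: mod_isomorphic_iff fg_module_left_module bij_betw_def)

lemma fg_module_regular:
  assumes "ring R" shows "fg_module R (regular_module R)"
proof -
  interpret ring R by fact
  have "N = carrier R" if N: "submodule N R (regular_module R)" "\<one>\<^bsub>R\<^esub> \<in> N" for N
  proof
    show "N \<subseteq> carrier R" using submoduleD(1)[OF N(1)] by simp
    show "carrier R \<subseteq> N" using submoduleD(6)[OF N(1) _ N(2)] by auto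
  qed
  then show ?thesis using left_module_regular[OF assms] unfolding fg_module_def
    by (intro conjI exI[of _ "{\<one>\<^bsub>R\<^esub>}"]) auto
qed

lemma fg_module_direct_sum:
  assumes "fg_module R M" "fg_module R N"
  shows "fg_module R (direct_sum M N)"
proof -
  have M: "left_module R M" and N: "left_module R N" using assms by (simp_all add: fg_module_def)
  interpret M: left_module R M by fact
  interpret N: left_module R N by fact
  obtain B where B: "finite B" "B \<subseteq> carrier M"
    and genB: "\<And>N. submodule N R M \<Longrightarrow> B \<subseteq> N \<Longrightarrow> N = carrier M" using assms(1) by (auto simp: fg_module_def)
  obtain C where C: "finite C" "C \<subseteq> carrier N"
    and genC: "\<And>K. submodule K R N \<Longrightarrow> C \<subseteq> K \<Longrightarrow> K = carrier N" using assms(2) by (auto simp: fg_module_def)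
  let ?S = "(\<lambda>x. (x, \<zero>\<^bsub>N\<^esub>)) ` B \<union> (\<lambda>y. (\<zero>\<^bsub>M\<^esub>, y)) ` C"
  have "L = carrier (direct_sum M N)" if L: "submodule L R (direct_sum M N)" "?S \<subseteq> L" for L
  proof
    have B': "{x \<in> carrier M. (x, \<zero>\<^bsub>N\<^esub>) \<in> L} = carrier M"
      by (rule genB) (use L B module_map_vimage[OF M left_module_direct_sum[OF M N]
          module_map_Pair_left[OF N] L(1)] in auto)
    have C': "{x \<in> carrier N. (\<zero>\<^bsub>M\<^esub>, x) \<in> L} = carrier N"
      by (rule genC) (use L C module_map_vimage[OF N left_module_direct_sum[OF M N]
          module_map_Pair_right[OF M] L(1)] in auto)
    show "carrier (direct_sum M N) \<subseteq> L"
    proof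
      fix p assume "p \<in> carrier (direct_sum M N)"
      then obtain x y where p: "p = (x, y)" "x \<in> carrier M" "y \<in> carrier N" by auto
      then have "(x, \<zero>\<^bsub>N\<^esub>) \<in> L" "(\<zero>\<^bsub>M\<^esub>, y) \<in> L" using B' C' by blast+
      from submoduleD(3)[OF L(1) this] show "p \<in> L" using p by simp
    qed
  qed (use submoduleD(1)[OF L(1)] in blast)
  moreover have "finite ?S" "?S \<subseteq> carrier (direct_sum M N)" using B C by auto
  ultimately show ?thesis
    using left_module_direct_sum[OF M N] unfolding fg_module_def by blast
qed

section \<open>Ascending and descending chain conditions\<close>

definition submodule_order ::
    "bool \<Rightarrow> ('a, 'c) ring_scheme \<Rightarrow> ('a, 'm) module \<Rightarrow> ('m set \<times> 'm set) set"
  where "submodule_order up R M =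
    {(K, L). submodule K R M \<and> submodule L R M \<and> (if up then L \<subset> K else K \<subset> L)}"

text \<open>Both chain conditions at once: \<open>submodule_order True\<close> is well-founded iff
  ascending chains stop, \<open>submodule_order False\<close> iff descending ones do. Carrying
  \<open>up\<close> as a parameter lets one proof settle both.\<close>

definition finite_length :: "('a, 'c) ring_scheme \<Rightarrow> ('a, 'm) module \<Rightarrow> bool"
  where "finite_length R M \<longleftrightarrow> (\<forall>up. wf (submodule_order up R M))"

text \<open>A strict inclusion of submodules of \<open>M\<close> stays strict after intersecting with \<open>A\<close> or after
  projecting to \<open>C\<close>, so both chain conditions follow from the lexicographic product.\<close>

lemma wf_submodule_order_exact:
  assumes A: "left_module R A" and M: "left_module R M" and C: "left_module R C"
    and i: "module_map R A M i" and p: "module_map R M C p"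
    and exact: "{x \<in> carrier M. p x = \<zero>\<^bsub>C\<^esub>} \<subseteq> i ` carrier A"
    and wfA: "wf (submodule_order up R A)" and wfC: "wf (submodule_order up R C)"
  shows "wf (submodule_order up R M)"
proof -
  interpret M: left_module R M by fact
  interpret C: left_module R C by fact
  let ?pre = "\<lambda>K. {a \<in> carrier A. i a \<in> K}"
  let ?\<phi> = "\<lambda>K. (?pre K, p ` K)"
  \<comment> \<open>If \<open>y\<close> in \<open>K\<close> and \<open>l\<close> in \<open>L\<close>
    have the same image under \<open>p\<close>, then \<open>y - l\<close> comes from
    \<open>A\<close> and lies in \<open>K\<close>, hence it already lies in
    \<open>L\<close>.\<close>
  have key: "K = L" if K: "submodule K R M" and L: "submodule L R M" and LK: "L \<subseteq> K"
    and eq: "?pre L = ?pre K" "p ` L = p ` K" for K L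
  proof
    show "K \<subseteq> L"
    proof
      fix y assume y: "y \<in> K"
      then obtain l where l: "l \<in> L" "p y = p l" using eq(2) by blast
      have c: "y \<in> carrier M" "l \<in> carrier M" using y l submoduleD(1)[OF K] submoduleD(1)[OF L] by auto
      have "p (y \<ominus>\<^bsub>M\<^esub> l) = \<zero>\<^bsub>C\<^esub>"
        using c l(2) by (simp add: module_map_minus[OF M C p] module_mapD[OF p] C.M.minus_eq_zero_iff)
      then obtain a where a: "a \<in> carrier A" "i a = y \<ominus>\<^bsub>M\<^esub> l" using exact c by (auto simp: image_iff)
      have "y \<ominus>\<^bsub>M\<^esub> l \<in> K" using submoduleD(5)[OF K y] l(1) LK by blast
      then have "a \<in> ?pre K" using a by simp
      then have "a \<in> ?pre L" using eq(1) by simp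
      then have "y \<ominus>\<^bsub>M\<^esub> l \<in> L" using a by simp
      from submoduleD(3)[OF L this l(1)] show "y \<in> L"
        using c by (simp add: a_minus_def M.M.a_assoc M.M.l_neg)
    qed
  qed (rule LK)
  have sub: "submodule (?pre K) R A" "submodule (p ` K) R C" if "submodule K R M" for K
    using module_map_vimage[OF A M i that] module_map_image[OF M C p that] .
  have mono: "?pre L \<subseteq> ?pre K" "p ` L \<subseteq> p ` K" if "L \<subseteq> K" for K L using that by auto
  have "(?\<phi> K, ?\<phi> L) \<in> submodule_order up R A <*lex*> submodule_order up R C"
    if KL: "(K, L) \<in> submodule_order up R M" for K L
  proof (cases up)
    case True
    then have s: "submodule K R M" "submodule L R M" "L \<subset> K" using KL by (auto simp: submodule_order_def)
    show ?thesis
    proof (cases "?pre L = ?pre K")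
      case eq: True
      then have "p ` L \<noteq> p ` K" using key[of K L] s by auto
      then show ?thesis using s sub mono(2)[of L K] eq True by (auto simp: submodule_order_def)
    next
      case False
      then show ?thesis using s sub mono(1)[of L K] True by (auto simp: submodule_order_def)
    qed
  next
    case False
    then have s: "submodule K R M" "submodule L R M" "K \<subset> L" using KL by (auto simp: submodule_order_def)
    show ?thesis
    proof (cases "?pre L = ?pre K")
      case eq: True
      then have "p ` L \<noteq> p ` K" using key[of L K] s by auto
      then show ?thesis using s sub mono(2)[of K L] eq False by (auto simp: submodule_order_def)
    next
      case neq: False
      then show ?thesis using s sub mono(1)[of K L] False by (auto simp: submodule_order_def)
    qed
  qed
  then have "submodule_order up R M \<subseteq>
      inv_image (submodule_order up R A <*lex*> submodule_order up R C) ?\<phi>" by (auto simp: inv_image_def)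
  then show ?thesis by (rule wf_subset[OF wf_inv_image[OF wf_lex_prod[OF wfA wfC]]])
qed

lemma wf_submodule_order_submodule:
  assumes "left_module R M" "submodule K R M" "wf (submodule_order up R M)"
  shows "wf (submodule_order up R (M\<lparr>carrier := K\<rparr>))"
  by (rule wf_subset[OF assms(3)]) (auto simp: submodule_order_def submodule_trans[OF assms(1,2)])

lemma wf_submodule_order_zero:
  assumes "left_module R M" "carrier M = {\<zero>\<^bsub>M\<^esub>}"
  shows "wf (submodule_order up R M)"
proof -
  have "K = {\<zero>\<^bsub>M\<^esub>}" if "submodule K R M" for K
    using submoduleD(1,2)[OF that] assms(2) by auto
  then have "submodule_order up R M = {}" by (auto simp: submodule_order_def)
  then show ?thesis by simp
qed

text \<open>The lemma on exact sequences applies with a zero module on the right, since every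
  element of \<open>N\<close> is in the image of \<open>f\<close>.\<close>

lemma wf_submodule_order_image:
  assumes M: "left_module R M" and N: "left_module R N" and f: "module_map R M N f"
    and surj: "f ` carrier M = carrier N" and wf: "wf (submodule_order up R M)"
  shows "wf (submodule_order up R N)"
proof -
  let ?Z = "N\<lparr>carrier := {\<zero>\<^bsub>N\<^esub>}\<rparr>"
  have Z: "left_module R ?Z" by (rule left_module_submodule[OF N submodule_zero[OF N]])
  have "module_map R N ?Z (\<lambda>_. \<zero>\<^bsub>N\<^esub>)"
    using module_map_const_zero[OF Z] by simp
  then show ?thesis
    by (rule wf_submodule_order_exact[OF M N Z f])
      (auto simp: surj wf wf_submodule_order_zero[OF Z])
qed

lemma finite_length_submodule:
  "left_module R M \<Longrightarrow> submodule K R M \<Longrightarrow> finite_length R M \<Longrightarrow> finite_length R (M\<lparr>carrier := K\<rparr>)"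
  by (simp add: finite_length_def wf_submodule_order_submodule)

lemma finite_length_image:
  "left_module R M \<Longrightarrow> left_module R N \<Longrightarrow> module_map R M N f \<Longrightarrow> f ` carrier M = carrier N \<Longrightarrow>
    finite_length R M \<Longrightarrow> finite_length R N"
  by (simp add: finite_length_def wf_submodule_order_image)

lemma finite_length_iso:
  "left_module R M \<Longrightarrow> left_module R N \<Longrightarrow> mod_isomorphic R M N \<Longrightarrow> finite_length R M \<Longrightarrow> finite_length R N"
  by (auto simp: mod_isomorphic_iff bij_betw_def intro: finite_length_image)

lemma finite_length_direct_sum:
  assumes M: "left_module R M" and N: "left_module R N" and "finite_length R M" "finite_length R N"
  shows "finite_length R (direct_sum M N)"
  unfolding finite_length_def
proof
  fix up
  show "wf (submodule_order up R (direct_sum M N))"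
    by (rule wf_submodule_order_exact[OF M left_module_direct_sum[OF M N] N
          module_map_Pair_left[OF N] module_map_snd])
      (use assms(3,4) in \<open>auto simp: finite_length_def\<close>)
qed

lemma finite_length_free:
  assumes R: "ring R" and fl: "finite_length R (regular_module R)"
  shows "finite_length R (free_module R n)"
proof (induction n)
  case 0
  have "carrier (free_module R 0) = {\<zero>\<^bsub>free_module R 0\<^esub>}"
    using ring.ring_simprules(2)[OF R] by (auto simp: fun_eq_iff)
  from wf_submodule_order_zero[OF left_module_free[OF R] this]
  show ?case by (simp add: finite_length_def)
next
  case (Suc n)
  note LM = left_module_free[OF R] left_module_regular[OF R]
  show ?case
    by (rule finite_length_iso[OF left_module_direct_sum[OF LM(2,1)] LM(1)
          mod_isomorphic_sym[OF LM(1) left_module_direct_sum[OF LM(2,1)] free_module_Suc[OF R]]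
          finite_length_direct_sum[OF LM(2,1) fl Suc]])
qed

lemma free_module_cover:
  assumes "fg_module R M"
  shows "\<exists>n f. module_map R (free_module R n) M f \<and> f ` carrier (free_module R n) = carrier M"
proof -
  interpret left_module R M using assms by (simp add: fg_module_def)
  obtain bs where bs: "set bs \<subseteq> carrier M" "{lin_comb M bs c |c. range c \<subseteq> carrier R} = carrier M"
    using assms fg_module_iff_lin_comb[OF left_module_axioms] by blast
  let ?n = "length bs"
  have "x \<in> lin_comb M bs ` carrier (free_module R ?n)" if "x \<in> carrier M" for x
  proof -
    have "x \<in> {lin_comb M bs c |c. range c \<subseteq> carrier R}" using that bs(2) by simp
    then obtain c where c: "range c \<subseteq> carrier R" "x = lin_comb M bs c" by auto
    let ?c = "\<lambda>i. if i < ?n then c i else \<zero>\<^bsub>R\<^esub>"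
    have "lin_comb M bs ?c = x" unfolding c(2) by (rule lin_comb_cong) simp
    moreover have "?c \<in> carrier (free_module R ?n)" using c(1) by auto
    ultimately show ?thesis by (rule image_eqI[OF sym])
  qed
  moreover have "module_map R (free_module R ?n) M (lin_comb M bs)"
    using bs(1) by (auto simp: module_map_def lin_comb_closed lin_comb_add lin_comb_smult)
  ultimately show ?thesis
    by (intro exI[of _ ?n] exI[of _ "lin_comb M bs"]) (auto dest: module_mapD(1) simp del: free_module_sel)
qed

lemma fg_finite_length:
  assumes fl: "finite_length R (regular_module R)" and fg: "fg_module R M"
  shows "finite_length R M"
proof -
  have M: "left_module R M" using fg by (simp add: fg_module_def)
  then have R: "ring R" by (simp add: left_module_def)
  obtain n f where "module_map R (free_module R n) M f" "f ` carrier (free_module R n) = carrier M"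
    using free_module_cover[OF fg] by blast
  from finite_length_image[OF left_module_free[OF R] M this finite_length_free[OF R fl]] show ?thesis .
qed

text \<open>By the ascending chain condition some span of a finite list is maximal; an element
  outside it could be added to the list.\<close>

lemma finite_length_fg:
  assumes M: "left_module R M" and "finite_length R M"
  shows "fg_module R M"
proof -
  interpret left_module R M by fact
  let ?span = "\<lambda>bs. {lin_comb M bs c |c. range c \<subseteq> carrier R}"
  let ?Q = "{?span bs |bs. set bs \<subseteq> carrier M}"
  have wf: "wf (submodule_order True R M)" using assms by (simp add: finite_length_def)
  have "?span [] \<in> ?Q" by (intro CollectI exI[of _ "[]"]) auto
  then obtain K where K: "K \<in> ?Q"
    and max: "\<And>L. (L, K) \<in> submodule_order True R M \<Longrightarrow> L \<notin> ?Q"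
    by (rule wfE_min[OF wf]) (rule that)
  obtain bs where bs: "set bs \<subseteq> carrier M" "K = ?span bs" using K by auto
  have "carrier M \<subseteq> K"
  proof (rule subsetI, rule ccontr)
    fix x assume x: "x \<in> carrier M" "x \<notin> K"
    have xs: "set (x # bs) \<subseteq> carrier M" using x bs by simp
    have gen: "set (x # bs) \<subseteq> ?span (x # bs)" using lin_comb_generator[OF xs] by blast
    have "?span bs \<subseteq> ?span (x # bs)"
    proof clarify
      fix c :: "nat \<Rightarrow> _" assume "range c \<subseteq> carrier R"
      then have "lin_comb M bs c \<in> ?span (x # bs)"
        using lin_comb_mem_submodule[OF submodule_lin_comb[OF xs], of bs c] gen by simp
      then show "\<exists>ca. lin_comb M bs c = lin_comb M (x # bs) ca \<and> range ca \<subseteq> carrier R" by blast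
    qed
    then have "K \<subset> ?span (x # bs)" using gen x(2) bs(2) by auto
    then have "(?span (x # bs), K) \<in> submodule_order True R M"
      using submodule_lin_comb[OF xs] submodule_lin_comb[OF bs(1)] bs(2) by (simp add: submodule_order_def)
    then show False using max[of "?span (x # bs)"] xs by blast
  qed
  then have "K = carrier M" using submoduleD(1)[OF submodule_lin_comb[OF bs(1)]] bs(2) by auto
  then show ?thesis using fg_module_iff_lin_comb[OF M] bs by blast
qed

lemma fg_submodule:
  assumes "finite_length R (regular_module R)" "fg_module R M" "submodule K R M"
  shows "fg_module R (M\<lparr>carrier := K\<rparr>)"
  using assms by (auto intro!: finite_length_fg finite_length_submodule left_module_submodule
      simp: fg_finite_length fg_module_left_module)

section \<open>Stabilising chains, endomorphisms and Fitting's lemma\<close>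

lemma finite_length_chain:
  assumes fl: "finite_length R M" and sub: "\<And>n::nat. submodule (N n) R M"
    and mono: "(\<forall>n. N n \<subseteq> N (Suc n)) \<or> (\<forall>n. N (Suc n) \<subseteq> N n)"
  shows "\<exists>n. \<forall>m\<ge>n. N m = N n"
proof -
  define up where "up \<longleftrightarrow> (\<forall>n. N n \<subseteq> N (Suc n))"
  have wf: "wf (submodule_order up R M)" using fl by (simp add: finite_length_def)
  have "N 0 \<in> range N" by simp
  then obtain n where n: "\<And>K. (K, N n) \<in> submodule_order up R M \<Longrightarrow> K \<notin> range N"
    by (rule wfE_min[OF wf]) blast
  have "N m = N n" if "m \<ge> n" for m
  proof -
    have "N n \<subseteq> N m" if up
      using lift_Suc_mono_le[of N n m] \<open>m \<ge> n\<close> that by (simp add: up_def)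
    moreover have "N m \<subseteq> N n" if "\<not> up"
      using lift_Suc_antimono_le[of N n m] \<open>m \<ge> n\<close> that mono by (auto simp: up_def)
    ultimately show ?thesis using n[of "N m"] sub by (cases up) (auto simp: submodule_order_def)
  qed
  then show ?thesis by blast
qed

lemma module_map_funpow: "module_map R M M f \<Longrightarrow> module_map R M M (f ^^ n)"
proof (induction n)
  case (Suc n)
  then show ?case using module_map_comp[of R M M "f ^^ n" M f] by (simp add: o_def)
qed (simp add: module_map_def)

text \<open>The kernels of the powers of \<open>f\<close> stabilise at some \<open>n\<close>. An
  \<open>x\<close> with \<open>f x = 0\<close> is \<open>(f ^^ n) y\<close> for some
  \<open>y\<close>, since powers of \<open>f\<close> are onto; then \<open>y\<close> lies in the
  kernel of \<open>f ^^ Suc n\<close>, hence of \<open>f ^^ n\<close>, and \<open>x\<close> is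
  zero.\<close>

lemma surjective_endomorphism_injective:
  assumes M: "left_module R M" and fl: "finite_length R M" and f: "module_map R M M f"
    and surj: "f ` carrier M = carrier M"
  shows "inj_on f (carrier M)"
  unfolding module_map_inj_iff[OF M M f]
proof (intro ballI impI)
  fix x assume x: "x \<in> carrier M" "f x = \<zero>\<^bsub>M\<^esub>"
  let ?N = "\<lambda>n. {y \<in> carrier M. (f ^^ n) y = \<zero>\<^bsub>M\<^esub>}"
  have "\<exists>n. \<forall>m\<ge>n. ?N m = ?N n"
    by (rule finite_length_chain[OF fl])
      (auto intro!: module_map_ker[OF M M] module_map_funpow[OF f] simp: module_map_zero[OF M M f])
  then obtain n where stable: "\<And>m. m \<ge> n \<Longrightarrow> ?N m = ?N n" by blast
  have n: "?N (Suc n) = ?N n" by (rule stable) simp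
  have "(f ^^ k) ` carrier M = carrier M" for k
  proof (induction k)
    case (Suc k)
    have "(f ^^ Suc k) ` carrier M = f ` ((f ^^ k) ` carrier M)" by (simp add: image_image)
    then show ?case using Suc surj by simp
  qed simp
  then obtain y where y: "y \<in> carrier M" "x = (f ^^ n) y" using x(1) by (metis imageE)
  then have "y \<in> ?N (Suc n)" using x by simp
  then have "y \<in> ?N n" unfolding n .
  then show "x = \<zero>\<^bsub>M\<^esub>" using y by simp
qed

text \<open>Where the kernels and the images of the powers have both stabilised,
  \<open>f ^^ n\<close> permutes its own image. Inverting it there splits \<open>f ^^ n\<close> as a
  map onto that image.\<close>

lemma fitting:
  assumes M: "left_module R M" and fl: "finite_length R M" and f: "module_map R M M f"
  obtains n where "mod_isomorphic R M (direct_sum (ker_mod M (f ^^ n) M) (M\<lparr>carrier := (f ^^ n) ` carrier M\<rparr>))"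
    and "n > 0"
proof -
  note fn = module_map_funpow[OF f]
  let ?K = "\<lambda>n. {y \<in> carrier M. (f ^^ n) y = \<zero>\<^bsub>M\<^esub>}" and ?I = "\<lambda>n. (f ^^ n) ` carrier M"
  have "\<exists>n. \<forall>m\<ge>n. ?K m = ?K n"
    by (rule finite_length_chain[OF fl])
      (auto intro!: module_map_ker[OF M M] fn simp: module_map_zero[OF M M f])
  then obtain k where k: "\<And>m. m \<ge> k \<Longrightarrow> ?K m = ?K k" by blast
  have "\<exists>n. \<forall>m\<ge>n. ?I m = ?I n"
  proof (rule finite_length_chain[OF fl])
    show "submodule (?I n) R M" for n by (rule module_map_image[OF M M fn submodule_carrier[OF M]])
    have "?I (Suc n) \<subseteq> ?I n" for n
      using module_mapD(1)[OF f] by (auto simp: funpow_Suc_right simp del: funpow.simps)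
    then show "(\<forall>n. ?I n \<subseteq> ?I (Suc n)) \<or> (\<forall>n. ?I (Suc n) \<subseteq> ?I n)" by blast
  qed
  then obtain l where l: "\<And>m. m \<ge> l \<Longrightarrow> ?I m = ?I l" by blast
  \<comment> \<open>Past both points of stability; the extra one makes \<open>n\<close> positive, so
    that the kernel of \<open>f\<close> is contained in that of \<open>f ^^ n\<close>.\<close>
  define n where "n = k + l + 1"
  let ?g = "f ^^ n"
  have gg: "?g (?g x) = (f ^^ (n + n)) x" for x by (simp add: funpow_add)
  have im: "submodule (?I n) R M" by (rule module_map_image[OF M M fn submodule_carrier[OF M]])
  let ?L = "M\<lparr>carrier := ?I n\<rparr>"
  have L: "left_module R ?L" by (rule left_module_submodule[OF M im])
  have IM: "?I n \<subseteq> carrier M" by (rule submoduleD(1)[OF im])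
  have gML: "module_map R M ?L ?g" using fn[of n] IM by (simp add: module_map_into_submodule)
  have gLL: "module_map R ?L ?L ?g" using module_map_on_submodule[OF gML IM] .
  have bij: "bij_betw ?g (carrier ?L) (carrier ?L)"
  proof -
    have "?g ` ?I n = ?I (n + n)" by (auto simp: image_image gg)
    also have "\<dots> = ?I n" using l[of "n + n"] l[of n] by (simp add: n_def)
    finally have "?g ` ?I n = ?I n" .
    moreover have "inj_on ?g (carrier ?L)"
      unfolding module_map_inj_iff[OF L L gLL]
    proof (intro ballI impI)
      fix y assume "y \<in> carrier ?L" and 0: "?g y = \<zero>\<^bsub>?L\<^esub>"
      then obtain x where x: "x \<in> carrier M" "y = ?g x" by auto
      then have "x \<in> ?K (n + n)" using 0 gg by simp
      moreover have "?K (n + n) = ?K n" using k[of "n + n"] k[of n] unfolding n_def by simp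
      ultimately have "x \<in> ?K n" by simp
      then show "y = \<zero>\<^bsub>?L\<^esub>" using x by simp
    qed
    ultimately show ?thesis by (simp add: bij_betw_def)
  qed
  let ?h = "inv_into (carrier ?L) ?g"
  have h: "module_map R ?L M ?h"
    using module_map_inv_into[OF L gLL bij] IM by (simp add: module_map_into_submodule)
  have "?g (?h y) = y" if "y \<in> carrier ?L" for y
    using bij that by (metis bij_betw_inv_into_right)
  from split_surjection[OF M L gML h this]
  have "mod_isomorphic R M (direct_sum (ker_mod M ?g M) ?L)" by simp
  then show thesis by (rule that) (simp add: n_def)
qed

section \<open>Projective modules\<close>

lemma projectiveI:
  assumes P: "left_module R P"
    and lift: "\<And>M N g f. M \<in> mod_cat R \<Longrightarrow> N \<in> mod_cat R \<Longrightarrow> module_map R M N g \<Longrightarrow>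
      module_map R P N f \<Longrightarrow> g ` carrier M = carrier N \<Longrightarrow>
      \<exists>h. module_map R P M h \<and> (\<forall>x \<in> carrier P. g (h x) = f x)"
  shows "projective R P"
  unfolding projective_def
proof (intro ballI impI)
  fix M N g f
  assume *: "M \<in> mod_cat R" "N \<in> mod_cat R" "g \<in> mod_hom R M N" "f \<in> mod_hom R P N" "g ` carrier M = carrier N"
  have M: "left_module R M" using * by (simp add: mod_cat_def fg_module_def)
  obtain h where h: "module_map R P M h" "\<And>x. x \<in> carrier P \<Longrightarrow> g (h x) = f x"
    using lift[OF *(1,2) module_map_of_hom[OF *(3)] module_map_of_hom[OF *(4)] *(5)] by blast
  show "\<exists>h \<in> mod_hom R P M. \<forall>x \<in> carrier P. g (h x) = f x"
    by (rule bexI[OF _ mod_hom_restrict[OF P M h(1)]]) (simp add: h)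
qed

lemma iso_to_mod_cat:
  assumes "fg_module R M"
  obtains M' f f' where "M' \<in> mod_cat R" "module_map R M M' f" "module_map R M' M f'"
    "\<And>x. x \<in> carrier M \<Longrightarrow> f' (f x) = x" "\<And>x. x \<in> carrier M' \<Longrightarrow> f (f' x) = x"
    "mod_isomorphic R M M'"
proof -
  have M: "left_module R M" using assms by (simp add: fg_module_def)
  obtain M' where M': "M' \<in> mod_cat R" "mod_isomorphic R M M'"
    using fg_module_representative[OF assms] by blast
  then have "left_module R M'" by (simp add: mod_cat_def fg_module_def)
  with M' M obtain f where f: "module_map R M M' f" "bij_betw f (carrier M) (carrier M')"
    by (auto simp: mod_isomorphic_iff)
  show thesis
    by (rule that[OF M'(1) f(1) module_map_inv_into[OF M f] _ _ M'(2)])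
      (use f(2) in \<open>simp_all add: bij_betw_inv_into_left bij_betw_inv_into_right\<close>)
qed

text \<open>The definition tests lifting inside \<open>mod_cat R\<close>. Conjugating with
  isomorphisms into \<open>mod_cat R\<close> gives lifting against finitely generated modules of any
  element type.\<close>

lemma projective_lift:
  assumes "projective R P" "left_module R P" "fg_module R M" "fg_module R N"
    and g: "module_map R M N g" and surj: "g ` carrier M = carrier N" and f: "module_map R P N f"
  obtains h where "module_map R P M h" "\<And>x. x \<in> carrier P \<Longrightarrow> g (h x) = f x"
proof -
  obtain M' \<mu> \<mu>' where M': "M' \<in> mod_cat R" "module_map R M M' \<mu>" "module_map R M' M \<mu>'"
    "\<And>x. x \<in> carrier M \<Longrightarrow> \<mu>' (\<mu> x) = x" "\<And>x. x \<in> carrier M' \<Longrightarrow> \<mu> (\<mu>' x) = x"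
    by (rule iso_to_mod_cat[OF assms(3)]) (rule that)
  obtain N' \<nu> \<nu>' where N': "N' \<in> mod_cat R" "module_map R N N' \<nu>" "module_map R N' N \<nu>'"
    "\<And>x. x \<in> carrier N \<Longrightarrow> \<nu>' (\<nu> x) = x" "\<And>x. x \<in> carrier N' \<Longrightarrow> \<nu> (\<nu>' x) = x"
    by (rule iso_to_mod_cat[OF assms(4)]) (rule that)
  have lM: "left_module R M'" "left_module R N'" using M'(1) N'(1) by (simp_all add: mod_cat_def fg_module_def)
  let ?g = "\<lambda>x. \<nu> (g (\<mu>' x))" and ?f = "\<lambda>x. \<nu> (f x)"
  have g': "module_map R M' N' ?g" using module_map_comp[OF module_map_comp[OF M'(3) g] N'(2)] .
  have f': "module_map R P N' ?f" using module_map_comp[OF f N'(2)] .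
  have "restrict ?g (carrier M') ` carrier M' = carrier N'"
  proof
    show "restrict ?g (carrier M') ` carrier M' \<subseteq> carrier N'" using module_mapD(1)[OF g'] by auto
    show "carrier N' \<subseteq> restrict ?g (carrier M') ` carrier M'"
    proof
      fix y assume y: "y \<in> carrier N'"
      then have "\<nu>' y \<in> carrier N" by (simp add: module_mapD[OF N'(3)])
      then obtain x where x: "x \<in> carrier M" "\<nu>' y = g x" using surj by (metis imageE)
      then have "?g (\<mu> x) = y" using y M'(4) N'(5) by metis
      moreover have "\<mu> x \<in> carrier M'" using x by (simp add: module_mapD[OF M'(2)])
      ultimately show "y \<in> restrict ?g (carrier M') ` carrier M'" by force
    qed
  qed
  then obtain h where h: "h \<in> mod_hom R P M'"
      "\<forall>x \<in> carrier P. restrict ?g (carrier M') (h x) = restrict ?f (carrier P) x"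
    using assms(1)[unfolded projective_def, rule_format, OF M'(1) N'(1)
        mod_hom_restrict[OF lM g'] mod_hom_restrict[OF assms(2) lM(2) f']] by blast
  have hm: "module_map R P M' h" using h(1) by (rule module_map_of_hom)
  show thesis
  proof (rule that[OF module_map_comp[OF hm M'(3)]])
    fix x assume x: "x \<in> carrier P"
    then have "h x \<in> carrier M'" by (simp add: module_mapD[OF hm])
    with x h(2) have "\<nu> (g (\<mu>' (h x))) = \<nu> (f x)" by auto
    moreover have "g (\<mu>' (h x)) \<in> carrier N" "f x \<in> carrier N"
      using \<open>h x \<in> carrier M'\<close> x by (simp_all add: module_mapD[OF g] module_mapD[OF f] module_mapD[OF M'(3)])
    ultimately show "g (\<mu>' (h x)) = f x" using N'(4) by metis
  qed
qed

lemma projective_retract: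
  assumes "projective R P" "left_module R P" "left_module R Q"
    and i: "module_map R Q P i" and r: "module_map R P Q r"
    and ri: "\<And>x. x \<in> carrier Q \<Longrightarrow> r (i x) = x"
  shows "projective R Q"
proof (rule projectiveI[OF assms(3)])
  fix M N g f
  assume *: "M \<in> mod_cat R" "N \<in> mod_cat R" "module_map R M N g" "module_map R Q N f"
    "g ` carrier M = carrier N"
  have fg: "fg_module R M" "fg_module R N" using * by (simp_all add: mod_cat_def)
  obtain h where h: "module_map R P M h" "\<And>x. x \<in> carrier P \<Longrightarrow> g (h x) = f (r x)"
    by (rule projective_lift[OF assms(1,2) fg *(3,5) module_map_comp[OF r *(4)]]) (rule that)
  then show "\<exists>h. module_map R Q M h \<and> (\<forall>x \<in> carrier Q. g (h x) = f x)"
    using module_map_comp[OF i h(1)] by (auto simp: ri module_mapD[OF i])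
qed

lemma projective_iso:
  assumes "projective R P" "left_module R P" "left_module R Q" "mod_isomorphic R P Q"
  shows "projective R Q"
proof -
  obtain f where f: "module_map R P Q f" "bij_betw f (carrier P) (carrier Q)"
    using assms by (auto simp: mod_isomorphic_iff)
  show ?thesis
    by (rule projective_retract[OF assms(1-3) module_map_inv_into[OF assms(2) f] f(1)])
      (use f(2) in \<open>simp add: bij_betw_inv_into_right\<close>)
qed

lemma projective_summand:
  assumes "projective R (direct_sum P Q)" "left_module R P" "left_module R Q"
  shows "projective R P"
  by (rule projective_retract[OF assms(1) left_module_direct_sum[OF assms(2,3)] assms(2)
        module_map_Pair_left[OF assms(3)] module_map_fst]) simp

lemma projective_direct_sum:
  assumes "projective R P" "projective R Q" "left_module R P" "left_module R Q"
  shows "projective R (direct_sum P Q)"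
proof (rule projectiveI[OF left_module_direct_sum[OF assms(3,4)]])
  fix M N g f
  assume *: "M \<in> mod_cat R" "N \<in> mod_cat R" "module_map R M N g" "module_map R (direct_sum P Q) N f"
    "g ` carrier M = carrier N"
  interpret P: left_module R P by fact
  interpret Q: left_module R Q by fact
  have fg: "fg_module R M" "fg_module R N" using * by (simp_all add: mod_cat_def)
  then have M: "left_module R M" by (simp add: fg_module_def)
  obtain h where h: "module_map R P M h" "\<And>x. x \<in> carrier P \<Longrightarrow> g (h x) = f (x, \<zero>\<^bsub>Q\<^esub>)"
    by (rule projective_lift[OF assms(1,3) fg *(3,5) module_map_comp[OF module_map_Pair_left[OF assms(4)] *(4)]]) (rule that)
  obtain k where k: "module_map R Q M k" "\<And>x. x \<in> carrier Q \<Longrightarrow> g (k x) = f (\<zero>\<^bsub>P\<^esub>, x)"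
    by (rule projective_lift[OF assms(2,4) fg *(3,5) module_map_comp[OF module_map_Pair_right[OF assms(3)] *(4)]]) (rule that)
  let ?h = "\<lambda>p. h (fst p) \<oplus>\<^bsub>M\<^esub> k (snd p)"
  have "module_map R (direct_sum P Q) M ?h"
    by (rule module_map_add[OF left_module_direct_sum[OF assms(3,4)] M
          module_map_comp[OF module_map_fst h(1)] module_map_comp[OF module_map_snd k(1)]])
  moreover have "g (?h p) = f p" if "p \<in> carrier (direct_sum P Q)" for p
    using that module_mapD(2)[OF *(4), of "(fst p, \<zero>\<^bsub>Q\<^esub>)" "(\<zero>\<^bsub>P\<^esub>, snd p)"]
    by (auto simp: module_mapD(1)[OF h(1)] module_mapD(1)[OF k(1)] module_mapD(2)[OF *(3)] h(2) k(2))
  ultimately show "\<exists>h. module_map R (direct_sum P Q) M h \<and> (\<forall>x \<in> carrier (direct_sum P Q). g (h x) = f x)"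
    by blast
qed

lemma projective_zero:
  assumes "left_module R P" "carrier P = {\<zero>\<^bsub>P\<^esub>}"
  shows "projective R P"
proof (rule projectiveI[OF assms(1)])
  fix M N g f
  assume *: "M \<in> mod_cat R" "N \<in> mod_cat R" "module_map R M N g" "module_map R P N f"
  then have M: "left_module R M" "left_module R N" by (simp_all add: mod_cat_def fg_module_def)
  show "\<exists>h. module_map R P M h \<and> (\<forall>x \<in> carrier P. g (h x) = f x)"
    by (rule exI[of _ "\<lambda>_. \<zero>\<^bsub>M\<^esub>"])
      (simp add: assms(2) module_map_const_zero[OF M(1)] module_map_zero[OF M *(3)] module_map_zero[OF assms(1) M(2) *(4)])
qed

lemma projective_regular:
  assumes "ring R" shows "projective R (regular_module R)"
proof (rule projectiveI[OF left_module_regular[OF assms]])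
  interpret ring R by fact
  fix M N g f
  assume *: "M \<in> mod_cat R" "N \<in> mod_cat R" "module_map R M N g" "module_map R (regular_module R) N f"
    "g ` carrier M = carrier N"
  interpret M: left_module R M using *(1) by (simp add: mod_cat_def fg_module_def)
  have "f \<one>\<^bsub>R\<^esub> \<in> carrier N" using module_mapD(1)[OF *(4), of "\<one>\<^bsub>R\<^esub>"] by simp
  then obtain m where m: "m \<in> carrier M" "f \<one>\<^bsub>R\<^esub> = g m" using *(5) by (metis imageE)
  have "module_map R (regular_module R) M (\<lambda>a. a \<odot>\<^bsub>M\<^esub> m)"
    using m by (simp add: module_map_def M.smult_closed M.smult_l_distr M.smult_assoc1)
  moreover have "g (a \<odot>\<^bsub>M\<^esub> m) = f a" if "a \<in> carrier R" for a
    using module_mapD(3)[OF *(4), of a "\<one>\<^bsub>R\<^esub>"] m that by (simp add: module_mapD(3)[OF *(3)])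
  ultimately show "\<exists>h. module_map R (regular_module R) M h \<and>
      (\<forall>x \<in> carrier (regular_module R). g (h x) = f x)"
    by (intro exI[of _ "\<lambda>a. a \<odot>\<^bsub>M\<^esub> m"]) simp
qed

text \<open>The modules in the induction have different element types, and a predicate in HOL fixes
  its type. So one and the same property is passed three times: as \<open>T\<close> for the regular
  module, as \<open>S\<close> for the direct sum and as \<open>P\<close> for the free
  modules.\<close>

lemma free_module_induct [consumes 1, case_names zero iso regular sum]:
  assumes R: "ring R"
    and zero: "\<And>M :: ('a, nat \<Rightarrow> 'a) module. left_module R M \<Longrightarrow> carrier M = {\<zero>\<^bsub>M\<^esub>} \<Longrightarrow> P M"
    and iso: "\<And>M N. left_module R M \<Longrightarrow> left_module R N \<Longrightarrow> mod_isomorphic R M N \<Longrightarrow> S M \<Longrightarrow> P N"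
    and regular: "T (regular_module R)"
    and sum: "\<And>M N. left_module R M \<Longrightarrow> left_module R N \<Longrightarrow> T M \<Longrightarrow> P N \<Longrightarrow> S (direct_sum M N)"
  shows "P (free_module R n)"
proof (induction n)
  case 0
  have "carrier (free_module R 0) = {\<zero>\<^bsub>free_module R 0\<^esub>}"
    using ring.ring_simprules(2)[OF R] by (auto simp: fun_eq_iff)
  from zero[OF left_module_free[OF R] this] show ?case .
next
  case (Suc n)
  note LM = left_module_free[OF R] left_module_regular[OF R]
  show ?case
    by (rule iso[OF left_module_direct_sum[OF LM(2,1)] LM(1)
          mod_isomorphic_sym[OF LM(1) left_module_direct_sum[OF LM(2,1)] free_module_Suc[OF R]]
          sum[OF LM(2,1) regular Suc]])
qed

lemma fg_module_zero: "left_module R M \<Longrightarrow> carrier M = {\<zero>\<^bsub>M\<^esub>} \<Longrightarrow> fg_module R M"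
  unfolding fg_module_def
proof (intro conjI exI[of _ "{}"] allI impI)
  fix N assume "carrier M = {\<zero>\<^bsub>M\<^esub>}" "submodule N R M \<and> {} \<subseteq> N"
  then show "N = carrier M" using submoduleD(1,2)[of N R M] by auto
qed auto

lemma fg_module_free: "ring R \<Longrightarrow> fg_module R (free_module R n)"
  by (rule free_module_induct[where S = "fg_module R" and T = "fg_module R"])
    (auto intro: fg_module_zero fg_module_iso fg_module_direct_sum fg_module_regular)

lemma projective_free: "ring R \<Longrightarrow> projective R (free_module R n)"
  by (rule free_module_induct[where S = "projective R" and T = "projective R"])
    (auto intro: projective_zero projective_iso projective_direct_sum projective_regular)

lemma projective_surjection:
  assumes "fg_module R M"
  obtains P p where "P \<in> mod_cat R" "projective R P" "module_map R P M p" "p ` carrier P = carrier M"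
proof -
  have M: "left_module R M" using assms by (simp add: fg_module_def)
  then have R: "ring R" by (simp add: left_module_def)
  obtain n f where f: "module_map R (free_module R n) M f" "f ` carrier (free_module R n) = carrier M"
    using free_module_cover[OF assms] by blast
  note F = fg_module_free[OF R, of n]
  obtain P \<mu> \<mu>' where P: "P \<in> mod_cat R" "module_map R (free_module R n) P \<mu>" "module_map R P (free_module R n) \<mu>'"
    "\<And>x. x \<in> carrier (free_module R n) \<Longrightarrow> \<mu>' (\<mu> x) = x" "\<And>x. x \<in> carrier P \<Longrightarrow> \<mu> (\<mu>' x) = x"
    by (rule iso_to_mod_cat[OF F]) (rule that)
  have "projective R P"
    by (rule projective_retract[OF projective_free[OF R] left_module_free[OF R] _ P(3,2)])
      (use P(1,5) in \<open>simp_all add: mod_cat_def fg_module_def\<close>)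
  moreover have "(\<lambda>x. f (\<mu>' x)) ` carrier P = carrier M"
  proof -
    have "\<mu>' ` carrier P = carrier (free_module R n)"
      using P(4) module_mapD(1)[OF P(3)] module_mapD(1)[OF P(2)] by (metis image_eqI image_subsetI subsetI subset_antisym)
    then show ?thesis using f(2) by (metis image_image)
  qed
  ultimately show thesis using that[OF P(1) _ module_map_comp[OF P(3) f(1)]] by blast
qed

text \<open>Both projections of the pullback \<open>?E\<close> of \<open>p\<close> and
  \<open>q\<close> split, because they map onto projective modules, and their kernels are copies of
  those of \<open>q\<close> and \<open>p\<close>. The pullback thus decomposes in two ways.\<close>

lemma schanuel:
  assumes fg: "fg_module R P" "fg_module R Q" "fg_module R M" and proj: "projective R P" "projective R Q"
    and p: "module_map R P M p" "p ` carrier P = carrier M"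
    and q: "module_map R Q M q" "q ` carrier Q = carrier M"
  shows "mod_isomorphic R (direct_sum (ker_mod P p M) Q) (direct_sum (ker_mod Q q M) P)"
proof -
  have L: "left_module R P" "left_module R Q" "left_module R M" using fg by (simp_all add: fg_module_def)
  interpret P: left_module R P by fact
  interpret Q: left_module R Q by fact
  interpret M: left_module R M by fact
  obtain s where s: "module_map R P Q s" "\<And>x. x \<in> carrier P \<Longrightarrow> q (s x) = p x"
    by (rule projective_lift[OF proj(1) L(1) fg(2,3) q p(1)]) (rule that)
  obtain t where t: "module_map R Q P t" "\<And>x. x \<in> carrier Q \<Longrightarrow> p (t x) = q x"
    by (rule projective_lift[OF proj(2) L(2) fg(1,3) p q(1)]) (rule that)
  let ?E = "{z \<in> carrier (direct_sum P Q). p (fst z) = q (snd z)}"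
  let ?D = "direct_sum P Q\<lparr>carrier := ?E\<rparr>"
  note PQ = left_module_direct_sum[OF L(1,2)]
  have E: "submodule ?E R (direct_sum P Q)"
    by (subst submodule_iff[OF PQ])
      (auto simp: module_map_zero[OF L(1,3) p(1)] module_map_zero[OF L(2,3) q(1)] module_mapD[OF p(1)]
        module_mapD[OF q(1)] P.smult_closed Q.smult_closed)
  have D: "left_module R ?D" by (rule left_module_submodule[OF PQ E])
  have ES: "?E \<subseteq> carrier (direct_sum P Q)" by auto
  note fs = module_map_on_submodule[OF module_map_fst ES] module_map_on_submodule[OF module_map_snd ES]
  have 1: "mod_isomorphic R ?D (direct_sum (ker_mod ?D fst P) P)"
    by (rule split_surjection[OF D L(1) fs(1), where h = "\<lambda>x. (x, s x)"])
      (use s in \<open>auto simp: module_map_def\<close>)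
  have 2: "mod_isomorphic R (ker_mod ?D fst P) (ker_mod Q q M)"
  proof -
    have K: "left_module R (ker_mod ?D fst P)" by (rule left_module_ker[OF D L(1) fs(1)])
    have K': "left_module R (ker_mod Q q M)" by (rule left_module_ker[OF L(2,3) q(1)])
    have "bij_betw snd (carrier (ker_mod ?D fst P)) (carrier (ker_mod Q q M))"
      by (rule bij_betwI[where g = "\<lambda>y. (\<zero>\<^bsub>P\<^esub>, y)"]) (auto simp: module_map_zero[OF L(1,3) p(1)])
    moreover have "module_map R (ker_mod ?D fst P) (ker_mod Q q M) snd"
      by (auto simp: module_map_def module_map_zero[OF L(1,3) p(1)])
    ultimately show ?thesis using K K' by (auto simp: mod_isomorphic_iff)
  qed
  have 3: "mod_isomorphic R ?D (direct_sum (ker_mod ?D snd Q) Q)"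
    by (rule split_surjection[OF D L(2) fs(2), where h = "\<lambda>y. (t y, y)"])
      (use t in \<open>auto simp: module_map_def\<close>)
  have 4: "mod_isomorphic R (ker_mod ?D snd Q) (ker_mod P p M)"
  proof -
    have K: "left_module R (ker_mod ?D snd Q)" by (rule left_module_ker[OF D L(2) fs(2)])
    have K': "left_module R (ker_mod P p M)" by (rule left_module_ker[OF L(1,3) p(1)])
    have "bij_betw fst (carrier (ker_mod ?D snd Q)) (carrier (ker_mod P p M))"
      by (rule bij_betwI[where g = "\<lambda>x. (x, \<zero>\<^bsub>Q\<^esub>)"]) (auto simp: module_map_zero[OF L(2,3) q(1)])
    moreover have "module_map R (ker_mod ?D snd Q) (ker_mod P p M) fst"
      by (auto simp: module_map_def module_map_zero[OF L(2,3) q(1)])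
    ultimately show ?thesis using K K' by (auto simp: mod_isomorphic_iff)
  qed
  note K = left_module_ker[OF D L(1) fs(1)] left_module_ker[OF D L(2) fs(2)]
    left_module_ker[OF L(2,3) q(1)] left_module_ker[OF L(1,3) p(1)]
  note S = left_module_direct_sum[OF K(1) L(1)] left_module_direct_sum[OF K(2) L(2)]
    left_module_direct_sum[OF K(3) L(1)] left_module_direct_sum[OF K(4) L(2)]
  have 5: "mod_isomorphic R ?D (direct_sum (ker_mod Q q M) P)"
    by (rule mod_isomorphic_trans[OF D S(1,3) 1 mod_isomorphic_direct_sum[OF K(1,3) L(1,1) 2
            mod_isomorphic_refl[OF L(1)]]])
  have 6: "mod_isomorphic R ?D (direct_sum (ker_mod P p M) Q)"
    by (rule mod_isomorphic_trans[OF D S(2,4) 3 mod_isomorphic_direct_sum[OF K(2,4) L(2,2) 4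
            mod_isomorphic_refl[OF L(2)]]])
  show ?thesis
    by (rule mod_isomorphic_trans[OF S(4) D S(3) mod_isomorphic_sym[OF D S(4) 6] 5])
qed

text \<open>Let \<open>L\<close> be a minimal submodule of a projective \<open>P\<close> that still
  maps onto \<open>M\<close>. Lifting gives \<open>h\<close> from \<open>P\<close> to
  \<open>L\<close> over \<open>M\<close>. Minimality makes the restriction of \<open>h\<close> to
  \<open>L\<close> onto, finite length makes it bijective, and so \<open>L\<close> is a retract of
  \<open>P\<close>.\<close>

lemma projective_cover_exists:
  assumes fl: "finite_length R (regular_module R)" and fg: "fg_module R M"
  shows "\<exists>P p. P \<in> mod_cat R \<and> projective_cover R M P p"
proof -
  obtain P p where P: "P \<in> mod_cat R" "projective R P" "module_map R P M p" "p ` carrier P = carrier M"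
    by (rule projective_surjection[OF fg])
  have fgP: "fg_module R P" using P(1) by (simp add: mod_cat_def)
  have LP: "left_module R P" and LM: "left_module R M" using fgP fg by (simp_all add: fg_module_def)
  interpret P: left_module R P by fact
  let ?Q = "{L. submodule L R P \<and> p ` L = carrier M}"
  have wf: "wf (submodule_order False R P)" using fg_finite_length[OF fl fgP] by (simp add: finite_length_def)
  have "carrier P \<in> ?Q" using submodule_carrier[OF LP] P(4) by simp
  then obtain L where L: "L \<in> ?Q" and min: "\<And>K. (K, L) \<in> submodule_order False R P \<Longrightarrow> K \<notin> ?Q"
    by (rule wfE_min[OF wf]) (rule that)
  have sL: "submodule L R P" and pL: "p ` L = carrier M" using L by auto
  have LP': "L \<subseteq> carrier P" by (rule submoduleD(1)[OF sL])
  let ?L = "P\<lparr>carrier := L\<rparr>"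
  have LL: "left_module R ?L" by (rule left_module_submodule[OF LP sL])
  have fgL: "fg_module R ?L" by (rule fg_submodule[OF fl fgP sL])
  note pm = module_map_on_submodule[OF P(3) LP']
  obtain h where h: "module_map R P ?L h" "\<And>x. x \<in> carrier P \<Longrightarrow> p (h x) = p x"
    using projective_lift[OF P(2) LP fgL fg pm _ P(3)] pL by auto
  note hL = module_map_on_submodule[OF h(1) LP']
  have min': "K = L" if "submodule K R ?L" "p ` K = carrier M" for K
    using min[of K] that sL unfolding submodule_trans[OF LP sL] submodule_order_def by auto
  have hLL: "h ` L = L"
  proof (rule min')
    show "submodule (h ` L) R ?L" using module_map_image[OF LL LL hL submodule_carrier[OF LL]] by simp
    have "p ` h ` L = p ` L" unfolding image_image using h(2) LP' by (auto simp: subset_iff intro!: image_cong)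
    then show "p ` h ` L = carrier M" using pL by simp
  qed
  have inj: "inj_on h (carrier ?L)"
    by (rule surjective_endomorphism_injective[OF LL fg_finite_length[OF fl fgL] hL]) (simp add: hLL)
  have bij: "bij_betw h (carrier ?L) (carrier ?L)" using inj hLL by (simp add: bij_betw_def)
  have "projective R ?L"
  proof (rule projective_retract[OF P(2) LP LL])
    show "module_map R ?L P (inv_into L h)"
      using module_map_inv_into[OF LL hL bij] LP' by (simp add: module_map_into_submodule)
    show "module_map R P ?L h" by (rule h(1))
    show "h (inv_into L h x) = x" if "x \<in> carrier ?L" for x
      using bij_betw_inv_into_right[OF bij] that by simp
  qed
  then have "projective_cover R M ?L (restrict p L)"
    unfolding projective_cover_def
  proof (intro conjI allI impI)
    fix K assume K: "submodule K R ?L \<and> restrict p L ` K = carrier M"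
    then have "K \<subseteq> L" using submoduleD(1)[of K R ?L] by simp
    then have "restrict p L ` K = p ` K" by (auto simp: subset_iff)
    then show "K = carrier ?L" using min'[of K] K by simp
  qed (use mod_hom_restrict[OF LL LM pm] pL in simp_all)
  moreover have "?L \<in> mod_cat R" using fgL by (simp add: mod_cat_def)
  ultimately show ?thesis by blast
qed

text \<open>Opens the choice inside \<open>syzygy\<close> once, so that Schanuel's lemma can compare
  the syzygy with the kernel of any other projective surjection.\<close>

lemma syzygy_kernel:
  assumes fl: "finite_length R (regular_module R)" and fg: "fg_module R M"
  obtains P p where "P \<in> mod_cat R" "projective R P" "module_map R P M p" "p ` carrier P = carrier M"
    "syzygy R M = ker_mod P p M"
proof -
  let ?t = "SOME (P, p). P \<in> mod_cat R \<and> projective_cover R M P p"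
  have "case ?t of (P, p) \<Rightarrow> P \<in> mod_cat R \<and> projective_cover R M P p"
    by (rule someI_ex) (use projective_cover_exists[OF fl fg] in auto)
  then have *: "fst ?t \<in> mod_cat R" "projective_cover R M (fst ?t) (snd ?t)" by (auto simp: case_prod_beta)
  have "syzygy R M = ker_mod (fst ?t) (snd ?t) M" by (simp add: syzygy_def case_prod_beta)
  then show thesis
    using that[OF *(1) _ _ _ \<open>syzygy R M = ker_mod (fst ?t) (snd ?t) M\<close>] *(2)
    by (auto simp: projective_cover_def intro: module_map_of_hom)
qed

section \<open>Projective resolutions\<close>

lemma proj_resolution_exists:
  assumes fl: "finite_length R (regular_module R)" and fg: "fg_module R X"
  shows "\<exists>P d e. proj_resolution R X P d e"
proof -
  have LX: "left_module R X" using fg by (simp add: fg_module_def)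
  obtain P0 e where P0: "P0 \<in> mod_cat R" "projective R P0" "module_map R P0 X e" "e ` carrier P0 = carrier X"
    by (rule projective_surjection[OF fg])
  have L0: "left_module R P0" using P0 by (simp add: mod_cat_def fg_module_def)
  let ?K0 = "{x \<in> carrier P0. e x = \<zero>\<^bsub>X\<^esub>}"
  \<comment> \<open>A state is a projective module together with the submodule that the next
    differential must have as its image. The clause for index zero pins the start to the chosen
    surjection onto \<open>X\<close>.\<close>
  let ?good = "\<lambda>(n::nat) PK. fst PK \<in> mod_cat R \<and> projective R (fst PK) \<and> submodule (snd PK) R (fst PK) \<and>
    (n = 0 \<longrightarrow> PK = (P0, ?K0))"
  let ?step = "\<lambda>PK QL d. d \<in> mod_hom R (fst QL) (fst PK) \<and> d ` carrier (fst QL) = snd PK \<and>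
    snd QL = {x \<in> carrier (fst QL). d x = \<zero>\<^bsub>fst PK\<^esub>}"
  have "\<exists>s. \<forall>n. ?good n (s n) \<and> (\<exists>d. ?step (s n) (s (Suc n)) d)"
  proof (rule dependent_nat_choice)
    show "\<exists>x. ?good 0 x"
      using P0 module_map_ker[OF L0 LX P0(3)] by (intro exI[of _ "(P0, ?K0)"]) simp
  next
    fix PK n assume PK: "?good n PK"
    obtain P K where [simp]: "PK = (P, K)" by force
    have P: "fg_module R P" "submodule K R P" using PK by (auto simp: mod_cat_def)
    have KP: "K \<subseteq> carrier P" by (rule submoduleD(1)[OF P(2)])
    obtain Q d where Q: "Q \<in> mod_cat R" "projective R Q" "module_map R Q (P\<lparr>carrier := K\<rparr>) d"
      "d ` carrier Q = carrier (P\<lparr>carrier := K\<rparr>)"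
      by (rule projective_surjection[OF fg_submodule[OF fl P]])
    have d: "module_map R Q P d" using Q(3) KP by (simp add: module_map_into_submodule)
    have LQ: "left_module R Q" "left_module R P" using Q(1) P by (simp_all add: mod_cat_def fg_module_def)
    let ?d = "restrict d (carrier Q)"
    have d': "?d \<in> mod_hom R Q P" by (rule mod_hom_restrict[OF LQ d])
    have *: "?good (Suc n) (Q, {x \<in> carrier Q. ?d x = \<zero>\<^bsub>P\<^esub>}) \<and>
      ?step PK (Q, {x \<in> carrier Q. ?d x = \<zero>\<^bsub>P\<^esub>}) ?d"
      using Q d' module_map_ker[OF LQ module_map_of_hom[OF d']] by (auto simp: image_restrict_eq)
    show "\<exists>y. ?good (Suc n) y \<and> (\<exists>d. ?step PK y d)"
      by (rule exI, rule conjI[OF conjunct1[OF *]], rule exI, rule conjunct2[OF *])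
  qed
  then obtain s where s': "\<forall>n. ?good n (s n) \<and> (\<exists>d. ?step (s n) (s (Suc n)) d)" by (rule exE)
  have s: "?good n (s n)" for n using s'[THEN spec, of n] by (rule conjunct1)
  have "\<exists>d. ?step (s n) (s (Suc n)) d" for n using s'[THEN spec, of n] by (rule conjunct2)
  from choice[OF allI[OF this]] obtain d where d': "\<forall>n. ?step (s n) (s (Suc n)) (d n)" by (rule exE)
  have d: "?step (s n) (s (Suc n)) (d n)" for n using d' by (rule spec)
  have s0: "s 0 = (P0, ?K0)" using s[of 0] by simp
  have "proj_resolution R X (\<lambda>n. fst (s n)) d (restrict e (carrier P0))"
    unfolding proj_resolution_def
    using s d d[of 0] P0(4) mod_hom_restrict[OF L0 LX P0(3)] by (simp add: s0 image_restrict_eq cong: conj_cong)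
  then show ?thesis by blast
qed

lemma proj_resolutionD:
  assumes "proj_resolution R X P d e"
  shows "fg_module R (P i)" "projective R (P i)" "d i \<in> mod_hom R (P (Suc i)) (P i)"
    "e \<in> mod_hom R (P 0) X" "e ` carrier (P 0) = carrier X"
    "d 0 ` carrier (P 1) = {x \<in> carrier (P 0). e x = \<zero>\<^bsub>X\<^esub>}"
    "d (Suc i) ` carrier (P (Suc (Suc i))) = {x \<in> carrier (P (Suc i)). d i x = \<zero>\<^bsub>P i\<^esub>}"
  using assms by (simp_all add: proj_resolution_def mod_cat_def)

lemma chosen_resolution:
  assumes "finite_length R (regular_module R)" "fg_module R X"
  shows "proj_resolution R X (res_obj R X) (res_diff R X) (res_aug R X)"
proof -
  have "case chosen_resolution R X of (P, d, e) \<Rightarrow> proj_resolution R X P d e"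
    unfolding chosen_resolution_def
    by (rule someI_ex) (use proj_resolution_exists[OF assms] in auto)
  then show ?thesis by (simp add: case_prod_beta)
qed

text \<open>The induction carries along that \<open>f i\<close> maps the image of \<open>d i\<close>
  into that of \<open>\<delta> i\<close>, which permits the next lift. Exactness of the target
  renews this property, since the source is a complex.\<close>

lemma comparison_lift:
  assumes P: "\<And>i. left_module R (P i)" "\<And>i. projective R (P i)"
    and d: "\<And>i. module_map R (P (Suc i)) (P i) (d i)" and e: "module_map R (P 0) X e"
    and dd: "\<And>i x. x \<in> carrier (P (Suc (Suc i))) \<Longrightarrow> d i (d (Suc i) x) = \<zero>\<^bsub>P i\<^esub>"
    and ed: "\<And>x. x \<in> carrier (P 1) \<Longrightarrow> e (d 0 x) = \<zero>\<^bsub>X\<^esub>"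
    and fg: "\<And>i. fg_module R (Q i)" "fg_module R X"
    and \<delta>: "\<And>i. module_map R (Q (Suc i)) (Q i) (\<delta> i)" and \<epsilon>: "module_map R (Q 0) X \<epsilon>"
    and \<epsilon>_surj: "\<epsilon> ` carrier (Q 0) = carrier X"
    and exact0: "\<delta> 0 ` carrier (Q 1) = {x \<in> carrier (Q 0). \<epsilon> x = \<zero>\<^bsub>X\<^esub>}"
    and exact: "\<And>i. \<delta> (Suc i) ` carrier (Q (Suc (Suc i))) = {x \<in> carrier (Q (Suc i)). \<delta> i x = \<zero>\<^bsub>Q i\<^esub>}"
  shows "\<exists>f. (\<forall>i. f i \<in> mod_hom R (P i) (Q i)) \<and> (\<forall>x \<in> carrier (P 0). \<epsilon> (f 0 x) = e x) \<and>
    (\<forall>i. \<forall>x \<in> carrier (P (Suc i)). \<delta> i (f (Suc i) x) = f i (d i x))"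
proof -
  have Q: "left_module R (Q i)" for i using fg by (simp add: fg_module_def)
  let ?good = "\<lambda>i f. f \<in> mod_hom R (P i) (Q i) \<and> (i = 0 \<longrightarrow> (\<forall>x \<in> carrier (P 0). \<epsilon> (f x) = e x)) \<and>
    (\<forall>x \<in> carrier (P (Suc i)). f (d i x) \<in> \<delta> i ` carrier (Q (Suc i)))"
  have "\<exists>f. \<forall>i. ?good i (f i) \<and> (\<forall>x \<in> carrier (P (Suc i)). \<delta> i (f (Suc i) x) = f i (d i x))"
  proof (rule dependent_nat_choice)
    obtain f where f: "module_map R (P 0) (Q 0) f" "\<And>x. x \<in> carrier (P 0) \<Longrightarrow> \<epsilon> (f x) = e x"
      by (rule projective_lift[OF P(2,1) fg \<epsilon> \<epsilon>_surj e]) (rule that)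
    have "?good 0 (restrict f (carrier (P 0)))"
      using mod_hom_restrict[OF P(1) Q f(1)] f(2) ed module_mapD(1)[OF d[of 0]] module_mapD(1)[OF f(1)]
      by (simp add: exact0[unfolded One_nat_def])
    then show "\<exists>f. ?good 0 f" by blast
  next
    fix f i assume f: "?good i f"
    note fm = module_map_of_hom[OF conjunct1[OF f]]
    let ?I = "Q i\<lparr>carrier := \<delta> i ` carrier (Q (Suc i))\<rparr>"
    have I: "submodule (\<delta> i ` carrier (Q (Suc i))) R (Q i)"
      by (rule module_map_image[OF Q Q \<delta> submodule_carrier[OF Q]])
    note IQ = submoduleD(1)[OF I]
    have LI: "left_module R ?I" by (rule left_module_submodule[OF Q I])
    have \<delta>I: "module_map R (Q (Suc i)) ?I (\<delta> i)" using \<delta>[of i] IQ by (simp add: module_map_into_submodule)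
    have fgI: "fg_module R ?I" by (rule fg_module_image[OF fg(1) LI \<delta>I]) simp
    have fd: "module_map R (P (Suc i)) ?I (\<lambda>x. f (d i x))"
      using module_map_comp[OF d fm] f IQ by (auto simp: module_map_into_submodule)
    obtain g where g: "module_map R (P (Suc i)) (Q (Suc i)) g" "\<And>x. x \<in> carrier (P (Suc i)) \<Longrightarrow> \<delta> i (g x) = f (d i x)"
      by (rule projective_lift[OF P(2,1) fg(1) fgI \<delta>I _ fd]) auto
    have "g (d (Suc i) x) \<in> \<delta> (Suc i) ` carrier (Q (Suc (Suc i)))" if x: "x \<in> carrier (P (Suc (Suc i)))" for x
      unfolding exact
      using g(2)[of "d (Suc i) x"] dd[OF x] module_map_zero[OF P(1) Q fm] module_mapD(1)[OF d x]
        module_mapD(1)[OF g(1)] by simp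
    then have "?good (Suc i) (restrict g (carrier (P (Suc i)))) \<and>
        (\<forall>x \<in> carrier (P (Suc i)). \<delta> i (restrict g (carrier (P (Suc i))) x) = f (d i x))"
      using mod_hom_restrict[OF P(1) Q g(1)] g(2) module_mapD(1)[OF d] by simp
    then show "\<exists>g. ?good (Suc i) g \<and> (\<forall>x \<in> carrier (P (Suc i)). \<delta> i (g x) = f (d i x))" by blast
  qed
  then obtain f where "\<forall>i. ?good i (f i) \<and> (\<forall>x \<in> carrier (P (Suc i)). \<delta> i (f (Suc i) x) = f i (d i x))"
    by (rule exE)
  then show ?thesis by (intro exI[of _ f]) simp
qed

section \<open>The stable Grothendieck group\<close>

lemma keys_K0_relation:
  assumes "C \<in> mod_cat R" "A \<in> mod_cat R" "B \<in> mod_cat R"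
  shows "Poly_Mapping.keys (frag_of C - (frag_of A + frag_of B)) \<subseteq> mod_cat R"
proof -
  have "Poly_Mapping.keys (frag_of A + frag_of B) \<subseteq> mod_cat R"
    using keys_add[of "frag_of A" "frag_of B"] assms by auto
  then show ?thesis using keys_diff[of "frag_of C" "frag_of A + frag_of B"] assms by auto
qed

lemma keys_K0_generator:
  assumes "x \<in> {frag_of C - (frag_of A + frag_of B) |A B C.
        A \<in> mod_cat R \<and> B \<in> mod_cat R \<and> C \<in> mod_cat R \<and> mod_isomorphic R C (direct_sum A B)} \<union>
     {frag_of Q |Q. Q \<in> mod_cat R \<and> projective R Q}"
  shows "Poly_Mapping.keys x \<subseteq> mod_cat R"
  using assms by (elim UnE CollectE exE conjE) (simp_all add: keys_K0_relation)

lemma K0_relations_induct [consumes 1, case_names zero sum projective add minus]: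
  assumes "x \<in> K0_relations R" and zero: "P 0"
    and sum: "\<And>A B C. A \<in> mod_cat R \<Longrightarrow> B \<in> mod_cat R \<Longrightarrow> C \<in> mod_cat R \<Longrightarrow>
      mod_isomorphic R C (direct_sum A B) \<Longrightarrow> P (frag_of C - (frag_of A + frag_of B))"
    and proj: "\<And>Q. Q \<in> mod_cat R \<Longrightarrow> projective R Q \<Longrightarrow> P (frag_of Q)"
    and add: "\<And>x y. P x \<Longrightarrow> P y \<Longrightarrow> P (x + y)"
    and minus: "\<And>x. P x \<Longrightarrow> P (- x)"
  shows "P x"
  using assms(1) unfolding K0_relations_def
proof (induction rule: generate.induct)
  case one
  then show ?case using zero by simp
next
  case (incl h)
  then show ?case using sum proj by auto
next
  case (inv h)
  \<comment> \<open>The inverse in the free abelian group is known to be negation only for formal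
    sums supported in \<open>mod_cat R\<close>.\<close>
  have "Poly_Mapping.keys h \<subseteq> mod_cat R" by (rule keys_K0_generator[OF inv])
  moreover have "P h" using inv sum proj by auto
  ultimately show ?case using minus by simp
next
  case (eng h1 h2)
  then show ?case using add by simp
qed

lemma K0_relations_keys: "x \<in> K0_relations R \<Longrightarrow> Poly_Mapping.keys x \<subseteq> mod_cat R"
proof (induction rule: K0_relations_induct)
  case (add x y)
  then show ?case using keys_add[of x y] by blast
qed (simp_all add: keys_K0_relation)

lemma K0_relations_zero: "0 \<in> K0_relations R"
  using generate.one[of "free_Abelian_group (mod_cat R)"] by (simp add: K0_relations_def)

lemma K0_relations_add: "x \<in> K0_relations R \<Longrightarrow> y \<in> K0_relations R \<Longrightarrow> x + y \<in> K0_relations R"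
  unfolding K0_relations_def using generate.eng[of x "free_Abelian_group (mod_cat R)"] by simp

lemma K0_relations_sum:
  "A \<in> mod_cat R \<Longrightarrow> B \<in> mod_cat R \<Longrightarrow> C \<in> mod_cat R \<Longrightarrow> mod_isomorphic R C (direct_sum A B) \<Longrightarrow>
    frag_of C - (frag_of A + frag_of B) \<in> K0_relations R"
  unfolding K0_relations_def by (rule generate.incl) blast

lemma K0_relations_projective: "Q \<in> mod_cat R \<Longrightarrow> projective R Q \<Longrightarrow> frag_of Q \<in> K0_relations R"
  unfolding K0_relations_def by (rule generate.incl) blast

lemma K0_relations_minus: "x \<in> K0_relations R \<Longrightarrow> - x \<in> K0_relations R"
proof -
  assume x: "x \<in> K0_relations R"
  let ?G = "free_Abelian_group (mod_cat R)" and ?H = "{frag_of C - (frag_of A + frag_of B) |A B C.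
        A \<in> mod_cat R \<and> B \<in> mod_cat R \<and> C \<in> mod_cat R \<and> mod_isomorphic R C (direct_sum A B)} \<union>
     {frag_of Q |Q. Q \<in> mod_cat R \<and> projective R Q}"
  have "?H \<subseteq> carrier ?G"
  proof
    fix y assume "y \<in> ?H"
    then have "Poly_Mapping.keys y \<subseteq> mod_cat R" by (rule keys_K0_generator)
    then show "y \<in> carrier ?G" by simp
  qed
  from group.generate_m_inv_closed[OF _ this, of x] x
  have "inv\<^bsub>?G\<^esub> x \<in> K0_relations R" by (simp add: K0_relations_def)
  then show ?thesis using K0_relations_keys[OF x] by simp
qed

lemma K0_relations_diff: "x \<in> K0_relations R \<Longrightarrow> y \<in> K0_relations R \<Longrightarrow> x - y \<in> K0_relations R"
  using K0_relations_add[of x R "- y"] K0_relations_minus[of y R] by simp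

text \<open>Equality of classes in \<open>K0 R\<close>, stated for formal sums so that cosets appear
  only when the definition of \<open>\<phi>\<close> is unfolded; \<open>K0_of_eq_iff\<close> makes
  the link.\<close>

definition K0_eq where "K0_eq R x y \<longleftrightarrow> x - y \<in> K0_relations R"

lemma K0_eq_refl [simp]: "K0_eq R x x"
  by (simp add: K0_eq_def K0_relations_zero)

lemma K0_eq_sym: "K0_eq R x y \<Longrightarrow> K0_eq R y x"
  using K0_relations_minus[of "x - y" R] by (simp add: K0_eq_def)

lemma K0_eq_trans [trans]: "K0_eq R x y \<Longrightarrow> K0_eq R y z \<Longrightarrow> K0_eq R x z"
  using K0_relations_add[of "x - y" R "y - z"] by (simp add: K0_eq_def)

lemma K0_eq_add: "K0_eq R x y \<Longrightarrow> K0_eq R x' y' \<Longrightarrow> K0_eq R (x + x') (y + y')"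
  using K0_relations_add[of "x - y" R "x' - y'"] by (simp add: K0_eq_def algebra_simps)

lemma K0_eq_diff: "K0_eq R x y \<Longrightarrow> K0_eq R x' y' \<Longrightarrow> K0_eq R (x - x') (y - y')"
  using K0_relations_diff[of "x - y" R "x' - y'"] by (simp add: K0_eq_def algebra_simps)

lemma K0_eq_zero: "K0_eq R x 0 \<longleftrightarrow> x \<in> K0_relations R"
  by (simp add: K0_eq_def)

lemma K0_eq_relations: "K0_eq R x y \<Longrightarrow> x \<in> K0_relations R \<longleftrightarrow> y \<in> K0_relations R"
  using K0_eq_trans[of R x y 0] K0_eq_trans[of R y x 0] K0_eq_sym[of R x y] by (auto simp: K0_eq_zero)

lemma frag_extend_K0_eq:
  assumes "Poly_Mapping.keys z \<subseteq> S" and "\<And>M. M \<in> S \<Longrightarrow> K0_eq R (F M) (G M)"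
  shows "K0_eq R (frag_extend F z) (frag_extend G z)"
  using assms(1)
proof (induction z rule: frag_induction)
  case (diff a b)
  then show ?case by (simp add: frag_extend_diff K0_eq_diff)
qed (simp_all add: assms(2))

text \<open>The universal property of \<open>K0 R\<close> in terms of representatives: additive maps
  are checked on the two kinds of generating relations.\<close>

lemma frag_extend_K0_relations:
  assumes sum: "\<And>A B C. A \<in> mod_cat R \<Longrightarrow> B \<in> mod_cat R \<Longrightarrow> C \<in> mod_cat R \<Longrightarrow>
      mod_isomorphic R C (direct_sum A B) \<Longrightarrow> K0_eq S (F C) (F A + F B)"
    and proj: "\<And>Q. Q \<in> mod_cat R \<Longrightarrow> projective R Q \<Longrightarrow> F Q \<in> K0_relations S"
    and "x \<in> K0_relations R"
  shows "frag_extend F x \<in> K0_relations S"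
  using assms(3)
proof (induction rule: K0_relations_induct)
  case (sum A B C)
  then show ?case using assms(1)[of A B C] by (simp add: K0_eq_def frag_extend_diff frag_extend_add)
qed (simp_all add: proj K0_relations_zero K0_relations_add K0_relations_minus frag_extend_add frag_extend_minus)

text \<open>A copy inside \<open>mod_cat R\<close>, whose members are the generators of the free
  abelian group. It gives a class to sums, quotients and restrictions of any element type.\<close>

definition mod_rep :: "('a, 'c) ring_scheme \<Rightarrow> ('a, 'm) module \<Rightarrow> ('a, 'a univ) module"
  where "mod_rep R M = (SOME N. N \<in> mod_cat R \<and> mod_isomorphic R M N)"

abbreviation mod_class :: "('a, 'c) ring_scheme \<Rightarrow> ('a, 'm) module \<Rightarrow> ('a, 'a univ) module \<Rightarrow>\<^sub>0 int"
  where "mod_class R M \<equiv> frag_of (mod_rep R M)"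

lemma mod_rep:
  assumes "fg_module R M"
  shows "mod_rep R M \<in> mod_cat R" "mod_isomorphic R M (mod_rep R M)"
  using someI_ex[OF fg_module_representative[OF assms, unfolded Bex_def]] by (auto simp: mod_rep_def)

lemma mod_cat_fg: "M \<in> mod_cat R \<longleftrightarrow> fg_module R M"
  by (simp add: mod_cat_def)

text \<open>The lift of \<open>K0_syzygy\<close> to formal sums; the two agree by
  \<open>K0_syzygy_of\<close>.\<close>

definition syzygy_map ::
    "('a, 'c) ring_scheme \<Rightarrow> (('a, 'a univ) module \<Rightarrow>\<^sub>0 int) \<Rightarrow> (('a, 'a univ) module \<Rightarrow>\<^sub>0 int)"
  where "syzygy_map R = frag_extend (\<lambda>M. frag_of (syzygy R M))"

lemma syzygy_map_diff: "syzygy_map R (x - y) = syzygy_map R x - syzygy_map R y"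
  by (simp add: syzygy_map_def frag_extend_diff)

lemma syzygy_map_pow_diff: "(syzygy_map R ^^ n) (x - y) = (syzygy_map R ^^ n) x - (syzygy_map R ^^ n) y"
  by (induction n) (simp_all add: syzygy_map_diff)

lemma syzygy_map_pow_add: "(syzygy_map R ^^ n) (x + y) = (syzygy_map R ^^ n) x + (syzygy_map R ^^ n) y"
  by (induction n) (simp_all add: syzygy_map_def frag_extend_add)

locale finite_length_ring =
  fixes R :: "('a, 'c) ring_scheme"
  assumes ring: "ring R" and finite_length: "finite_length R (regular_module R)"
begin

lemma zero_object: obtains Z where "Z \<in> mod_cat R" "carrier Z = {\<zero>\<^bsub>Z\<^esub>}"
proof -
  let ?P = "mod_rep R (regular_module R)"
  have P: "left_module R ?P"
    using mod_rep(1)[OF fg_module_regular[OF ring]] by (simp add: mod_cat_fg fg_module_left_module)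
  let ?Z = "?P\<lparr>carrier := {\<zero>\<^bsub>?P\<^esub>}\<rparr>"
  have "left_module R ?Z" by (rule left_module_submodule[OF P submodule_zero[OF P]])
  then have "?Z \<in> mod_cat R" by (simp add: mod_cat_fg fg_module_zero)
  then show thesis by (rule that) simp
qed

text \<open>The defining relations speak of direct sums. Adding a zero module, which is projective
  and so has class zero, turns an isomorphism into such a relation.\<close>

lemma K0_eq_iso:
  assumes M: "M \<in> mod_cat R" and N: "N \<in> mod_cat R" and iso: "mod_isomorphic R M N"
  shows "K0_eq R (frag_of M) (frag_of N)"
proof -
  obtain Z where Z: "Z \<in> mod_cat R" "carrier Z = {\<zero>\<^bsub>Z\<^esub>}" by (rule zero_object)
  have L: "left_module R M" "left_module R N" "left_module R Z"
    using M N Z by (simp_all add: mod_cat_fg fg_module_left_module)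
  have "mod_isomorphic R M (direct_sum N Z)"
    by (rule mod_isomorphic_trans[OF L(1,2) left_module_direct_sum[OF L(2,3)] iso
          direct_sum_zero_object[OF L(2,3) Z(2)]])
  from K0_relations_add[OF K0_relations_sum[OF N Z(1) M this]
      K0_relations_projective[OF Z(1) projective_zero[OF L(3) Z(2)]]]
  show ?thesis by (simp add: K0_eq_def)
qed

lemma mod_class_iso:
  assumes "fg_module R M" "fg_module R N" "mod_isomorphic R M N"
  shows "K0_eq R (mod_class R M) (mod_class R N)"
proof -
  note r = mod_rep[OF assms(1)] mod_rep[OF assms(2)]
  have L: "left_module R M" "left_module R N" "left_module R (mod_rep R M)" "left_module R (mod_rep R N)"
    using assms r by (simp_all add: mod_cat_fg fg_module_left_module)
  show ?thesis
    by (rule K0_eq_iso[OF r(1,3) mod_isomorphic_trans[OF L(3,2,4)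
            mod_isomorphic_trans[OF L(3,1,2) mod_isomorphic_sym[OF L(1,3) r(2)] assms(3)] r(4)]])
qed

lemma mod_class_mod_cat:
  assumes "M \<in> mod_cat R" shows "K0_eq R (mod_class R M) (frag_of M)"
proof -
  have fg: "fg_module R M" using assms by (simp add: mod_cat_fg)
  note r = mod_rep[OF fg]
  show ?thesis using K0_eq_sym[OF K0_eq_iso[OF assms r]] .
qed

lemma mod_class_sum:
  assumes "fg_module R M" "fg_module R N"
  shows "K0_eq R (mod_class R (direct_sum M N)) (mod_class R M + mod_class R N)"
proof -
  note fg = fg_module_direct_sum[OF assms]
  note r = mod_rep[OF assms(1)] mod_rep[OF assms(2)] mod_rep[OF fg]
  have L: "left_module R M" "left_module R N" "left_module R (mod_rep R M)" "left_module R (mod_rep R N)"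
    "left_module R (direct_sum M N)" "left_module R (mod_rep R (direct_sum M N))"
    using assms r fg by (simp_all add: mod_cat_fg fg_module_left_module)
  have "mod_isomorphic R (mod_rep R (direct_sum M N)) (direct_sum (mod_rep R M) (mod_rep R N))"
    by (rule mod_isomorphic_trans[OF L(6,5) left_module_direct_sum[OF L(3,4)]
          mod_isomorphic_sym[OF L(5,6) r(6)] mod_isomorphic_direct_sum[OF L(1,3,2,4) r(2,4)]])
  then show ?thesis unfolding K0_eq_def by (rule K0_relations_sum[OF r(1,3,5)])
qed

lemma mod_class_projective:
  assumes "fg_module R P" "projective R P"
  shows "mod_class R P \<in> K0_relations R"
proof -
  note r = mod_rep[OF assms(1)]
  have L: "left_module R P" "left_module R (mod_rep R P)"
    using assms r by (simp_all add: mod_cat_fg fg_module_left_module)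
  show ?thesis by (rule K0_relations_projective[OF r(1) projective_iso[OF assms(2) L r(2)]])
qed

lemma fg_ker:
  assumes "fg_module R M" "left_module R N" "module_map R M N f"
  shows "fg_module R (ker_mod M f N)"
  by (rule fg_submodule[OF finite_length assms(1) module_map_ker[OF fg_module_left_module[OF assms(1)] assms(2,3)]])

text \<open>Schanuel's lemma makes the kernels isomorphic after adding projectives, whose classes
  vanish.\<close>

lemma mod_class_kernels:
  assumes fg: "fg_module R P" "fg_module R Q" "fg_module R M" and proj: "projective R P" "projective R Q"
    and p: "module_map R P M p" "p ` carrier P = carrier M"
    and q: "module_map R Q M q" "q ` carrier Q = carrier M"
  shows "K0_eq R (mod_class R (ker_mod P p M)) (mod_class R (ker_mod Q q M))"
proof -
  note L = fg_module_left_module[OF fg(3)]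
  note k = fg_ker[OF fg(1) L p(1)] fg_ker[OF fg(2) L q(1)]
  have drop: "K0_eq R (mod_class R K) (mod_class R (direct_sum K V))"
    if "fg_module R K" "fg_module R V" "projective R V" for K V
  proof -
    have "K0_eq R (mod_class R K + mod_class R V) (mod_class R K + 0)"
      using mod_class_projective[OF that(2,3)] by (intro K0_eq_add) (simp_all add: K0_eq_zero)
    from K0_eq_trans[OF mod_class_sum[OF that(1,2)] this] show ?thesis by (simp add: K0_eq_sym)
  qed
  have "K0_eq R (mod_class R (ker_mod P p M)) (mod_class R (direct_sum (ker_mod P p M) Q))"
    by (rule drop[OF k(1) fg(2) proj(2)])
  also have "K0_eq R \<dots> (mod_class R (direct_sum (ker_mod Q q M) P))"
    by (rule mod_class_iso[OF fg_module_direct_sum[OF k(1) fg(2)] fg_module_direct_sum[OF k(2) fg(1)]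
          schanuel[OF fg proj p q]])
  also have "K0_eq R \<dots> (mod_class R (ker_mod Q q M))"
    by (rule K0_eq_sym[OF drop[OF k(2) fg(1) proj(1)]])
  finally show ?thesis .
qed

lemma syzygy_mod_cat:
  assumes "fg_module R M" shows "syzygy R M \<in> mod_cat R"
proof -
  obtain P p where P: "P \<in> mod_cat R" "projective R P" "module_map R P M p" "p ` carrier P = carrier M"
    "syzygy R M = ker_mod P p M" by (rule syzygy_kernel[OF finite_length assms])
  have "fg_module R P" using P(1) by (simp add: mod_cat_fg)
  from fg_ker[OF this fg_module_left_module[OF assms] P(3)] show ?thesis by (simp add: mod_cat_fg P(5))
qed

text \<open>Allows any projective surjection in place of the chosen projective cover, so that
  syzygies can be computed from whatever surjection is at hand.\<close>

lemma syzygy_class: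
  assumes "fg_module R P" "fg_module R M" "projective R P" "module_map R P M p" "p ` carrier P = carrier M"
  shows "K0_eq R (frag_of (syzygy R M)) (mod_class R (ker_mod P p M))"
proof -
  obtain Q q where Q: "Q \<in> mod_cat R" "projective R Q" "module_map R Q M q" "q ` carrier Q = carrier M"
    "syzygy R M = ker_mod Q q M" by (rule syzygy_kernel[OF finite_length assms(2)])
  have fgQ: "fg_module R Q" using Q(1) by (simp add: mod_cat_fg)
  have "K0_eq R (frag_of (syzygy R M)) (mod_class R (ker_mod Q q M))"
    using K0_eq_sym[OF mod_class_mod_cat[OF syzygy_mod_cat[OF assms(2)]]] unfolding Q(5) .
  also have "K0_eq R \<dots> (mod_class R (ker_mod P p M))"
    by (rule mod_class_kernels[OF fgQ assms(1,2) Q(2) assms(3) Q(3,4) assms(4,5)])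
  finally show ?thesis .
qed

lemma syzygy_map_class:
  assumes fg: "fg_module R P" "fg_module R M" and proj: "projective R P"
    and p: "module_map R P M p" "p ` carrier P = carrier M"
  shows "K0_eq R (syzygy_map R (mod_class R M)) (mod_class R (ker_mod P p M))"
proof -
  note r = mod_rep[OF fg(2)]
  have L: "left_module R M" "left_module R (mod_rep R M)" and fgr: "fg_module R (mod_rep R M)"
    using fg r by (simp_all add: mod_cat_fg fg_module_left_module)
  obtain f where f: "module_map R M (mod_rep R M) f" "bij_betw f (carrier M) (carrier (mod_rep R M))"
    using r(2) L by (auto simp: mod_isomorphic_iff)
  have inj: "\<forall>x \<in> carrier M. f x = \<zero>\<^bsub>mod_rep R M\<^esub> \<longrightarrow> x = \<zero>\<^bsub>M\<^esub>"
    using f(2) module_map_inj_iff[OF L f(1)] by (simp add: bij_betw_def)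
  have "(\<lambda>x. f (p x)) ` carrier P = carrier (mod_rep R M)"
    using p(2) f(2) by (metis bij_betw_def image_image)
  from syzygy_class[OF fg(1) fgr proj module_map_comp[OF p(1) f(1)] this]
  have "K0_eq R (frag_of (syzygy R (mod_rep R M))) (mod_class R (ker_mod P (\<lambda>x. f (p x)) (mod_rep R M)))" .
  moreover have "{x \<in> carrier P. f (p x) = \<zero>\<^bsub>mod_rep R M\<^esub>} = {x \<in> carrier P. p x = \<zero>\<^bsub>M\<^esub>}"
    using inj module_mapD(1)[OF p(1)] module_map_zero[OF L f(1)] by auto
  ultimately show ?thesis by (simp add: syzygy_map_def)
qed

text \<open>This makes \<open>\<Omega>\<close> well defined. The sum of two projective surjections
  has the direct sum of the kernels as its kernel; for a projective module the identity is a
  projective surjection with zero kernel.\<close>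

lemma syzygy_map_relations:
  assumes "x \<in> K0_relations R" shows "syzygy_map R x \<in> K0_relations R"
  unfolding syzygy_map_def
proof (rule frag_extend_K0_relations[OF _ _ assms])
  fix A B C
  assume *: "A \<in> mod_cat R" "B \<in> mod_cat R" "C \<in> mod_cat R" and iso: "mod_isomorphic R C (direct_sum A B)"
  have fg: "fg_module R A" "fg_module R B" "fg_module R C" using * by (simp_all add: mod_cat_fg)
  note L = fg[THEN fg_module_left_module]
  obtain f where f: "module_map R (direct_sum A B) C f" "bij_betw f (carrier (direct_sum A B)) (carrier C)"
    using mod_isomorphic_sym[OF L(3) left_module_direct_sum[OF L(1,2)] iso] L
    by (auto simp: mod_isomorphic_iff left_module_direct_sum simp del: direct_sum_sel)
  obtain P p where P: "P \<in> mod_cat R" "projective R P" "module_map R P A p" "p ` carrier P = carrier A"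
    by (rule projective_surjection[OF fg(1)])
  obtain Q q where Q: "Q \<in> mod_cat R" "projective R Q" "module_map R Q B q" "q ` carrier Q = carrier B"
    by (rule projective_surjection[OF fg(2)])
  have fgPQ: "fg_module R P" "fg_module R Q" using P Q by (simp_all add: mod_cat_fg)
  note LPQ = fgPQ[THEN fg_module_left_module]
  have inj: "inj_on f (carrier (direct_sum A B))" and surj: "f ` carrier (direct_sum A B) = carrier C"
    using f(2) by (simp_all add: bij_betw_def)
  have "K0_eq R (frag_of (syzygy R C)) (mod_class R (direct_sum (ker_mod P p A) (ker_mod Q q B)))"
    using syzygy_class[OF fg_module_direct_sum[OF fgPQ] fg(3) projective_direct_sum[OF P(2) Q(2) LPQ]
        module_map_direct_sum_comp[OF P(3) Q(3) f(1)] map_direct_sum_surj[OF P(4) Q(4) surj]]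
    unfolding ker_mod_direct_sum[OF L P(3) Q(3) f(1) inj] .
  also have "K0_eq R \<dots> (mod_class R (ker_mod P p A) + mod_class R (ker_mod Q q B))"
    by (rule mod_class_sum[OF fg_ker[OF fgPQ(1) L(1) P(3)] fg_ker[OF fgPQ(2) L(2) Q(3)]])
  also have "K0_eq R \<dots> (frag_of (syzygy R A) + frag_of (syzygy R B))"
    by (intro K0_eq_add K0_eq_sym[OF syzygy_class] fgPQ fg P Q)
  finally show "K0_eq R (frag_of (syzygy R C)) (frag_of (syzygy R A) + frag_of (syzygy R B))" .
next
  fix Q assume Q: "Q \<in> mod_cat R" "projective R Q"
  have fg: "fg_module R Q" using Q by (simp add: mod_cat_fg)
  note L = fg_module_left_module[OF fg]
  let ?K = "ker_mod Q (\<lambda>x. x) Q"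
  note LK = left_module_ker[OF L L module_map_id]
  note z = ker_mod_inj[OF L L module_map_id inj_on_id2]
  have "K0_eq R (frag_of (syzygy R Q)) (mod_class R ?K)"
    by (rule syzygy_class[OF fg fg Q(2) module_map_id]) simp
  moreover have "mod_class R ?K \<in> K0_relations R"
    by (rule mod_class_projective[OF fg_module_zero[OF LK z] projective_zero[OF LK z]])
  ultimately show "frag_of (syzygy R Q) \<in> K0_relations R" using K0_eq_relations by blast
qed

lemma syzygy_map_eq: "K0_eq R x y \<Longrightarrow> K0_eq R (syzygy_map R x) (syzygy_map R y)"
  using syzygy_map_relations[of "x - y"] by (simp add: K0_eq_def syzygy_map_diff)

lemma syzygy_map_pow_eq: "K0_eq R x y \<Longrightarrow> K0_eq R ((syzygy_map R ^^ n) x) ((syzygy_map R ^^ n) y)"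
  by (induction n) (simp_all add: syzygy_map_eq)

lemma syzygy_map_keys:
  assumes "Poly_Mapping.keys x \<subseteq> mod_cat R" shows "Poly_Mapping.keys (syzygy_map R x) \<subseteq> mod_cat R"
proof -
  have "Poly_Mapping.keys (syzygy_map R x) \<subseteq> (\<Union>M \<in> Poly_Mapping.keys x. {syzygy R M})"
    using keys_frag_extend[of "\<lambda>M. frag_of (syzygy R M)" x] by (simp add: syzygy_map_def)
  then show ?thesis using assms syzygy_mod_cat by (auto simp: mod_cat_fg subset_iff)
qed

lemma syzygy_map_pow_keys:
  "Poly_Mapping.keys x \<subseteq> mod_cat R \<Longrightarrow> Poly_Mapping.keys ((syzygy_map R ^^ n) x) \<subseteq> mod_cat R"
  by (induction n) (simp_all add: syzygy_map_keys)

end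

section \<open>Finite projective dimension\<close>

text \<open>Projective dimension at most \<open>n\<close>, by asking for one good projective
  surjection at each stage. Kernels keep the element type, so the recursion stays inside a single
  type; \<open>pd_le\<close> then admits any type through \<open>mod_rep\<close>.\<close>

primrec pd_le_aux :: "('a, 'c) ring_scheme \<Rightarrow> nat \<Rightarrow> ('a, 'a univ) module \<Rightarrow> bool"
  where
    "pd_le_aux R 0 M \<longleftrightarrow> projective R M"
  | "pd_le_aux R (Suc n) M \<longleftrightarrow> (\<exists>P \<in> mod_cat R. \<exists>p. projective R P \<and> module_map R P M p \<and>
      p ` carrier P = carrier M \<and> pd_le_aux R n (ker_mod P p M))"

definition pd_le :: "('a, 'c) ring_scheme \<Rightarrow> nat \<Rightarrow> ('a, 'm) module \<Rightarrow> bool"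
  where "pd_le R n M \<longleftrightarrow> pd_le_aux R n (mod_rep R M)"

context finite_length_ring
begin

lemma pd_le_aux_iso:
  assumes "M \<in> mod_cat R" "N \<in> mod_cat R" "mod_isomorphic R M N" "pd_le_aux R n M"
  shows "pd_le_aux R n N"
proof (cases n)
  case 0
  then show ?thesis using assms by (simp add: mod_cat_fg fg_module_left_module projective_iso[of R M])
next
  case (Suc k)
  have L: "left_module R M" "left_module R N" using assms by (simp_all add: mod_cat_fg fg_module_left_module)
  obtain f where f: "module_map R M N f" "bij_betw f (carrier M) (carrier N)"
    using assms L by (auto simp: mod_isomorphic_iff)
  obtain P p where P: "P \<in> mod_cat R" "projective R P" "module_map R P M p" "p ` carrier P = carrier M"
    "pd_le_aux R k (ker_mod P p M)" using assms(4) Suc by auto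
  have "(\<lambda>x. f (p x)) ` carrier P = carrier N" using P(4) f(2) by (metis bij_betw_def image_image)
  moreover have "pd_le_aux R k (ker_mod P (\<lambda>x. f (p x)) N)"
    unfolding ker_mod_comp_inj[OF L P(3) f(1) bij_betw_imp_inj_on[OF f(2)]] by (rule P(5))
  ultimately show ?thesis unfolding Suc pd_le_aux.simps using P(1,2) module_map_comp[OF P(3) f(1)] by blast
qed

lemma mod_rep_left_module: "fg_module R M \<Longrightarrow> left_module R (mod_rep R M)"
  using mod_rep(1)[of R M] by (simp add: mod_cat_fg fg_module_left_module)

lemma pd_le_iso:
  assumes fg: "fg_module R M" "fg_module R N" and iso: "mod_isomorphic R M N" and "pd_le R n M"
  shows "pd_le R n N"
proof -
  note L = fg[THEN fg_module_left_module] fg[THEN mod_rep_left_module]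
  have "mod_isomorphic R (mod_rep R M) (mod_rep R N)"
    by (rule mod_isomorphic_trans[OF L(3,2,4) mod_isomorphic_trans[OF L(3,1,2)
          mod_isomorphic_sym[OF L(1,3) mod_rep(2)[OF fg(1)]] iso] mod_rep(2)[OF fg(2)]])
  then show ?thesis using assms pd_le_aux_iso[OF mod_rep(1)[OF fg(1)] mod_rep(1)[OF fg(2)]]
    by (simp add: pd_le_def)
qed

lemma pd_le_mod_cat:
  assumes "M \<in> mod_cat R" shows "pd_le R n M \<longleftrightarrow> pd_le_aux R n M"
proof -
  have fg: "fg_module R M" using assms by (simp add: mod_cat_fg)
  note L = fg_module_left_module[OF fg] mod_rep_left_module[OF fg]
  show ?thesis unfolding pd_le_def
    using pd_le_aux_iso[OF mod_rep(1)[OF fg] assms mod_isomorphic_sym[OF L mod_rep(2)[OF fg]]]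
      pd_le_aux_iso[OF assms mod_rep[OF fg]] by blast
qed

lemma pd_le_0:
  assumes "fg_module R M" shows "pd_le R 0 M \<longleftrightarrow> projective R M"
proof -
  note L = fg_module_left_module[OF assms] mod_rep_left_module[OF assms]
  show ?thesis unfolding pd_le_def pd_le_aux.simps
    using projective_iso[OF _ L mod_rep(2)[OF assms]]
      projective_iso[OF _ L(2,1) mod_isomorphic_sym[OF L mod_rep(2)[OF assms]]] by blast
qed

lemma pd_le_SucE:
  assumes fg: "fg_module R M" and "pd_le R (Suc n) M"
  obtains P p where "P \<in> mod_cat R" "projective R P" "module_map R P M p" "p ` carrier P = carrier M"
    "pd_le R n (ker_mod P p M)"
proof -
  note L = fg_module_left_module[OF fg] mod_rep_left_module[OF fg]
  obtain P p where P: "P \<in> mod_cat R" "projective R P" "module_map R P (mod_rep R M) p"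
    "p ` carrier P = carrier (mod_rep R M)" "pd_le_aux R n (ker_mod P p (mod_rep R M))"
    using assms(2) by (auto simp: pd_le_def)
  obtain f where f: "module_map R (mod_rep R M) M f" "bij_betw f (carrier (mod_rep R M)) (carrier M)"
    using mod_isomorphic_sym[OF L mod_rep(2)[OF fg]] L by (auto simp: mod_isomorphic_iff)
  have surj: "(\<lambda>x. f (p x)) ` carrier P = carrier M" using P(4) f(2) by (metis bij_betw_def image_image)
  have fgP: "fg_module R P" using P(1) by (simp add: mod_cat_fg)
  have eq: "ker_mod P (\<lambda>x. f (p x)) M = ker_mod P p (mod_rep R M)"
    by (rule ker_mod_comp_inj[OF L(2,1) P(3) f(1) bij_betw_imp_inj_on[OF f(2)]])
  have k: "ker_mod P p (mod_rep R M) \<in> mod_cat R" using fg_ker[OF fgP L(2) P(3)] by (simp add: mod_cat_fg)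
  have "pd_le R n (ker_mod P (\<lambda>x. f (p x)) M)" unfolding eq pd_le_mod_cat[OF k] by (rule P(5))
  with P(1,2) module_map_comp[OF P(3) f(1)] surj show thesis by (rule that)
qed

lemma pd_le_SucI:
  assumes fg: "fg_module R P" "fg_module R M" and proj: "projective R P" and p: "module_map R P M p"
    and surj: "p ` carrier P = carrier M" and K: "pd_le R n (ker_mod P p M)"
  shows "pd_le R (Suc n) M"
proof -
  note L = fg[THEN fg_module_left_module] fg[THEN mod_rep_left_module]
  obtain f where f: "module_map R M (mod_rep R M) f" "bij_betw f (carrier M) (carrier (mod_rep R M))"
    using mod_rep(2)[OF fg(2)] L by (auto simp: mod_isomorphic_iff)
  obtain g where g: "module_map R (mod_rep R P) P g" "bij_betw g (carrier (mod_rep R P)) (carrier P)"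
    using mod_isomorphic_sym[OF L(1,3) mod_rep(2)[OF fg(1)]] L by (auto simp: mod_isomorphic_iff)
  let ?p = "\<lambda>x. f (p (g x))" and ?P = "mod_rep R P" and ?M = "mod_rep R M"
  have pg: "module_map R ?P M (\<lambda>x. p (g x))" by (rule module_map_comp[OF g(1) p])
  have p': "module_map R ?P ?M ?p" by (rule module_map_comp[OF pg f(1)])
  have "?p ` carrier ?P = f ` p ` g ` carrier ?P" by (simp add: image_image)
  then have "?p ` carrier ?P = carrier ?M" using surj f(2) g(2) by (simp add: bij_betw_def)
  moreover have "pd_le_aux R n (ker_mod ?P ?p ?M)"
  proof -
    have eq: "ker_mod ?P ?p ?M = ker_mod ?P (\<lambda>x. p (g x)) M"
      by (rule ker_mod_comp_inj[OF L(2,4) pg f(1) bij_betw_imp_inj_on[OF f(2)]])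
    note k = fg_ker[OF fg(1) L(2) p] fg_ker[OF _ L(2) pg, OF mod_rep(1)[OF fg(1), unfolded mod_cat_fg]]
    note LK = k[THEN fg_module_left_module]
    have "bij_betw g (carrier (ker_mod ?P (\<lambda>x. p (g x)) M)) (carrier (ker_mod P p M))"
      using g(2) by (auto simp: bij_betw_def inj_on_def image_iff)
    moreover have "module_map R (ker_mod ?P (\<lambda>x. p (g x)) M) (ker_mod P p M) g"
      using module_mapD[OF g(1)] by (auto simp: module_map_def)
    ultimately have "mod_isomorphic R (ker_mod ?P (\<lambda>x. p (g x)) M) (ker_mod P p M)"
      using LK by (auto simp: mod_isomorphic_iff)
    from pd_le_iso[OF k mod_isomorphic_sym[OF LK(2,1) this] K] show ?thesis
      using k(2) unfolding eq by (simp add: pd_le_mod_cat mod_cat_fg)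
  qed
  ultimately show ?thesis unfolding pd_le_def pd_le_aux.simps
    using mod_rep(1)[OF fg(1)] projective_iso[OF proj L(1,3) mod_rep(2)[OF fg(1)]] p' by blast
qed

lemma pd_le_projective:
  assumes "fg_module R M" "projective R M"
  shows "pd_le R n M"
  using assms
proof (induction n arbitrary: M)
  case 0
  then show ?case by (simp add: pd_le_0)
next
  case (Suc n)
  note L = fg_module_left_module[OF Suc.prems(1)]
  note z = ker_mod_inj[OF L L module_map_id inj_on_id2]
  note LK = left_module_ker[OF L L module_map_id]
  show ?case
    by (rule pd_le_SucI[OF Suc.prems(1,1,2) module_map_id image_ident
          Suc.IH[OF fg_module_zero[OF LK z] projective_zero[OF LK z]]])
qed

lemma pd_le_direct_sum_mod_cat:
  assumes "U \<in> mod_cat R" "V \<in> mod_cat R" "pd_le R n U" "pd_le R n V"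
  shows "pd_le R n (direct_sum U V)"
  using assms
proof (induction n arbitrary: U V)
  case 0
  then show ?case
    by (simp add: pd_le_0 mod_cat_fg fg_module_direct_sum projective_direct_sum fg_module_left_module)
next
  case (Suc n)
  have fg: "fg_module R U" "fg_module R V" using Suc.prems by (simp_all add: mod_cat_fg)
  note L = fg[THEN fg_module_left_module]
  obtain P p where P: "P \<in> mod_cat R" "projective R P" "module_map R P U p" "p ` carrier P = carrier U"
    "pd_le R n (ker_mod P p U)" by (rule pd_le_SucE[OF fg(1) Suc.prems(3)])
  obtain Q q where Q: "Q \<in> mod_cat R" "projective R Q" "module_map R Q V q" "q ` carrier Q = carrier V"
    "pd_le R n (ker_mod Q q V)" by (rule pd_le_SucE[OF fg(2) Suc.prems(4)])
  have fgPQ: "fg_module R P" "fg_module R Q" using P Q by (simp_all add: mod_cat_fg)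
  note LPQ = fgPQ[THEN fg_module_left_module]
  have k: "ker_mod P p U \<in> mod_cat R" "ker_mod Q q V \<in> mod_cat R"
    using fg_ker[OF fgPQ(1) L(1) P(3)] fg_ker[OF fgPQ(2) L(2) Q(3)] by (simp_all add: mod_cat_fg)
  show ?case
  proof (rule pd_le_SucI[OF fg_module_direct_sum[OF fgPQ] fg_module_direct_sum[OF fg]
        projective_direct_sum[OF P(2) Q(2) LPQ]
        module_map_direct_sum_comp[OF P(3) Q(3) module_map_id] map_direct_sum_surj[OF P(4) Q(4) image_ident]])
    show "pd_le R n (ker_mod (direct_sum P Q) (\<lambda>z. (p (fst z), q (snd z))) (direct_sum U V))"
      unfolding ker_mod_direct_sum[OF L left_module_direct_sum[OF L] P(3) Q(3) module_map_id inj_on_id2]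
      by (rule Suc.IH[OF k P(5) Q(5)])
  qed
qed

lemma mod_rep_fg: "fg_module R M \<Longrightarrow> fg_module R (mod_rep R M)"
  using mod_rep(1)[of R M] by (simp add: mod_cat_fg)

lemma pd_le_direct_sum:
  assumes fg: "fg_module R U" "fg_module R V" and "pd_le R n U" "pd_le R n V"
  shows "pd_le R n (direct_sum U V)"
proof -
  note L = fg[THEN fg_module_left_module] fg[THEN mod_rep_left_module]
  have "pd_le R n (direct_sum (mod_rep R U) (mod_rep R V))"
    by (rule pd_le_direct_sum_mod_cat[OF mod_rep(1)[OF fg(1)] mod_rep(1)[OF fg(2)]])
      (use assms(3,4) mod_rep(1)[OF fg(1)] mod_rep(1)[OF fg(2)] in
        \<open>simp_all add: pd_le_mod_cat\<close>, simp_all add: pd_le_def)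
  from pd_le_iso[OF fg_module_direct_sum[OF fg[THEN mod_rep_fg]] fg_module_direct_sum[OF fg]
      mod_isomorphic_sym[OF left_module_direct_sum[OF L(1,2)] left_module_direct_sum[OF L(3,4)]
        mod_isomorphic_direct_sum[OF L(1,3,2,4) mod_rep(2)[OF fg(1)] mod_rep(2)[OF fg(2)]]] this]
  show ?thesis .
qed

text \<open>Schanuel's lemma for \<open>T\<close> and \<open>P \<oplus> Q\<close> over
  \<open>U \<oplus> V\<close> exhibits the kernel over \<open>U\<close> as a summand of a module of
  dimension at most \<open>n\<close>. The complement changes at each step, so the induction
  generalises over it.\<close>

lemma pd_le_summand_mod_cat:
  assumes "U \<in> mod_cat R" "V \<in> mod_cat R" "pd_le R n (direct_sum U V)"
  shows "pd_le R n U"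
  using assms
proof (induction n arbitrary: U V)
  case 0
  then have fg: "fg_module R U" "fg_module R V" by (simp_all add: mod_cat_fg)
  show ?case using 0(3) projective_summand[OF _ fg[THEN fg_module_left_module]]
    by (simp add: pd_le_0 fg fg_module_direct_sum)
next
  case (Suc n)
  have fg: "fg_module R U" "fg_module R V" using Suc.prems by (simp_all add: mod_cat_fg)
  note L = fg[THEN fg_module_left_module]
  note fgUV = fg_module_direct_sum[OF fg]
  obtain T t where T: "T \<in> mod_cat R" "projective R T" "module_map R T (direct_sum U V) t"
    "t ` carrier T = carrier (direct_sum U V)" "pd_le R n (ker_mod T t (direct_sum U V))"
    by (rule pd_le_SucE[OF fgUV Suc.prems(3)])
  obtain P p where P: "P \<in> mod_cat R" "projective R P" "module_map R P U p" "p ` carrier P = carrier U"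
    by (rule projective_surjection[OF fg(1)])
  obtain Q q where Q: "Q \<in> mod_cat R" "projective R Q" "module_map R Q V q" "q ` carrier Q = carrier V"
    by (rule projective_surjection[OF fg(2)])
  have fgP: "fg_module R P" "fg_module R Q" "fg_module R T" using P Q T by (simp_all add: mod_cat_fg)
  note LP = fgP[THEN fg_module_left_module]
  let ?r = "\<lambda>z. (p (fst z), q (snd z))"
  let ?kT = "ker_mod T t (direct_sum U V)" and ?kP = "ker_mod P p U" and ?kQ = "ker_mod Q q V"
  note r = module_map_direct_sum_comp[OF P(3) Q(3) module_map_id] map_direct_sum_surj[OF P(4) Q(4) image_ident]
  have fgk: "fg_module R ?kT" "fg_module R ?kP" "fg_module R ?kQ"
    using fg_ker[OF fgP(3) left_module_direct_sum[OF L] T(3)] fg_ker[OF fgP(1) L(1) P(3)]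
      fg_ker[OF fgP(2) L(2) Q(3)] by simp_all
  note Lk = fgk[THEN fg_module_left_module]
  note fPQ = fg_module_direct_sum[OF fgP(1,2)] and pPQ = projective_direct_sum[OF P(2) Q(2) LP(1,2)]
  have 1: "mod_isomorphic R (direct_sum ?kT (direct_sum P Q)) (direct_sum (direct_sum ?kP ?kQ) T)"
    using schanuel[OF fgP(3) fPQ fgUV T(2) pPQ T(3,4) r]
    unfolding ker_mod_direct_sum[OF L left_module_direct_sum[OF L] P(3) Q(3) module_map_id inj_on_id2] .
  \<comment> \<open>The new complement has to be an object of \<open>mod_cat R\<close> again for the
    induction hypothesis to fit its type.\<close>
  let ?W = "mod_rep R (direct_sum ?kQ T)"
  note fkT = fg_module_direct_sum[OF fgk(3) fgP(3)]
  note S = left_module_direct_sum[OF Lk(1) left_module_direct_sum[OF LP(1,2)]]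
    left_module_direct_sum[OF left_module_direct_sum[OF Lk(2,3)] LP(3)]
    left_module_direct_sum[OF Lk(2) left_module_direct_sum[OF Lk(3) LP(3)]]
    left_module_direct_sum[OF Lk(2) mod_rep_left_module[OF fkT]]
  have 2: "mod_isomorphic R (direct_sum ?kT (direct_sum P Q)) (direct_sum ?kP ?W)"
    by (rule mod_isomorphic_trans[OF S(1,3,4) mod_isomorphic_trans[OF S(1,2,3) 1
            direct_sum_assoc[OF Lk(2,3) LP(3)]]
          mod_isomorphic_direct_sum[OF Lk(2,2) left_module_direct_sum[OF Lk(3) LP(3)]
            mod_rep_left_module[OF fkT] mod_isomorphic_refl[OF Lk(2)] mod_rep(2)[OF fkT]]])
  have 3: "pd_le R n (direct_sum ?kT (direct_sum P Q))"
    by (rule pd_le_direct_sum[OF fgk(1) fPQ T(5) pd_le_projective[OF fPQ pPQ]])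
  have "pd_le R n (direct_sum ?kP ?W)"
    by (rule pd_le_iso[OF fg_module_direct_sum[OF fgk(1) fPQ]
          fg_module_direct_sum[OF fgk(2) mod_rep_fg[OF fkT]] 2 3])
  then have "pd_le R n ?kP"
    using Suc.IH[of ?kP ?W] fgk(2) mod_rep(1)[OF fkT] by (simp add: mod_cat_fg)
  then show ?case by (rule pd_le_SucI[OF fgP(1) fg(1) P(2,3,4)])
qed

lemma pd_le_summand:
  assumes fg: "fg_module R U" "fg_module R V" and "pd_le R n (direct_sum U V)"
  shows "pd_le R n U"
proof -
  note L = fg[THEN fg_module_left_module] fg[THEN mod_rep_left_module]
  have "pd_le R n (direct_sum (mod_rep R U) (mod_rep R V))"
    by (rule pd_le_iso[OF fg_module_direct_sum[OF fg] fg_module_direct_sum[OF fg[THEN mod_rep_fg]]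
        mod_isomorphic_direct_sum[OF L(1,3,2,4) mod_rep(2)[OF fg(1)] mod_rep(2)[OF fg(2)]] assms(3)])
  from pd_le_summand_mod_cat[OF mod_rep(1)[OF fg(1)] mod_rep(1)[OF fg(2)] this] show ?thesis
    using mod_rep(1)[OF fg(1)] by (simp add: pd_le_mod_cat) (simp add: pd_le_def)
qed

text \<open>\<open>pd_le\<close> promises a single surjection with a good kernel. By Schanuel's
  lemma any other kernel is a summand of that one plus a projective.\<close>

lemma pd_le_ker:
  assumes fg: "fg_module R P" "fg_module R M" and proj: "projective R P" and p: "module_map R P M p"
    and surj: "p ` carrier P = carrier M" and M: "pd_le R (Suc n) M"
  shows "pd_le R n (ker_mod P p M)"
proof -
  obtain T t where T: "T \<in> mod_cat R" "projective R T" "module_map R T M t" "t ` carrier T = carrier M"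
    "pd_le R n (ker_mod T t M)" by (rule pd_le_SucE[OF fg(2) M])
  have fgT: "fg_module R T" using T by (simp add: mod_cat_fg)
  note LM = fg_module_left_module[OF fg(2)]
  note k = fg_ker[OF fg(1) LM p] fg_ker[OF fgT LM T(3)]
  have "pd_le R n (direct_sum (ker_mod T t M) P)"
    by (rule pd_le_direct_sum[OF k(2) fg(1) T(5) pd_le_projective[OF fg(1) proj]])
  from pd_le_iso[OF fg_module_direct_sum[OF k(2) fg(1)] fg_module_direct_sum[OF k(1) fgT]
      schanuel[OF fgT fg(1,2) T(2) proj T(3,4) p surj] this]
  show ?thesis by (rule pd_le_summand[OF k(1) fgT])
qed

text \<open>Pulling back along a projective surjection \<open>q\<close> onto the middle term turns the exact sequence with
  terms \<open>ker g, B, C\<close> into one with terms \<open>ker q, ker (g q), ker g\<close>. Its first two terms are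
  syzygies of \<open>B\<close> and \<open>C\<close>, and the finiteness of the projective dimension moves from one term to
  another. Alternating between the three positions replaces the horseshoe lemma.\<close>

lemma rotate_exact:
  assumes B: "left_module R B" and C: "left_module R C" and g: "module_map R B C g" "g ` carrier B = carrier C"
    and q: "module_map R Q B q" "q ` carrier Q = carrier B"
  shows "module_map R (ker_mod Q (\<lambda>x. g (q x)) C) (ker_mod B g C) q"
    "q ` carrier (ker_mod Q (\<lambda>x. g (q x)) C) = carrier (ker_mod B g C)"
    "ker_mod (ker_mod Q (\<lambda>x. g (q x)) C) q (ker_mod B g C) = ker_mod Q q B"
    "(\<lambda>x. g (q x)) ` carrier Q = carrier C"
proof -
  show "module_map R (ker_mod Q (\<lambda>x. g (q x)) C) (ker_mod B g C) q"
    using module_mapD[OF q(1)] by (auto simp: module_map_def)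
  show "q ` carrier (ker_mod Q (\<lambda>x. g (q x)) C) = carrier (ker_mod B g C)"
    using q(2) by auto
  have "{x \<in> carrier Q. g (q x) = \<zero>\<^bsub>C\<^esub> \<and> q x = \<zero>\<^bsub>B\<^esub>} = {x \<in> carrier Q. q x = \<zero>\<^bsub>B\<^esub>}"
    using module_map_zero[OF B C g(1)] by auto
  then show "ker_mod (ker_mod Q (\<lambda>x. g (q x)) C) q (ker_mod B g C) = ker_mod Q q B" by (simp add: conj_assoc)
  show "(\<lambda>x. g (q x)) ` carrier Q = carrier C" using g(2) q(2) by (metis image_image)
qed

text \<open>The two parts have the term of finite projective dimension at the right end and in the
  middle. They are proved together because a rotation moves this term: from the right end to the
  middle, from the middle to the left end, and from there to the right end.\<close>

lemma syzygy_pow_exact_mod_cat: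
  "(\<forall>B \<in> mod_cat R. \<forall>C \<in> mod_cat R. \<forall>g. module_map R B C g \<longrightarrow> g ` carrier B = carrier C \<longrightarrow> pd_le R d C \<longrightarrow>
      K0_eq R ((syzygy_map R ^^ d) (mod_class R (ker_mod B g C))) ((syzygy_map R ^^ d) (mod_class R B))) \<and>
   (\<forall>B \<in> mod_cat R. \<forall>C \<in> mod_cat R. \<forall>g. module_map R B C g \<longrightarrow> g ` carrier B = carrier C \<longrightarrow> pd_le R d B \<longrightarrow>
      K0_eq R ((syzygy_map R ^^ d) (mod_class R (ker_mod B g C))) ((syzygy_map R ^^ Suc d) (mod_class R C)))"
proof (induction d)
  case 0
  show ?case
  proof (intro conjI ballI allI impI)
    fix B C g assume *: "B \<in> mod_cat R" "C \<in> mod_cat R" "module_map R B C g" "g ` carrier B = carrier C" "pd_le R 0 C"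
    have fg: "fg_module R B" "fg_module R C" using * by (simp_all add: mod_cat_fg)
    have C: "projective R C" using * fg by (simp add: pd_le_0)
    note L = fg[THEN fg_module_left_module]
    note k = fg_ker[OF fg(1) L(2) *(3)]
    obtain h where h: "module_map R C B h" "\<And>x. x \<in> carrier C \<Longrightarrow> g (h x) = x"
      by (rule projective_lift[OF C L(2) fg *(3,4) module_map_id]) (rule that)
    have "K0_eq R (mod_class R B) (mod_class R (direct_sum (ker_mod B g C) C))"
      by (rule mod_class_iso[OF fg(1) fg_module_direct_sum[OF k fg(2)] split_surjection[OF L *(3) h]])
    also have "K0_eq R \<dots> (mod_class R (ker_mod B g C) + mod_class R C)"
      by (rule mod_class_sum[OF k fg(2)])
    also have "K0_eq R \<dots> (mod_class R (ker_mod B g C) + 0)"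
      using mod_class_projective[OF fg(2) C] by (intro K0_eq_add) (simp_all add: K0_eq_zero)
    finally show "K0_eq R ((syzygy_map R ^^ 0) (mod_class R (ker_mod B g C))) ((syzygy_map R ^^ 0) (mod_class R B))"
      by (simp add: K0_eq_sym)
  next
    fix B C g assume *: "B \<in> mod_cat R" "C \<in> mod_cat R" "module_map R B C g" "g ` carrier B = carrier C" "pd_le R 0 B"
    have fg: "fg_module R B" "fg_module R C" using * by (simp_all add: mod_cat_fg)
    then have "projective R B" using * by (simp add: pd_le_0)
    from syzygy_map_class[OF fg this *(3,4)]
    show "K0_eq R ((syzygy_map R ^^ 0) (mod_class R (ker_mod B g C))) ((syzygy_map R ^^ Suc 0) (mod_class R C))"
      by (simp add: K0_eq_sym)
  qed
next
  case (Suc d)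
  have right: "K0_eq R ((syzygy_map R ^^ d) (mod_class R (ker_mod B g C))) ((syzygy_map R ^^ d) (mod_class R B))"
    if "B \<in> mod_cat R" "C \<in> mod_cat R" "module_map R B C g" "g ` carrier B = carrier C" "pd_le R d C" for B C g
    using Suc that by blast
  have mid: "K0_eq R ((syzygy_map R ^^ d) (mod_class R (ker_mod B g C))) ((syzygy_map R ^^ Suc d) (mod_class R C))"
    if "B \<in> mod_cat R" "C \<in> mod_cat R" "module_map R B C g" "g ` carrier B = carrier C" "pd_le R d B" for B C g
    using Suc that by blast
  have suc: "K0_eq R ((syzygy_map R ^^ Suc d) (mod_class R M)) ((syzygy_map R ^^ d) (mod_class R (ker_mod P p M)))"
    if "P \<in> mod_cat R" "M \<in> mod_cat R" "projective R P" "module_map R P M p" "p ` carrier P = carrier M" for P M p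
    using syzygy_map_pow_eq[OF syzygy_map_class[of P M p], of d] that
    by (simp add: mod_cat_fg funpow_Suc_right del: funpow.simps)
  \<comment> \<open>The third position, where the kernel has finite projective dimension. It costs
    one more syzygy and follows from the first part at \<open>d\<close> after a rotation.\<close>
  have left: "K0_eq R ((syzygy_map R ^^ Suc d) (mod_class R B)) ((syzygy_map R ^^ Suc d) (mod_class R C))"
    if *: "B \<in> mod_cat R" "C \<in> mod_cat R" "module_map R B C g" "g ` carrier B = carrier C" "pd_le R d (ker_mod B g C)"
    for B C g
  proof -
    have fg: "fg_module R B" "fg_module R C" using * by (simp_all add: mod_cat_fg)
    note L = fg[THEN fg_module_left_module]
    obtain Q q where Q: "Q \<in> mod_cat R" "projective R Q" "module_map R Q B q" "q ` carrier Q = carrier B"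
      by (rule projective_surjection[OF fg(1)])
    have fgQ: "fg_module R Q" using Q by (simp add: mod_cat_fg)
    note rot = rotate_exact[OF L *(3,4) Q(3,4)]
    note gq = module_map_comp[OF Q(3) *(3)]
    have mc: "ker_mod Q (\<lambda>x. g (q x)) C \<in> mod_cat R" "ker_mod B g C \<in> mod_cat R"
      using fg_ker[OF fgQ L(2) gq] fg_ker[OF fg(1) L(2) *(3)] by (simp_all add: mod_cat_fg)
    have "K0_eq R ((syzygy_map R ^^ Suc d) (mod_class R B)) ((syzygy_map R ^^ d) (mod_class R (ker_mod Q q B)))"
      by (rule suc[OF Q(1) *(1) Q(2,3,4)])
    also have "K0_eq R \<dots> ((syzygy_map R ^^ d) (mod_class R (ker_mod Q (\<lambda>x. g (q x)) C)))"
      using right[OF mc rot(1,2) *(5)] unfolding rot(3) .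
    also have "K0_eq R \<dots> ((syzygy_map R ^^ Suc d) (mod_class R C))"
      by (rule K0_eq_sym[OF suc[OF Q(1) *(2) Q(2) gq rot(4)]])
    finally show ?thesis .
  qed
  show ?case
  proof (intro conjI ballI allI impI)
    fix B C g
    assume *: "B \<in> mod_cat R" "C \<in> mod_cat R" "module_map R B C g" "g ` carrier B = carrier C" "pd_le R (Suc d) C"
    have fg: "fg_module R B" "fg_module R C" using * by (simp_all add: mod_cat_fg)
    note L = fg[THEN fg_module_left_module]
    obtain Q q where Q: "Q \<in> mod_cat R" "projective R Q" "module_map R Q B q" "q ` carrier Q = carrier B"
      by (rule projective_surjection[OF fg(1)])
    have fgQ: "fg_module R Q" using Q by (simp add: mod_cat_fg)
    note rot = rotate_exact[OF L *(3,4) Q(3,4)]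
    note gq = module_map_comp[OF Q(3) *(3)]
    have mc: "ker_mod Q (\<lambda>x. g (q x)) C \<in> mod_cat R" "ker_mod B g C \<in> mod_cat R"
      using fg_ker[OF fgQ L(2) gq] fg_ker[OF fg(1) L(2) *(3)] by (simp_all add: mod_cat_fg)
    have "K0_eq R ((syzygy_map R ^^ Suc d) (mod_class R B)) ((syzygy_map R ^^ d) (mod_class R (ker_mod Q q B)))"
      by (rule suc[OF Q(1) *(1) Q(2,3,4)])
    also have "K0_eq R \<dots> ((syzygy_map R ^^ Suc d) (mod_class R (ker_mod B g C)))"
      using mid[OF mc rot(1,2) pd_le_ker[OF fgQ fg(2) Q(2) gq rot(4) *(5)]] unfolding rot(3) .
    finally show "K0_eq R ((syzygy_map R ^^ Suc d) (mod_class R (ker_mod B g C))) ((syzygy_map R ^^ Suc d) (mod_class R B))"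
      by (rule K0_eq_sym)
  next
    fix B C g
    assume *: "B \<in> mod_cat R" "C \<in> mod_cat R" "module_map R B C g" "g ` carrier B = carrier C" "pd_le R (Suc d) B"
    have fg: "fg_module R B" "fg_module R C" using * by (simp_all add: mod_cat_fg)
    note L = fg[THEN fg_module_left_module]
    obtain Q q where Q: "Q \<in> mod_cat R" "projective R Q" "module_map R Q B q" "q ` carrier Q = carrier B"
      "pd_le R d (ker_mod Q q B)"
      by (rule pd_le_SucE[OF fg(1) *(5)])
    have fgQ: "fg_module R Q" using Q by (simp add: mod_cat_fg)
    note rot = rotate_exact[OF L *(3,4) Q(3,4)]
    note gq = module_map_comp[OF Q(3) *(3)]
    have mc: "ker_mod Q (\<lambda>x. g (q x)) C \<in> mod_cat R" "ker_mod B g C \<in> mod_cat R"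
      using fg_ker[OF fgQ L(2) gq] fg_ker[OF fg(1) L(2) *(3)] by (simp_all add: mod_cat_fg)
    have "K0_eq R ((syzygy_map R ^^ Suc d) (mod_class R (ker_mod Q (\<lambda>x. g (q x)) C)))
        ((syzygy_map R ^^ Suc d) (mod_class R (ker_mod B g C)))"
      by (rule left[OF mc rot(1,2)]) (unfold rot(3), rule Q(5))
    from K0_eq_trans[OF K0_eq_sym[OF this] syzygy_map_pow_eq[OF K0_eq_sym[OF syzygy_map_class[OF fgQ fg(2) Q(2) gq rot(4)]]]]
    show "K0_eq R ((syzygy_map R ^^ Suc d) (mod_class R (ker_mod B g C))) ((syzygy_map R ^^ Suc (Suc d)) (mod_class R C))"
      by (simp add: funpow_Suc_right del: funpow.simps)
  qed
qed

lemma syzygy_pow_exact: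
  assumes fg: "fg_module R B" "fg_module R C" and g: "module_map R B C g" "g ` carrier B = carrier C"
    and pd: "pd_le R d B"
  shows "K0_eq R ((syzygy_map R ^^ d) (mod_class R (ker_mod B g C))) ((syzygy_map R ^^ Suc d) (mod_class R C))"
proof -
  note L = fg[THEN fg_module_left_module] fg[THEN mod_rep_left_module]
  let ?B = "mod_rep R B" and ?C = "mod_rep R C"
  obtain f where f: "module_map R C ?C f" "bij_betw f (carrier C) (carrier ?C)"
    using mod_rep(2)[OF fg(2)] L by (auto simp: mod_isomorphic_iff)
  obtain h where h: "module_map R ?B B h" "bij_betw h (carrier ?B) (carrier B)"
    using mod_isomorphic_sym[OF L(1,3) mod_rep(2)[OF fg(1)]] L by (auto simp: mod_isomorphic_iff)
  let ?g = "\<lambda>x. f (g (h x))"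
  have gh: "module_map R ?B C (\<lambda>x. g (h x))" by (rule module_map_comp[OF h(1) g(1)])
  have g': "module_map R ?B ?C ?g" by (rule module_map_comp[OF gh f(1)])
  have "?g ` carrier ?B = f ` g ` h ` carrier ?B" by (simp add: image_image)
  then have surj: "?g ` carrier ?B = carrier ?C" using g(2) f(2) h(2) by (simp add: bij_betw_def)
  have eq: "ker_mod ?B ?g ?C = ker_mod ?B (\<lambda>x. g (h x)) C"
    by (rule ker_mod_comp_inj[OF L(2,4) gh f(1) bij_betw_imp_inj_on[OF f(2)]])
  note k = fg_ker[OF fg(1) L(2) g(1)] fg_ker[OF mod_rep_fg[OF fg(1)] L(2) gh]
  note LK = k[THEN fg_module_left_module]
  have "bij_betw h (carrier (ker_mod ?B (\<lambda>x. g (h x)) C)) (carrier (ker_mod B g C))"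
    using h(2) by (auto simp: bij_betw_def inj_on_def image_iff)
  moreover have "module_map R (ker_mod ?B (\<lambda>x. g (h x)) C) (ker_mod B g C) h"
    using module_mapD[OF h(1)] by (auto simp: module_map_def)
  ultimately have "mod_isomorphic R (ker_mod ?B (\<lambda>x. g (h x)) C) (ker_mod B g C)"
    using LK by (auto simp: mod_isomorphic_iff)
  then have "K0_eq R (mod_class R (ker_mod B g C)) (mod_class R (ker_mod ?B ?g ?C))"
    unfolding eq by (rule K0_eq_sym[OF mod_class_iso[OF k(2,1)]])
  then have "K0_eq R ((syzygy_map R ^^ d) (mod_class R (ker_mod B g C))) ((syzygy_map R ^^ d) (mod_class R (ker_mod ?B ?g ?C)))"
    by (rule syzygy_map_pow_eq)
  also have "K0_eq R \<dots> ((syzygy_map R ^^ Suc d) (mod_class R ?C))"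
  proof -
    note pd' = pd_le_iso[OF fg(1) mod_rep_fg[OF fg(1)] mod_rep(2)[OF fg(1)] pd]
    note mid = conjunct2[OF syzygy_pow_exact_mod_cat[of d]]
    show ?thesis
      by (rule mid[THEN bspec, OF mod_rep(1)[OF fg(1)], THEN bspec, OF mod_rep(1)[OF fg(2)], THEN spec,
            THEN mp, OF g', THEN mp, OF surj, THEN mp, OF pd'])
  qed
  also have "K0_eq R \<dots> ((syzygy_map R ^^ Suc d) (mod_class R C))"
    by (rule syzygy_map_pow_eq[OF mod_class_iso[OF mod_rep_fg[OF fg(2)] fg(2)
            mod_isomorphic_sym[OF L(2,4) mod_rep(2)[OF fg(2)]]]])
  finally show ?thesis .
qed

text \<open>Each syzygy replaces the class by that of a kernel of smaller dimension, and at
  dimension zero a projective is reached.\<close>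

lemma syzygy_pow_finite_pd:
  assumes "M \<in> mod_cat R" "pd_le R d M"
  shows "(syzygy_map R ^^ d) (mod_class R M) \<in> K0_relations R"
  using assms
proof (induction d arbitrary: M)
  case 0
  then show ?case using mod_class_projective[of M] by (simp add: mod_cat_fg pd_le_0)
next
  case (Suc d)
  have fg: "fg_module R M" using Suc.prems by (simp add: mod_cat_fg)
  obtain P p where P: "P \<in> mod_cat R" "projective R P" "module_map R P M p" "p ` carrier P = carrier M"
    "pd_le R d (ker_mod P p M)" by (rule pd_le_SucE[OF fg Suc.prems(2)])
  have fgP: "fg_module R P" using P by (simp add: mod_cat_fg)
  have "ker_mod P p M \<in> mod_cat R"
    using fg_ker[OF fgP fg_module_left_module[OF fg] P(3)] by (simp add: mod_cat_fg)
  from Suc.IH[OF this P(5)] K0_eq_relations[OF syzygy_map_pow_eq[OF syzygy_map_class[OF fgP fg P(2,3,4)]], of d]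
  show ?case by (simp add: funpow_Suc_right del: funpow.simps)
qed

text \<open>Climbs back from the end of a finite resolution: the image of the differential at index
  \<open>n\<close> is zero, and each earlier image gets a bound larger by one. The result exceeds
  the length by one, which is harmless, since any finite \<open>d\<close> serves in the
  comparison.\<close>

lemma pd_le_of_proj_dim:
  assumes fg: "fg_module R M" and "proj_dim R M < \<infinity>"
  obtains d where "pd_le R d M"
proof -
  let ?S = "{enat n |n. \<exists>P d e. proj_resolution R M P d e \<and> (\<forall>i>n. carrier (P i) = {\<zero>\<^bsub>P i\<^esub>})}"
  have "?S \<noteq> {}" using assms(2) unfolding proj_dim_def by (metis Inf_empty less_irrefl top_enat_def)
  then obtain n P d e where P: "proj_resolution R M P d e" "\<And>i. i > n \<Longrightarrow> carrier (P i) = {\<zero>\<^bsub>P i\<^esub>}" by auto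
  have Pi: "P i \<in> mod_cat R" "projective R (P i)" "fg_module R (P i)" for i
    using P(1) by (simp_all add: proj_resolution_def mod_cat_fg)
  note LP = Pi(3)[THEN fg_module_left_module]
  have d: "module_map R (P (Suc i)) (P i) (d i)" for i
    using P(1) by (auto simp: proj_resolution_def intro: module_map_of_hom)
  let ?I = "\<lambda>i. P i\<lparr>carrier := d i ` carrier (P (Suc i))\<rparr>"
  have sI: "submodule (d i ` carrier (P (Suc i))) R (P i)" for i
    by (rule module_map_image[OF LP LP d submodule_carrier[OF LP]])
  have dI: "module_map R (P (Suc i)) (?I i) (d i)" for i
    using d[of i] submoduleD(1)[OF sI[of i]] by (simp add: module_map_into_submodule)
  have LI: "left_module R (?I i)" for i by (rule left_module_submodule[OF LP sI])
  have fgI: "fg_module R (?I i)" for i by (rule fg_module_image[OF Pi(3) LI dI]) simp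
  have kI: "ker_mod (P (Suc i)) (d i) (?I i) = ?I (Suc i)" for i
    using P(1) by (simp add: proj_resolution_def)
  have "pd_le R k (?I (n - k))" if "k \<le> n" for k
    using that
  proof (induction k)
    case 0
    have "carrier (?I n) = {\<zero>\<^bsub>?I n\<^esub>}"
      using module_map_zero[OF LP LP d, of n] P(2)[of "Suc n"] by simp
    from projective_zero[OF LI this] show ?case unfolding diff_zero pd_le_0[OF fgI] .
  next
    case (Suc k)
    define i where "i = n - Suc k"
    have "n - k = Suc i" using Suc.prems by (simp add: i_def)
    then have "pd_le R k (?I (Suc i))" using Suc by simp
    then have "pd_le R k (ker_mod (P (Suc i)) (d i) (?I i))" unfolding kI .
    then have "pd_le R (Suc k) (?I i)" by (rule pd_le_SucI[OF Pi(3) fgI Pi(2) dI, rotated]) simp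
    then show ?case unfolding i_def .
  qed
  from this[of n] have 0: "pd_le R n (?I 0)" by simp
  have e: "module_map R (P 0) M e" "e ` carrier (P 0) = carrier M" "ker_mod (P 0) e M = ?I 0"
    using P(1) by (auto simp: proj_resolution_def intro: module_map_of_hom)
  have "pd_le R (Suc n) M" by (rule pd_le_SucI[OF Pi(3) fg Pi(2) e(1,2)]) (unfold e(3), rule 0)
  then show thesis by (rule that)
qed

end

section \<open>Indecomposable summands\<close>

text \<open>The images of the powers stabilise, so \<open>(f ^^ n) y\<close> is also
  \<open>(f ^^ n) (f z)\<close> for some \<open>z\<close>, and the injective power cancels.\<close>

lemma injective_endomorphism_surjective:
  assumes M: "left_module R M" and fl: "finite_length R M" and f: "module_map R M M f"
    and inj: "inj_on f (carrier M)"
  shows "f ` carrier M = carrier M"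
proof
  show "f ` carrier M \<subseteq> carrier M" using module_mapD(1)[OF f] by auto
  note fn = module_map_funpow[OF f]
  let ?I = "\<lambda>n. (f ^^ n) ` carrier M"
  have "\<exists>n. \<forall>m\<ge>n. ?I m = ?I n"
  proof (rule finite_length_chain[OF fl])
    show "submodule (?I n) R M" for n by (rule module_map_image[OF M M fn submodule_carrier[OF M]])
    have "?I (Suc n) \<subseteq> ?I n" for n
      using module_mapD(1)[OF f] by (auto simp: funpow_Suc_right simp del: funpow.simps)
    then show "(\<forall>n. ?I n \<subseteq> ?I (Suc n)) \<or> (\<forall>n. ?I (Suc n) \<subseteq> ?I n)" by blast
  qed
  then obtain n where stable: "\<And>m. m \<ge> n \<Longrightarrow> ?I m = ?I n" by blast
  have eq: "?I (Suc n) = ?I n" by (rule stable) simp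
  have injn: "inj_on (f ^^ k) (carrier M)" for k
  proof (induction k)
    case (Suc k)
    have "inj_on (f \<circ> (f ^^ k)) (carrier M)"
      by (rule comp_inj_on[OF Suc inj_on_subset[OF inj]]) (use module_mapD(1)[OF fn] in auto)
    then show ?case by (simp add: o_def)
  qed simp
  show "carrier M \<subseteq> f ` carrier M"
  proof
    fix y assume y: "y \<in> carrier M"
    then have "(f ^^ n) y \<in> ?I (Suc n)" unfolding eq by simp
    then obtain z where z: "z \<in> carrier M" "(f ^^ n) y = (f ^^ Suc n) z" by (rule imageE)
    then have "(f ^^ n) y = (f ^^ n) (f z)" by (simp add: funpow_Suc_right del: funpow.simps)
    then have "y = f z" using inj_onD[OF injn[of n], of y "f z"] y z(1) module_mapD(1)[OF f] by simp
    then show "y \<in> f ` carrier M" using z(1) by simp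
  qed
qed

text \<open>The modules that generate \<open>add_subgroup\<close>, named so that its elements become
  classes of formal sums with \<open>keys\<close> in this set.\<close>

definition indec_summands :: "('a, 'c) ring_scheme \<Rightarrow> ('a, 'm) module \<Rightarrow> ('a, 'a univ) module set"
  where "indec_summands R M = {N \<in> mod_cat R. indecomposable R N \<and>
    (\<exists>N' \<in> mod_cat R. mod_isomorphic R M (direct_sum N N'))}"

context finite_length_ring
begin

lemma summand_of_retract:
  assumes fg: "fg_module R M" "fg_module R N" and i: "module_map R N M i" and r: "module_map R M N r"
    and ri: "\<And>x. x \<in> carrier N \<Longrightarrow> r (i x) = x"
  shows "\<exists>N' \<in> mod_cat R. mod_isomorphic R M (direct_sum N N')"
proof -
  note L = fg[THEN fg_module_left_module]
  note k = fg_ker[OF fg(1) L(2) r]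
  note Lk = fg_module_left_module[OF k] mod_rep_left_module[OF k]
  have "mod_isomorphic R M (direct_sum N (mod_rep R (ker_mod M r N)))"
    by (rule mod_isomorphic_trans[OF L(1) left_module_direct_sum[OF Lk(1) L(2)] left_module_direct_sum[OF L(2) Lk(2)]
          split_surjection[OF L r i ri] mod_isomorphic_trans[OF left_module_direct_sum[OF Lk(1) L(2)]
            left_module_direct_sum[OF L(2) Lk(1)] left_module_direct_sum[OF L(2) Lk(2)] direct_sum_comm[OF Lk(1) L(2)]
            mod_isomorphic_direct_sum[OF L(2,2) Lk mod_isomorphic_refl[OF L(2)] mod_rep(2)[OF k]]]])
  then show ?thesis using mod_rep(1)[OF k] by blast
qed

lemma indec_summands_iso:
  assumes "left_module R M" "left_module R M'" "mod_isomorphic R M M'"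
  shows "indec_summands R M = indec_summands R M'"
proof -
  have "mod_isomorphic R M (direct_sum N N') \<longleftrightarrow> mod_isomorphic R M' (direct_sum N N')"
    if "N \<in> mod_cat R" "N' \<in> mod_cat R" for N N'
  proof -
    have D: "left_module R (direct_sum N N')"
      using that by (simp add: mod_cat_fg fg_module_left_module left_module_direct_sum)
    show ?thesis
      using mod_isomorphic_trans[OF assms(1,2) D assms(3)]
        mod_isomorphic_trans[OF assms(2,1) D mod_isomorphic_sym[OF assms]] by blast
  qed
  then show ?thesis unfolding indec_summands_def by blast
qed

text \<open>By Fitting's lemma either the kernel or the image of a positive power vanishes. This
  expresses that the endomorphism ring is local.\<close>

lemma indecomposable_endomorphism:
  assumes N: "N \<in> mod_cat R" and indec: "indecomposable R N" and f: "module_map R N N f"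
  shows "(\<exists>n. \<forall>x \<in> carrier N. (f ^^ n) x = \<zero>\<^bsub>N\<^esub>) \<or> bij_betw f (carrier N) (carrier N)"
proof -
  have fg: "fg_module R N" using N by (simp add: mod_cat_fg)
  note L = fg_module_left_module[OF fg]
  note fl = fg_finite_length[OF finite_length fg]
  obtain n where iso: "mod_isomorphic R N (direct_sum (ker_mod N (f ^^ n) N) (N\<lparr>carrier := (f ^^ n) ` carrier N\<rparr>))"
    and n: "n > 0" by (rule fitting[OF L fl f])
  note fn = module_map_funpow[OF f, of n]
  let ?K = "ker_mod N (f ^^ n) N" and ?I = "N\<lparr>carrier := (f ^^ n) ` carrier N\<rparr>"
  have "?K \<in> mod_cat R" "?I \<in> mod_cat R"
    using fg_ker[OF fg L fn] fg_submodule[OF finite_length fg module_map_image[OF L L fn submodule_carrier[OF L]]]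
    by (simp_all add: mod_cat_fg)
  with indec iso have "carrier ?K = {\<zero>\<^bsub>?K\<^esub>} \<or> carrier ?I = {\<zero>\<^bsub>?I\<^esub>}"
    unfolding indecomposable_def by blast
  then show ?thesis
  proof
    assume "carrier ?I = {\<zero>\<^bsub>?I\<^esub>}"
    then have "\<forall>x \<in> carrier N. (f ^^ n) x = \<zero>\<^bsub>N\<^esub>" by auto
    then show ?thesis by blast
  next
    assume K: "carrier ?K = {\<zero>\<^bsub>?K\<^esub>}"
    have "inj_on f (carrier N)" unfolding module_map_inj_iff[OF L L f]
    proof (intro ballI impI)
      fix x assume x: "x \<in> carrier N" "f x = \<zero>\<^bsub>N\<^esub>"
      obtain k where k: "n = Suc k" using n by (cases n) auto
      have "(f ^^ n) x = (f ^^ k) \<zero>\<^bsub>N\<^esub>" using x(2) by (simp add: k funpow_Suc_right del: funpow.simps)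
      also have "\<dots> = \<zero>\<^bsub>N\<^esub>" by (rule module_map_zero[OF L L module_map_funpow[OF f]])
      finally have "x \<in> carrier ?K" using x(1) by simp
      then show "x = \<zero>\<^bsub>N\<^esub>" unfolding K by simp
    qed
    with injective_endomorphism_surjective[OF L fl f] show ?thesis by (simp add: bij_betw_def)
  qed
qed

text \<open>The Krull-Schmidt exchange argument: the identity of \<open>N\<close> is the sum of two
  endomorphisms, one through \<open>A\<close> and one through \<open>B\<close>. If the first is
  nilpotent, the second is bijective. A bijective one makes \<open>N\<close> a retract of the factor
  that it passes through.\<close>

lemma indecomposable_exchange:
  assumes N: "N \<in> mod_cat R" "indecomposable R N" and A: "A \<in> mod_cat R" and B: "B \<in> mod_cat R"
    and M: "left_module R M" "mod_isomorphic R M (direct_sum A B)" and sum: "N \<in> indec_summands R M"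
  shows "N \<in> indec_summands R A \<or> N \<in> indec_summands R B"
proof -
  have fg: "fg_module R N" "fg_module R A" "fg_module R B" using N A B by (simp_all add: mod_cat_fg)
  note L = fg[THEN fg_module_left_module]
  note fl = fg_finite_length[OF finite_length fg(1)]
  note LAB = left_module_direct_sum[OF L(2,3)]
  interpret N: left_module R N by (rule L(1))
  interpret A: left_module R A by (rule L(2))
  interpret B: left_module R B by (rule L(3))
  have "N \<in> indec_summands R (direct_sum A B)" using sum indec_summands_iso[OF M(1) LAB M(2)] by simp
  then obtain N' where N': "N' \<in> mod_cat R" "mod_isomorphic R (direct_sum A B) (direct_sum N N')"
    by (auto simp: indec_summands_def)
  have LN': "left_module R N'" using N' by (simp add: mod_cat_fg fg_module_left_module)
  obtain j p where j: "module_map R N (direct_sum A B) j" and p: "module_map R (direct_sum A B) N p"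
    and pj: "\<And>x. x \<in> carrier N \<Longrightarrow> p (j x) = x" by (rule retract_of_summand[OF LAB L(1) LN' N'(2)]) (rule that)
  let ?e = "\<lambda>x. p (fst (j x), \<zero>\<^bsub>B\<^esub>)" and ?e' = "\<lambda>x. p (\<zero>\<^bsub>A\<^esub>, snd (j x))"
  note jA = module_map_comp[OF j module_map_fst] and jB = module_map_comp[OF j module_map_snd]
  note pA = module_map_comp[OF module_map_Pair_left[OF L(3)] p] and pB = module_map_comp[OF module_map_Pair_right[OF L(2)] p]
  note e = module_map_comp[OF jA pA] and e' = module_map_comp[OF jB pB]
  have sum: "?e x \<oplus>\<^bsub>N\<^esub> ?e' x = x" if "x \<in> carrier N" for x
    using module_mapD(2)[OF p, of "(fst (j x), \<zero>\<^bsub>B\<^esub>)" "(\<zero>\<^bsub>A\<^esub>, snd (j x))"]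
      module_mapD(1)[OF jA that] module_mapD(1)[OF jB that] pj[OF that] by simp
  have retract: "\<exists>N' \<in> mod_cat R. mod_isomorphic R C (direct_sum N N')"
    if "fg_module R C" "module_map R N C i" "module_map R C N r"
      "bij_betw (\<lambda>x. r (i x)) (carrier N) (carrier N)" for C i r
    by (rule summand_of_retract[OF that(1) fg(1) that(2) module_map_comp[OF that(3)
          module_map_inv_into[OF L(1) module_map_comp[OF that(2,3)] that(4)]]])
      (rule bij_betw_inv_into_left[OF that(4)])
  show ?thesis
  proof (cases "bij_betw ?e (carrier N) (carrier N)")
    case True
    from retract[OF fg(2) jA pA True] show ?thesis using N by (simp add: indec_summands_def)
  next
    case False
    with indecomposable_endomorphism[OF N e] obtain n where
      n: "\<And>x. x \<in> carrier N \<Longrightarrow> (?e ^^ n) x = \<zero>\<^bsub>N\<^esub>" by blast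
    have "inj_on ?e' (carrier N)" unfolding module_map_inj_iff[OF L(1,1) e']
    proof (intro ballI impI)
      fix x assume x: "x \<in> carrier N" "?e' x = \<zero>\<^bsub>N\<^esub>"
      \<comment> \<open>An element killed by \<open>?e'\<close> is fixed by \<open>?e\<close>, hence
        zero because \<open>?e\<close> is nilpotent.\<close>
      then have "?e x = x" using sum[OF x(1)] module_mapD(1)[OF e x(1)] by simp
      then have "(?e ^^ k) x = x" for k by (induction k) simp_all
      then show "x = \<zero>\<^bsub>N\<^esub>" using n[OF x(1)] by simp
    qed
    with injective_endomorphism_surjective[OF L(1) fl e']
    have "bij_betw ?e' (carrier N) (carrier N)" by (simp add: bij_betw_def)
    from retract[OF fg(3) jB pB this] show ?thesis using N by (simp add: indec_summands_def)
  qed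
qed

text \<open>Induction along proper inclusion of submodules: a decomposable submodule has two factors
  isomorphic to proper submodules of it, and by exchange each of its indecomposable summands is a
  summand of one of them.\<close>

lemma finite_indec_summands_mod_cat:
  assumes M: "M \<in> mod_cat R"
  shows "submodule K R M \<Longrightarrow> \<exists>S. finite S \<and> S \<subseteq> mod_cat R \<and>
    (\<forall>N \<in> indec_summands R (M\<lparr>carrier := K\<rparr>). \<exists>N' \<in> S. mod_isomorphic R N N')"
proof -
  have fgM: "fg_module R M" using M by (simp add: mod_cat_fg)
  note LM = fg_module_left_module[OF fgM]
  have wf: "wf (submodule_order False R M)"
    using fg_finite_length[OF finite_length fgM] by (simp add: finite_length_def)
  show "submodule K R M \<Longrightarrow> ?thesis"
  proof (induction K rule: wf_induct_rule[OF wf])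
    case (1 K)
    note IH = 1(1) and K = 1(2)
    let ?L = "M\<lparr>carrier := K\<rparr>"
    have L: "?L \<in> mod_cat R" using fg_submodule[OF finite_length fgM K] by (simp add: mod_cat_fg)
    have fgL: "fg_module R ?L" using L by (simp add: mod_cat_fg)
    note LL = fg_module_left_module[OF fgL]
    consider (zero) "carrier ?L = {\<zero>\<^bsub>?L\<^esub>}" | (indec) "indecomposable R ?L"
      | (dec) A B where "A \<in> mod_cat R" "B \<in> mod_cat R" "mod_isomorphic R ?L (direct_sum A B)"
        "carrier A \<noteq> {\<zero>\<^bsub>A\<^esub>}" "carrier B \<noteq> {\<zero>\<^bsub>B\<^esub>}"
      unfolding indecomposable_def by blast
    then show ?case
    proof cases
      case zero
      have "False" if N: "N \<in> indec_summands R ?L" for N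
      proof -
        obtain N' where N': "N \<in> mod_cat R" "indecomposable R N" "N' \<in> mod_cat R" "mod_isomorphic R ?L (direct_sum N N')"
          using N by (auto simp: indec_summands_def)
        then have "left_module R (direct_sum N N')"
          by (simp add: mod_cat_fg fg_module_left_module left_module_direct_sum)
        from zero_iso[OF LL this N'(4) zero] have "fst ` (carrier N \<times> carrier N') = fst ` {(\<zero>\<^bsub>N\<^esub>, \<zero>\<^bsub>N'\<^esub>)}"
          "carrier N' \<noteq> {}" by auto
        then have "carrier N = {\<zero>\<^bsub>N\<^esub>}" by (simp add: fst_image_times)
        then show False using N'(2) by (simp add: indecomposable_def)
      qed
      then show ?thesis by (intro exI[of _ "{}"]) auto
    next
      case indec
      have "mod_isomorphic R N ?L" if N: "N \<in> indec_summands R ?L" for N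
      proof -
        obtain N' where N': "N \<in> mod_cat R" "indecomposable R N" "N' \<in> mod_cat R" "mod_isomorphic R ?L (direct_sum N N')"
          using N by (auto simp: indec_summands_def)
        then have LN: "left_module R N" "left_module R N'"
          by (simp_all add: mod_cat_fg fg_module_left_module)
        have "carrier N' = {\<zero>\<^bsub>N'\<^esub>}" using indec N' unfolding indecomposable_def by blast
        from direct_sum_zero_right[OF LN this] show ?thesis
          by (rule mod_isomorphic_sym[OF LL LN(1) mod_isomorphic_trans[OF LL left_module_direct_sum[OF LN] LN(1) N'(4)]])
      qed
      then show ?thesis using L by (intro exI[of _ "{?L}"]) auto
    next
      case dec
      have LA: "left_module R A" "left_module R B" using dec by (simp_all add: mod_cat_fg fg_module_left_module)
      interpret A: left_module R A by (rule LA(1))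
      interpret B: left_module R B by (rule LA(2))
      note LAB = left_module_direct_sum[OF LA]
      obtain f where f: "module_map R (direct_sum A B) ?L f" "bij_betw f (carrier (direct_sum A B)) (carrier ?L)"
        using mod_isomorphic_sym[OF LL LAB dec(3)] LL LAB by (auto simp: mod_isomorphic_iff simp del: direct_sum_sel)
      have inj: "inj_on f (carrier A \<times> carrier B)" using f(2) by (simp add: bij_betw_def)
      \<comment> \<open>Transports a factor \<open>C\<close> to its image under \<open>f\<close>, a
        submodule of \<open>M\<close> that is proper in \<open>K\<close> because it misses
        \<open>f z\<close>.\<close>
      have part: "\<exists>S. finite S \<and> S \<subseteq> mod_cat R \<and> (\<forall>N \<in> indec_summands R C. \<exists>N' \<in> S. mod_isomorphic R N N')"
        if C: "left_module R C" and i: "module_map R C (direct_sum A B) i" and inji: "inj_on i (carrier C)"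
          and z: "z \<in> carrier (direct_sum A B)" "z \<notin> i ` carrier C" for C :: "('a, 'a univ) module" and i z
      proof -
        let ?i = "\<lambda>x. f (i x)"
        have i': "module_map R C ?L ?i" by (rule module_map_comp[OF i f(1)])
        let ?J = "?i ` carrier C"
        have J: "submodule ?J R ?L" by (rule module_map_image[OF C LL i' submodule_carrier[OF C]])
        have J': "submodule ?J R M" "?J \<subseteq> K" using J submodule_trans[OF LM K] by auto
        have "f z \<notin> ?J" using z inj module_mapD(1)[OF i] by (auto dest: inj_onD)
        moreover have "f z \<in> K" using module_mapD(1)[OF f(1) z(1)] by simp
        ultimately have "(?J, K) \<in> submodule_order False R M" using J' K by (auto simp: submodule_order_def)
        from IH[OF this J'(1)] obtain S where S: "finite S" "S \<subseteq> mod_cat R"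
          "\<forall>N \<in> indec_summands R (M\<lparr>carrier := ?J\<rparr>). \<exists>N' \<in> S. mod_isomorphic R N N'" by blast
        have LJ: "left_module R (M\<lparr>carrier := ?J\<rparr>)" by (rule left_module_submodule[OF LM J'(1)])
        have "inj_on ?i (carrier C)"
          using inj_on_subset[OF inj, of "i ` carrier C"] comp_inj_on[OF inji, of f] module_mapD(1)[OF i]
          by (auto simp: o_def)
        then have "bij_betw ?i (carrier C) (carrier (M\<lparr>carrier := ?J\<rparr>))" by (simp add: bij_betw_def)
        moreover have "module_map R C (M\<lparr>carrier := ?J\<rparr>) ?i" using i' by (auto simp: module_map_def)
        ultimately have "mod_isomorphic R C (M\<lparr>carrier := ?J\<rparr>)" using C LJ by (auto simp: mod_isomorphic_iff)
        from indec_summands_iso[OF C LJ this] show ?thesis using S by (intro exI[of _ S]) simp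
      qed
      obtain b where b: "b \<in> carrier B" "b \<noteq> \<zero>\<^bsub>B\<^esub>" using dec(5) B.M.zero_closed by blast
      obtain a where a: "a \<in> carrier A" "a \<noteq> \<zero>\<^bsub>A\<^esub>" using dec(4) A.M.zero_closed by blast
      obtain S where S: "finite S" "S \<subseteq> mod_cat R" "\<forall>N \<in> indec_summands R A. \<exists>N' \<in> S. mod_isomorphic R N N'"
        using part[OF LA(1) module_map_Pair_left[OF LA(2)], of "(\<zero>\<^bsub>A\<^esub>, b)"] b by (auto simp: inj_on_def)
      obtain T where T: "finite T" "T \<subseteq> mod_cat R" "\<forall>N \<in> indec_summands R B. \<exists>N' \<in> T. mod_isomorphic R N N'"
        using part[OF LA(2) module_map_Pair_right[OF LA(1)], of "(a, \<zero>\<^bsub>B\<^esub>)"] a by (auto simp: inj_on_def)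
      have "\<exists>N' \<in> S \<union> T. mod_isomorphic R N N'" if N: "N \<in> indec_summands R ?L" for N
        using indecomposable_exchange[OF _ _ dec(1,2) LL dec(3) N] N S(3) T(3) by (auto simp: indec_summands_def)
      then show ?thesis using S T by (intro exI[of _ "S \<union> T"]) simp
    qed
  qed
qed

lemma finite_indec_summands:
  assumes fg: "fg_module R M"
  obtains S where "finite S" "S \<subseteq> mod_cat R" "\<And>N. N \<in> indec_summands R M \<Longrightarrow> \<exists>N' \<in> S. mod_isomorphic R N N'"
proof -
  note L = fg_module_left_module[OF fg] mod_rep_left_module[OF fg]
  obtain S where "finite S" "S \<subseteq> mod_cat R"
    "\<forall>N \<in> indec_summands R (mod_rep R M\<lparr>carrier := carrier (mod_rep R M)\<rparr>). \<exists>N' \<in> S. mod_isomorphic R N N'"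
    using finite_indec_summands_mod_cat[OF mod_rep(1)[OF fg] submodule_carrier[OF L(2)]] by blast
  then show thesis using indec_summands_iso[OF L mod_rep(2)[OF fg]] by (intro that[of S]) simp_all
qed

end

section \<open>The Igusa-Todorov function\<close>

lemma int_subgroup_chain:
  fixes I :: "nat \<Rightarrow> int set"
  assumes zero: "\<And>n. 0 \<in> I n" and diff: "\<And>n x y. x \<in> I n \<Longrightarrow> y \<in> I n \<Longrightarrow> x - y \<in> I n"
    and mono: "\<And>n. I n \<subseteq> I (Suc n)"
  shows "\<exists>n. \<forall>m\<ge>n. I m = I n"
proof -
  have mono': "I n \<subseteq> I m" if "n \<le> m" for n m using lift_Suc_mono_le[of I, OF mono that] .
  have neg: "- x \<in> I n" if "x \<in> I n" for x n using diff[OF zero that] by simp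
  have add: "x + y \<in> I n" if "x \<in> I n" "y \<in> I n" for x y n using diff[OF that(1) neg[OF that(2)]] by simp
  have nat_mult: "int k * x \<in> I n" if "x \<in> I n" for k x n
    by (induction k) (simp_all add: zero add that algebra_simps)
  have mult: "k * x \<in> I n" if "x \<in> I n" for k x n
    using nat_mult[OF that, of "nat k"] neg[OF nat_mult[OF that, of "nat (- k)"]] by (cases "k \<ge> 0") simp_all
  let ?P = "\<lambda>g::nat. g > 0 \<and> (\<exists>n. int g \<in> I n)"
  show ?thesis
  proof (cases "\<exists>g. ?P g")
    case False
    have "x = 0" if x: "x \<in> I n" for x n
    proof (rule ccontr)
      assume "x \<noteq> 0"
      then have "?P (nat \<bar>x\<bar>)" using x neg[OF x] by (cases "x > 0") auto
      then show False using False by blast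
    qed
    then have "I n = {0}" for n using zero by blast
    then show ?thesis by simp
  next
    case True
    \<comment> \<open>The least positive integer in any member of the chain. From a stage that
      contains it on, division with remainder shows that it divides every element.\<close>
    define g where "g = (LEAST g. ?P g)"
    have g: "?P g" unfolding g_def by (rule LeastI_ex[OF True])
    have min: "g \<le> h" if "?P h" for h unfolding g_def by (rule Least_le[where P = "?P", OF that])
    obtain n where n: "int g \<in> I n" using g by blast
    have "x \<in> I n" if m: "m \<ge> n" and x: "x \<in> I m" for m x
    proof -
      have "x mod int g = x - (x div int g) * int g" by (simp add: minus_div_mult_eq_mod)
      then have r: "x mod int g \<in> I m" using diff[OF x mult[of "int g" m "x div int g"]] n mono'[OF m] by auto
      have "x mod int g = 0"
      proof (rule ccontr)
        assume "x mod int g \<noteq> 0"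
        moreover have "0 \<le> x mod int g" "x mod int g < int g" using g by simp_all
        ultimately have "?P (nat (x mod int g))" using r by auto
        from min[OF this] show False using \<open>x mod int g < int g\<close> \<open>0 \<le> x mod int g\<close> by linarith
      qed
      then have "int g dvd x" by (simp add: mod_eq_0_iff_dvd)
      then have "x = (x div int g) * int g" by simp
      then show ?thesis using mult[OF n, of "x div int g"] by simp
    qed
    then show ?thesis using mono' by blast
  qed
qed

text \<open>Induction on the finite set of generators: a subgroup in the chain is controlled by its
  values at one coordinate and by its elements that vanish there.\<close>

lemma frag_subgroup_chain:
  fixes H :: "nat \<Rightarrow> ('b \<Rightarrow>\<^sub>0 int) set"
  assumes "finite S" and "\<And>n x. x \<in> H n \<Longrightarrow> Poly_Mapping.keys x \<subseteq> S"
    and "\<And>n. 0 \<in> H n" and "\<And>n x y. x \<in> H n \<Longrightarrow> y \<in> H n \<Longrightarrow> x - y \<in> H n"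
    and "\<And>n. H n \<subseteq> H (Suc n)"
  shows "\<exists>n. \<forall>m\<ge>n. H m = H n"
  using assms
proof (induction S arbitrary: H rule: finite_induct)
  case empty
  have "x = 0" if "x \<in> H n" for n x using empty(1)[OF that] by simp
  then have "H n = {0}" for n using empty(2)[of n] by blast
  then show ?case by simp
next
  case (insert a S)
  let ?K = "\<lambda>n. {x \<in> H n. Poly_Mapping.lookup x a = 0}" and ?I = "\<lambda>n. (\<lambda>x. Poly_Mapping.lookup x a) ` H n"
  have keys: "Poly_Mapping.keys x \<subseteq> S" if "x \<in> ?K n" for n x
    using insert.prems(1)[of x n] that by (auto simp: in_keys_iff)
  have "\<exists>n. \<forall>m\<ge>n. ?K m = ?K n"
  proof (rule insert.IH)
    show "x \<in> ?K n \<Longrightarrow> Poly_Mapping.keys x \<subseteq> S" for n x by (rule keys)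
    show "?K n \<subseteq> ?K (Suc n)" for n using insert.prems(4)[of n] by blast
  qed (use insert.prems(2,3) in \<open>auto simp: lookup_minus\<close>)
  then obtain k where k: "\<And>m. m \<ge> k \<Longrightarrow> ?K m = ?K k" by blast
  have "\<exists>n. \<forall>m\<ge>n. ?I m = ?I n"
  proof (rule int_subgroup_chain)
    show "0 \<in> ?I n" for n using insert.prems(2)[of n] by (auto intro!: image_eqI[of _ _ 0])
    show "x - y \<in> ?I n" if "x \<in> ?I n" "y \<in> ?I n" for n x y
      using that insert.prems(3) by (auto simp: lookup_minus[symmetric])
    show "?I n \<subseteq> ?I (Suc n)" for n using insert.prems(4) by blast
  qed
  then obtain l where l: "\<And>m. m \<ge> l \<Longrightarrow> ?I m = ?I l" by blast
  have mono: "H n \<subseteq> H m" if "n \<le> m" for n m using lift_Suc_mono_le[of H, OF insert.prems(4) that] .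
  have "H m \<subseteq> H (k + l)" if m: "m \<ge> k + l" for m
  proof
    fix x assume x: "x \<in> H m"
    have "Poly_Mapping.lookup x a \<in> ?I m" using x by blast
    moreover have "?I m = ?I (k + l)" using l[of m] l[of "k + l"] m by simp
    ultimately have "Poly_Mapping.lookup x a \<in> ?I (k + l)" by simp
    then obtain y where y: "y \<in> H (k + l)" "Poly_Mapping.lookup x a = Poly_Mapping.lookup y a" by blast
    \<comment> \<open>Equal values at \<open>a\<close> bring the difference into the part that has
      already stabilised.\<close>
    have "x - y \<in> ?K m" using insert.prems(3)[of x m y] x y mono[OF m] by (auto simp: lookup_minus)
    moreover have "?K m = ?K (k + l)" using k[of m] k[of "k + l"] m by simp
    ultimately have "x - y \<in> H (k + l)" by simp
    then have "0 - (x - y) \<in> H (k + l)" using insert.prems(2,3) by blast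
    then have "y - (0 - (x - y)) \<in> H (k + l)" using insert.prems(3) y by blast
    then show "x \<in> H (k + l)" by simp
  qed
  then show ?case using mono by blast
qed

text \<open>The isomorphism demanded by \<open>IT_phi\<close> at stage \<open>s\<close>, reduced to
  a kernel condition on formal sums; see \<open>K0_syzygy_iso_iff\<close>.\<close>

definition syzygy_injective :: "('a, 'c) ring_scheme \<Rightarrow> ('a, 'm) module \<Rightarrow> nat \<Rightarrow> bool"
  where "syzygy_injective R M s \<longleftrightarrow> (\<forall>z. Poly_Mapping.keys z \<subseteq> indec_summands R M \<longrightarrow>
    (syzygy_map R ^^ Suc s) z \<in> K0_relations R \<longrightarrow> (syzygy_map R ^^ s) z \<in> K0_relations R)"

section \<open>Cosets of formal sums and the definition of \<open>\<phi>\<close>\<close>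

lemma K0_of_alt: "K0_of R x = {h + x |h. h \<in> K0_relations R}"
  by (auto simp: K0_of_def r_coset_def)

lemma K0_of_eq_iff: "K0_of R x = K0_of R y \<longleftrightarrow> K0_eq R x y"
proof
  assume *: "K0_of R x = K0_of R y"
  have "0 + x \<in> K0_of R x" unfolding K0_of_alt using K0_relations_zero by blast
  then obtain h where h: "h \<in> K0_relations R" "0 + x = h + y" unfolding * unfolding K0_of_alt by blast
  then show "K0_eq R x y" by (simp add: K0_eq_def)
next
  have sub: "K0_of R x \<subseteq> K0_of R y" if "K0_eq R x y" for x y
  proof
    fix z assume "z \<in> K0_of R x"
    then obtain h where h: "h \<in> K0_relations R" "z = h + x" by (auto simp: K0_of_alt)
    then have "z = (h + (x - y)) + y" "h + (x - y) \<in> K0_relations R"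
      using that K0_relations_add by (auto simp: K0_eq_def)
    then show "z \<in> K0_of R y" unfolding K0_of_alt by blast
  qed
  assume "K0_eq R x y"
  then show "K0_of R x = K0_of R y" using sub[of x y] sub[of y x] K0_eq_sym by blast
qed

lemma K0_mult: "K0_of R x \<otimes>\<^bsub>K0 R\<^esub> K0_of R y = K0_of R (x + y)"
proof -
  have mult: "K0_of R x \<otimes>\<^bsub>K0 R\<^esub> K0_of R y = {a + b |a b. a \<in> K0_of R x \<and> b \<in> K0_of R y}"
    by (auto simp: K0_def FactGroup_def set_mult_def)
  have "{a + b |a b. a \<in> K0_of R x \<and> b \<in> K0_of R y} = K0_of R (x + y)"
  proof (intro subset_antisym subsetI)
    fix u assume "u \<in> {a + b |a b. a \<in> K0_of R x \<and> b \<in> K0_of R y}"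
    then obtain h h' where h: "h \<in> K0_relations R" "h' \<in> K0_relations R" "u = (h + x) + (h' + y)"
      by (auto simp: K0_of_alt)
    then have "u = (h + h') + (x + y)" by (simp add: algebra_simps)
    then show "u \<in> K0_of R (x + y)" using K0_relations_add[OF h(1,2)] unfolding K0_of_alt by blast
  next
    fix u assume "u \<in> K0_of R (x + y)"
    then obtain h where h: "h \<in> K0_relations R" "u = h + (x + y)" by (auto simp: K0_of_alt)
    then have "u = (h + x) + (0 + y)" by (simp add: algebra_simps)
    moreover have "h + x \<in> K0_of R x" "0 + y \<in> K0_of R y"
      using h(1) K0_relations_zero[of R] unfolding K0_of_alt by blast+
    ultimately show "u \<in> {a + b |a b. a \<in> K0_of R x \<and> b \<in> K0_of R y}" by blast
  qed
  with mult show ?thesis by simp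
qed

lemma K0_relations_subgroup: "subgroup (K0_relations R) (free_Abelian_group (mod_cat R))"
proof (rule group.subgroupI)
  fix a assume a: "a \<in> K0_relations R"
  then show "inv\<^bsub>free_Abelian_group (mod_cat R)\<^esub> a \<in> K0_relations R"
    by (simp add: K0_relations_keys K0_relations_minus)
qed (use K0_relations_zero in \<open>auto simp: K0_relations_add dest: K0_relations_keys\<close>)

lemma K0_group: "group (K0 R)"
proof -
  have "K0_relations R \<lhd> free_Abelian_group (mod_cat R)"
    by (rule comm_group.subgroup_imp_normal[OF abelian_free_Abelian_group K0_relations_subgroup])
  then show ?thesis unfolding K0_def by (rule normal.factorgroup_is_group)
qed

lemma K0_of_closed: "Poly_Mapping.keys x \<subseteq> mod_cat R \<Longrightarrow> K0_of R x \<in> carrier (K0 R)"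
  by (auto simp: K0_def FactGroup_def RCOSETS_def K0_of_def)

lemma K0_one: "\<one>\<^bsub>K0 R\<^esub> = K0_of R 0"
  by (simp add: K0_def FactGroup_def K0_of_alt)

lemma K0_inv:
  assumes "Poly_Mapping.keys x \<subseteq> mod_cat R"
  shows "inv\<^bsub>K0 R\<^esub> (K0_of R x) = K0_of R (- x)"
  by (rule group.inv_equality[OF K0_group]) (use assms in \<open>simp_all add: K0_of_closed K0_mult K0_one\<close>)

text \<open>Sums and inverses of generators are classes of formal sums on the same generators, so
  the generated subgroup is the image of a free abelian group.\<close>

lemma add_subgroup_eq: "add_subgroup R M = K0_of R ` {z. Poly_Mapping.keys z \<subseteq> indec_summands R M}"
proof -
  let ?S = "{K0_of R (frag_of N) |N. N \<in> indec_summands R M}"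
  have sub: "indec_summands R M \<subseteq> mod_cat R" by (auto simp: indec_summands_def)
  have S: "?S \<subseteq> carrier (K0 R)" using sub by (auto intro!: K0_of_closed)
  have eq: "add_subgroup R M = generate (K0 R) ?S"
    by (simp add: add_subgroup_def indec_summands_def conj_assoc)
  show ?thesis unfolding eq
  proof (intro subset_antisym subsetI)
    fix C assume "C \<in> generate (K0 R) ?S"
    then show "C \<in> K0_of R ` {z. Poly_Mapping.keys z \<subseteq> indec_summands R M}"
    proof (induction rule: generate.induct)
      case one
      show ?case unfolding K0_one by (intro image_eqI[OF refl]) simp
    next
      case (incl h)
      then show ?case by (auto intro!: image_eqI[OF refl])
    next
      case (inv h)
      then obtain N where "N \<in> indec_summands R M" "h = K0_of R (frag_of N)" by blast
      then show ?case using sub by (auto simp: K0_inv intro!: image_eqI[OF refl])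
    next
      case (eng h h')
      then obtain z z' where "Poly_Mapping.keys z \<subseteq> indec_summands R M" "h = K0_of R z"
        "Poly_Mapping.keys z' \<subseteq> indec_summands R M" "h' = K0_of R z'" by blast
      then show ?case using keys_add[of z z'] unfolding K0_mult[symmetric]
        by (auto simp: K0_mult intro!: image_eqI[OF refl])
    qed
  next
    fix C assume "C \<in> K0_of R ` {z. Poly_Mapping.keys z \<subseteq> indec_summands R M}"
    then obtain z where z: "Poly_Mapping.keys z \<subseteq> indec_summands R M" "C = K0_of R z" by blast
    have "Poly_Mapping.keys z \<subseteq> indec_summands R M \<and> K0_of R z \<in> generate (K0 R) ?S"
      using z(1)
    proof (induction z rule: frag_induction)
      case zero
      show ?case using generate.one[of "K0 R" ?S] by (simp add: K0_one)
    next
      case (one N)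
      then show ?case by (auto intro!: generate.incl)
    next
      case (diff a b)
      have "inv\<^bsub>K0 R\<^esub> (K0_of R b) \<in> generate (K0 R) ?S"
        using group.generate_m_inv_closed[OF K0_group S] diff by blast
      moreover have "inv\<^bsub>K0 R\<^esub> (K0_of R b) = K0_of R (- b)"
        by (rule K0_inv) (use diff sub in blast)
      ultimately have "K0_of R (- b) \<in> generate (K0 R) ?S" by simp
      from generate.eng[OF conjunct2[OF diff(1)] this] show ?case
        using diff keys_diff[of a b] unfolding K0_mult by auto
    qed
    then show "C \<in> generate (K0 R) ?S" using z by blast
  qed
qed

context finite_length_ring
begin

text \<open>All elements of a coset have the same image because \<open>syzygy_map\<close> preserves
  the relations, so \<open>the_elem\<close> is applied to a singleton.\<close>

lemma K0_syzygy_of: "K0_syzygy R (K0_of R x) = K0_of R (syzygy_map R x)"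
proof -
  have eq: "K0_of R (syzygy_map R y) = K0_of R (syzygy_map R x)" if "y \<in> K0_of R x" for y
  proof -
    have "K0_eq R y x" using that by (auto simp: K0_of_alt K0_eq_def)
    then show ?thesis by (simp add: K0_of_eq_iff syzygy_map_eq)
  qed
  have "x \<in> K0_of R x" using K0_relations_zero[of R] by (force simp: K0_of_alt)
  have "(\<lambda>y. K0_of R (syzygy_map R y)) ` K0_of R x = (\<lambda>_. K0_of R (syzygy_map R x)) ` K0_of R x"
    by (rule image_cong[OF refl eq])
  also have "\<dots> = {K0_of R (syzygy_map R x)}" by (rule image_constant) fact
  finally have "(\<lambda>y. K0_of R (syzygy_map R y)) ` K0_of R x = {K0_of R (syzygy_map R x)}" .
  then show ?thesis by (simp add: K0_syzygy_def syzygy_map_def)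
qed

lemma K0_syzygy_pow_of: "(K0_syzygy R ^^ s) (K0_of R x) = K0_of R ((syzygy_map R ^^ s) x)"
  by (induction s) (simp_all add: K0_syzygy_of)

text \<open>The map is additive, and it is onto because the target is defined as the image. What
  remains is injectivity, which by linearity concerns the elements mapped to zero.\<close>

lemma K0_syzygy_iso_iff:
  "K0_syzygy R \<in> iso
      ((K0 R)\<lparr>carrier := (K0_syzygy R ^^ s) ` add_subgroup R M\<rparr>)
      ((K0 R)\<lparr>carrier := (K0_syzygy R ^^ Suc s) ` add_subgroup R M\<rparr>) \<longleftrightarrow> syzygy_injective R M s"
proof -
  let ?Z = "{z. Poly_Mapping.keys z \<subseteq> indec_summands R M}"
  let ?f = "\<lambda>s z. K0_of R ((syzygy_map R ^^ s) z)"
  have G: "(K0_syzygy R ^^ s) ` add_subgroup R M = ?f s ` ?Z" for s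
    unfolding add_subgroup_eq image_image K0_syzygy_pow_of ..
  have step: "K0_syzygy R (?f s z) = ?f (Suc s) z" for z by (simp add: K0_syzygy_of)
  have surj: "K0_syzygy R ` ?f s ` ?Z = ?f (Suc s) ` ?Z" unfolding image_image step ..
  have zd: "x - y \<in> ?Z" if "x \<in> ?Z" "y \<in> ?Z" for x y using that keys_diff[of x y] by auto
  have eq: "?f k x = ?f k y \<longleftrightarrow> (syzygy_map R ^^ k) (x - y) \<in> K0_relations R" for k x y
    by (simp add: K0_of_eq_iff K0_eq_def syzygy_map_pow_diff)
  have "inj_on (K0_syzygy R) (?f s ` ?Z) \<longleftrightarrow> syzygy_injective R M s"
  proof
    assume inj: "inj_on (K0_syzygy R) (?f s ` ?Z)"
    show "syzygy_injective R M s" unfolding syzygy_injective_def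
    proof (intro allI impI)
      fix z assume z: "Poly_Mapping.keys z \<subseteq> indec_summands R M" "(syzygy_map R ^^ Suc s) z \<in> K0_relations R"
      then have "K0_syzygy R (?f s z) = K0_syzygy R (?f s 0)" unfolding step eq by simp
      then have "?f s z = ?f s 0" by (rule inj_onD[OF inj]) (use z in auto)
      then show "(syzygy_map R ^^ s) z \<in> K0_relations R" unfolding eq by simp
    qed
  next
    assume si: "syzygy_injective R M s"
    show "inj_on (K0_syzygy R) (?f s ` ?Z)"
    proof (rule inj_onI)
      fix u v assume "u \<in> ?f s ` ?Z" "v \<in> ?f s ` ?Z" and e: "K0_syzygy R u = K0_syzygy R v"
      then obtain x y where xy: "x \<in> ?Z" "u = ?f s x" "y \<in> ?Z" "v = ?f s y" by blast
      from e have "?f (Suc s) x = ?f (Suc s) y" unfolding xy step .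
      then show "u = v" using si zd[OF xy(1,3)] unfolding xy(2,4) eq syzygy_injective_def by blast
    qed
  qed
  moreover have "K0_syzygy R \<in> hom ((K0 R)\<lparr>carrier := ?f s ` ?Z\<rparr>) ((K0 R)\<lparr>carrier := ?f (Suc s) ` ?Z\<rparr>)"
  proof (rule homI)
    fix u assume "u \<in> carrier ((K0 R)\<lparr>carrier := ?f s ` ?Z\<rparr>)"
    then have "K0_syzygy R u \<in> K0_syzygy R ` ?f s ` ?Z" by simp
    then show "K0_syzygy R u \<in> carrier ((K0 R)\<lparr>carrier := ?f (Suc s) ` ?Z\<rparr>)" unfolding surj by simp
  next
    fix u v assume "u \<in> carrier ((K0 R)\<lparr>carrier := ?f s ` ?Z\<rparr>)" "v \<in> carrier ((K0 R)\<lparr>carrier := ?f s ` ?Z\<rparr>)"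
    then obtain x y where xy: "u = K0_of R x" "v = K0_of R y" by auto
    have "syzygy_map R (x + y) = syzygy_map R x + syzygy_map R y" by (simp add: syzygy_map_def frag_extend_add)
    then show "K0_syzygy R (u \<otimes>\<^bsub>(K0 R)\<lparr>carrier := ?f s ` ?Z\<rparr>\<^esub> v) =
        K0_syzygy R u \<otimes>\<^bsub>(K0 R)\<lparr>carrier := ?f (Suc s) ` ?Z\<rparr>\<^esub> K0_syzygy R v"
      by (simp add: xy K0_mult K0_syzygy_of)
  qed
  ultimately show ?thesis unfolding G iso_def using surj by (simp add: bij_betw_def del: funpow.simps)
qed

lemma IT_phi_alt: "IT_phi R M = (LEAST n. \<forall>s\<ge>n. syzygy_injective R M s)"
  unfolding IT_phi_def K0_syzygy_iso_iff ..

lemma IT_phi_le: "(\<And>s. s \<ge> n \<Longrightarrow> syzygy_injective R M s) \<Longrightarrow> IT_phi R M \<le> n"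
  unfolding IT_phi_alt by (rule Least_le) blast

lemma syzygy_injective_eventually:
  assumes "fg_module R M"
  shows "\<exists>n. \<forall>s\<ge>n. syzygy_injective R M s"
proof -
  obtain S where S: "finite S" "S \<subseteq> mod_cat R"
    and rep: "\<And>N. N \<in> indec_summands R M \<Longrightarrow> \<exists>N' \<in> S. mod_isomorphic R N N'"
    by (rule finite_indec_summands[OF assms]) (rule that)
  from rep obtain c where c: "\<And>N. N \<in> indec_summands R M \<Longrightarrow> c N \<in> S \<and> mod_isomorphic R N (c N)" by metis
  let ?H = "\<lambda>s. {z. Poly_Mapping.keys z \<subseteq> S \<and> (syzygy_map R ^^ s) z \<in> K0_relations R}"
  have "\<exists>n. \<forall>m\<ge>n. ?H m = ?H n"
  proof (rule frag_subgroup_chain[OF S(1)])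
    have z: "(syzygy_map R ^^ n) 0 = 0" for n by (induction n) (simp_all add: syzygy_map_def)
    show "0 \<in> ?H n" for n by (simp add: z K0_relations_zero)
    show "x - y \<in> ?H n" if "x \<in> ?H n" "y \<in> ?H n" for n x y
      using that keys_diff[of x y] by (auto simp: syzygy_map_pow_diff K0_relations_diff)
    show "?H n \<subseteq> ?H (Suc n)" for n by (auto simp: syzygy_map_relations)
  qed auto
  then obtain n where n: "\<And>m. m \<ge> n \<Longrightarrow> ?H m = ?H n" by blast
  have "syzygy_injective R M s" if s: "s \<ge> n" for s
    unfolding syzygy_injective_def
  proof (intro allI impI)
    fix z assume z: "Poly_Mapping.keys z \<subseteq> indec_summands R M" "(syzygy_map R ^^ Suc s) z \<in> K0_relations R"
    \<comment> \<open>Each summand is replaced by its isomorphic copy in the finite set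
      \<open>S\<close>. The class does not change, and the stabilised kernels \<open>?H\<close>
      become applicable.\<close>
    let ?y = "frag_extend (\<lambda>N. frag_of (c N)) z"
    have "K0_eq R (frag_extend frag_of z) ?y"
    proof (rule frag_extend_K0_eq[OF z(1)])
      fix N assume N: "N \<in> indec_summands R M"
      show "K0_eq R (frag_of N) (frag_of (c N))"
        by (rule K0_eq_iso) (use c[OF N] S(2) N in \<open>auto simp: indec_summands_def\<close>)
    qed
    then have zy: "K0_eq R z ?y" by (simp add: frag_expansion[symmetric])
    have "Poly_Mapping.keys ?y \<subseteq> S"
      using keys_frag_extend[of "\<lambda>N. frag_of (c N)" z] c z(1) by auto
    moreover have "(syzygy_map R ^^ Suc s) ?y \<in> K0_relations R"
      using K0_eq_relations[OF syzygy_map_pow_eq[OF zy]] z(2) by blast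
    ultimately have "?y \<in> ?H (Suc s)" by blast
    moreover have "?H (Suc s) = ?H s" using n[OF s] n[of "Suc s"] s by (metis le_SucI)
    ultimately have "(syzygy_map R ^^ s) ?y \<in> K0_relations R" by blast
    then show "(syzygy_map R ^^ s) z \<in> K0_relations R"
      using K0_eq_relations[OF syzygy_map_pow_eq[OF zy]] by blast
  qed
  then show ?thesis by blast
qed

text \<open>The value of \<open>LEAST\<close> has its defining property because a suitable stage
  exists.\<close>

lemma syzygy_injective_IT_phi:
  assumes "fg_module R M" "s \<ge> IT_phi R M"
  shows "syzygy_injective R M s"
  using LeastI_ex[OF syzygy_injective_eventually[OF assms(1)]] assms(2) unfolding IT_phi_alt by blast

end

section \<open>Restriction of scalars and base change along a quotient map\<close>

lemma restrict_scalars_sel [simp]: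
  "carrier (restrict_scalars R I X) = carrier X" "\<zero>\<^bsub>restrict_scalars R I X\<^esub> = \<zero>\<^bsub>X\<^esub>"
  "x \<oplus>\<^bsub>restrict_scalars R I X\<^esub> y = x \<oplus>\<^bsub>X\<^esub> y"
  "a \<odot>\<^bsub>restrict_scalars R I X\<^esub> x = (I +>\<^bsub>R\<^esub> a) \<odot>\<^bsub>X\<^esub> x"
  by (simp_all add: restrict_scalars_def)

lemma restrict_scalars_direct_sum:
  "restrict_scalars R I (direct_sum X Y) = direct_sum (restrict_scalars R I X) (restrict_scalars R I Y)"
  by (simp add: restrict_scalars_def direct_sum_def fun_eq_iff)

lemma restrict_scalars_ker:
  "restrict_scalars R I (ker_mod X f Y) = ker_mod (restrict_scalars R I X) f (restrict_scalars R I Y)"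
  by (simp add: restrict_scalars_def)

text \<open>The submodule \<open>I M\<close>, taken as the least one that contains all products, so
  that inclusions follow from minimality and no finite sums occur.\<close>

definition ideal_mult :: "('a, 'c) ring_scheme \<Rightarrow> 'a set \<Rightarrow> ('a, 'm) module \<Rightarrow> 'm set"
  where "ideal_mult R I M = \<Inter>{N. submodule N R M \<and> (\<forall>a \<in> I. \<forall>x \<in> carrier M. a \<odot>\<^bsub>M\<^esub> x \<in> N)}"

definition residue_class :: "('a, 'c) ring_scheme \<Rightarrow> 'a set \<Rightarrow> ('a, 'm) module \<Rightarrow> 'm \<Rightarrow> 'm set"
  where "residue_class R I M x = {y \<in> carrier M. y \<ominus>\<^bsub>M\<^esub> x \<in> ideal_mult R I M}"

text \<open>The quotient of \<open>M\<close> by \<open>I M\<close>, that is, the tensor product of \<open>M\<close> with \<open>R Quot I\<close>. The operations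
  act on arbitrarily chosen representatives.\<close>

definition base_change :: "('a, 'c) ring_scheme \<Rightarrow> 'a set \<Rightarrow> ('a, 'm) module \<Rightarrow> ('a set, 'm set) module"
  where "base_change R I M =
    (let r = (\<lambda>U. SOME x. x \<in> carrier M \<and> residue_class R I M x = U);
         s = (\<lambda>C. SOME a. a \<in> carrier R \<and> I +>\<^bsub>R\<^esub> a = C)
     in \<lparr>carrier = residue_class R I M ` carrier M, monoid.mult = undefined, one = undefined,
         ring.zero = residue_class R I M \<zero>\<^bsub>M\<^esub>,
         add = (\<lambda>U V. residue_class R I M (r U \<oplus>\<^bsub>M\<^esub> r V)),
         smult = (\<lambda>C U. residue_class R I M (s C \<odot>\<^bsub>M\<^esub> r U))\<rparr>)"

lemma (in abelian_group) minus_telescope: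
  "x \<in> carrier G \<Longrightarrow> y \<in> carrier G \<Longrightarrow> z \<in> carrier G \<Longrightarrow> (z \<ominus> x) \<oplus> (x \<ominus> y) = z \<ominus> y"
  by (simp add: a_minus_def a_assoc r_neg1)

lemma (in abelian_group) add_minus_cancel:
  "x \<in> carrier G \<Longrightarrow> y \<in> carrier G \<Longrightarrow> (x \<oplus> y) \<ominus> y = x"
  by (simp add: a_minus_def a_assoc r_neg)

lemma carrier_FactRing: "carrier (R Quot I) = (+>\<^bsub>R\<^esub>) I ` carrier R"
  by (auto simp: FactRing_def A_RCOSETS_def')

locale quotient_setting = finite_length_ring +
  fixes I
  assumes ideal: "ideal I R"
begin

abbreviation B where "B \<equiv> R Quot I"
abbreviation res where "res X \<equiv> restrict_scalars R I X"
abbreviation bc where "bc M \<equiv> base_change R I M"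
abbreviation q where "q M \<equiv> residue_class R I M"
abbreviation IM where "IM M \<equiv> ideal_mult R I M"

sublocale I: ideal I R by (rule ideal)

lemma ring_B: "ring B" by (rule I.quotient_is_ring)

lemma coset_ops [simp]:
  "a \<in> carrier R \<Longrightarrow> b \<in> carrier R \<Longrightarrow> I +>\<^bsub>R\<^esub> (a \<oplus>\<^bsub>R\<^esub> b) = (I +>\<^bsub>R\<^esub> a) \<oplus>\<^bsub>B\<^esub> (I +>\<^bsub>R\<^esub> b)"
  "a \<in> carrier R \<Longrightarrow> b \<in> carrier R \<Longrightarrow> I +>\<^bsub>R\<^esub> (a \<otimes>\<^bsub>R\<^esub> b) = (I +>\<^bsub>R\<^esub> a) \<otimes>\<^bsub>B\<^esub> (I +>\<^bsub>R\<^esub> b)"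
  "I +>\<^bsub>R\<^esub> \<one>\<^bsub>R\<^esub> = \<one>\<^bsub>B\<^esub>"
  "a \<in> carrier R \<Longrightarrow> I +>\<^bsub>R\<^esub> a \<in> carrier B"
  by (rule ring_hom_add[OF I.rcos_ring_hom] ring_hom_mult[OF I.rcos_ring_hom] ring_hom_one[OF I.rcos_ring_hom]
      ring_hom_closed[OF I.rcos_ring_hom]; assumption)+

lemma carrier_B: "carrier B = (+>\<^bsub>R\<^esub>) I ` carrier R"
  by (rule carrier_FactRing)

lemma coset_eq: "a \<in> carrier R \<Longrightarrow> b \<in> carrier R \<Longrightarrow> I +>\<^bsub>R\<^esub> a = I +>\<^bsub>R\<^esub> b \<longleftrightarrow> a \<ominus>\<^bsub>R\<^esub> b \<in> I"
  by (rule I.quotient_eq_iff_same_a_r_cos[OF ideal, symmetric])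

lemma coset_zero: "a \<in> I \<Longrightarrow> I +>\<^bsub>R\<^esub> a = \<zero>\<^bsub>B\<^esub>"
  using I.a_rcos_const[of a] by (simp only: FactRing_def ring.simps)

lemma coset_zero' [simp]: "I +>\<^bsub>R\<^esub> \<zero>\<^bsub>R\<^esub> = \<zero>\<^bsub>B\<^esub>"
  by (rule coset_zero) (rule additive_subgroup.zero_closed[OF ideal.axioms(1)[OF ideal]])

lemma left_module_restrict_iff: "left_module B X \<longleftrightarrow> left_module R (res X)"
proof
  assume "left_module B X"
  then interpret X: left_module B X .
  show "left_module R (res X)"
    by (rule left_moduleI)
      (auto simp: ring X.smult_closed X.smult_l_distr X.smult_r_distr X.smult_assoc1 X.smult_one
        X.M.a_ac X.zero_smult)
next
  assume "left_module R (res X)"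
  then interpret X: left_module R "res X" .
  show "left_module B X"
  proof (rule left_moduleI)
    fix C D x y assume C: "C \<in> carrier B" and x: "x \<in> carrier X"
    from C obtain a where a: "a \<in> carrier R" "C = I +>\<^bsub>R\<^esub> a" by (auto simp: carrier_B)
    show "C \<odot>\<^bsub>X\<^esub> x \<in> carrier X" using X.smult_closed[of a x] a x by simp
    show "C \<odot>\<^bsub>X\<^esub> (x \<oplus>\<^bsub>X\<^esub> y) = C \<odot>\<^bsub>X\<^esub> x \<oplus>\<^bsub>X\<^esub> C \<odot>\<^bsub>X\<^esub> y" if "y \<in> carrier X"
      using X.smult_r_distr[of a x y] a x that by simp
    assume D: "D \<in> carrier B"
    from D obtain b where b: "b \<in> carrier R" "D = I +>\<^bsub>R\<^esub> b" by (auto simp: carrier_B)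
    show "(C \<oplus>\<^bsub>B\<^esub> D) \<odot>\<^bsub>X\<^esub> x = C \<odot>\<^bsub>X\<^esub> x \<oplus>\<^bsub>X\<^esub> D \<odot>\<^bsub>X\<^esub> x"
      using X.smult_l_distr[of a b x] a b x by simp
    show "(C \<otimes>\<^bsub>B\<^esub> D) \<odot>\<^bsub>X\<^esub> x = C \<odot>\<^bsub>X\<^esub> (D \<odot>\<^bsub>X\<^esub> x)"
      using X.smult_assoc1[of a b x] a b x by simp
  next
    fix x assume x: "x \<in> carrier X"
    show "\<one>\<^bsub>B\<^esub> \<odot>\<^bsub>X\<^esub> x = x" using X.smult_one[of x] x by simp
    show "\<zero>\<^bsub>B\<^esub> \<odot>\<^bsub>X\<^esub> x = \<zero>\<^bsub>X\<^esub>" using X.zero_smult[of x] x by simp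
  qed (use X.M.a_closed X.M.a_assoc X.M.a_comm X.M.zero_closed X.M.l_zero in \<open>simp_all add: ring_B\<close>)
qed

lemma submodule_restrict_iff: "left_module B X \<Longrightarrow> submodule K B X \<longleftrightarrow> submodule K R (res X)"
  by (simp add: submodule_iff left_module_restrict_iff[symmetric] carrier_B)

lemma fg_restrict_iff: "fg_module B X \<longleftrightarrow> fg_module R (res X)"
  using submodule_restrict_iff[of X] by (auto simp: fg_module_def left_module_restrict_iff[symmetric])

lemma module_map_restrict_iff: "module_map B X Y f \<longleftrightarrow> module_map R (res X) (res Y) f"
  by (auto simp: module_map_def carrier_B)

lemma mod_hom_restrict_iff: "mod_hom B X Y = mod_hom R (res X) (res Y)"
  by (auto simp: mod_hom_def carrier_B)

lemma mod_isomorphic_restrict_iff: "mod_isomorphic B X Y \<longleftrightarrow> mod_isomorphic R (res X) (res Y)"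
  by (simp add: mod_isomorphic_def mod_hom_restrict_iff)

text \<open>Submodules over the quotient are the same sets as submodules over \<open>R\<close>, and
  the quotient is finitely generated over \<open>R\<close>.\<close>

lemma finite_length_B: "finite_length B (regular_module B)"
proof -
  let ?X = "regular_module B"
  have fg: "fg_module B ?X" by (rule fg_module_regular[OF ring_B])
  have L: "left_module B ?X" by (rule left_module_regular[OF ring_B])
  have "finite_length R (res ?X)"
    by (rule fg_finite_length[OF finite_length]) (use fg fg_restrict_iff in blast)
  moreover have "submodule_order up B ?X = submodule_order up R (res ?X)" for up
    using submodule_restrict_iff[OF L] by (auto simp: submodule_order_def)
  ultimately show ?thesis by (simp add: finite_length_def)
qed

sublocale BF: finite_length_ring B
  by (rule finite_length_ring.intro[OF ring_B finite_length_B])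

section \<open>The submodule \<open>I M\<close> and the quotient by it\<close>

lemma submodule_ideal_mult:
  assumes "left_module R M" shows "submodule (IM M) R M"
proof -
  interpret M: left_module R M by fact
  show ?thesis
    unfolding submodule_iff[OF assms]
  proof (intro conjI)
    show "IM M \<subseteq> carrier M"
      using submodule_carrier[OF assms] M.smult_closed I.Icarr by (auto simp: ideal_mult_def)
  qed (auto simp: ideal_mult_def submoduleD)
qed

lemma ideal_mult_memI: "a \<in> I \<Longrightarrow> x \<in> carrier M \<Longrightarrow> a \<odot>\<^bsub>M\<^esub> x \<in> IM M"
  by (auto simp: ideal_mult_def)

lemma ideal_mult_least:
  "submodule N R M \<Longrightarrow> (\<And>a x. a \<in> I \<Longrightarrow> x \<in> carrier M \<Longrightarrow> a \<odot>\<^bsub>M\<^esub> x \<in> N) \<Longrightarrow> IM M \<subseteq> N"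
  by (auto simp: ideal_mult_def)

lemma ideal_mult_map:
  assumes M: "left_module R M" and N: "left_module R N" and f: "module_map R M N f" and x: "x \<in> IM M"
  shows "f x \<in> IM N"
proof -
  have "IM M \<subseteq> {x \<in> carrier M. f x \<in> IM N}"
  proof (rule ideal_mult_least[OF module_map_vimage[OF M N f submodule_ideal_mult[OF N]]])
    fix a x assume ax: "a \<in> I" "x \<in> carrier M"
    interpret M: left_module R M by fact
    show "a \<odot>\<^bsub>M\<^esub> x \<in> {x \<in> carrier M. f x \<in> IM N}"
      using ax I.Icarr[OF ax(1)] ideal_mult_memI[OF ax(1) module_mapD(1)[OF f ax(2)]]
      by (simp add: M.smult_closed module_mapD(3)[OF f])
  qed
  then show ?thesis using x by blast
qed

lemma ideal_mult_surj:
  assumes M: "left_module R M" and N: "left_module R N" and f: "module_map R M N f"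
    and surj: "f ` carrier M = carrier N"
  shows "f ` IM M = IM N"
proof
  show "f ` IM M \<subseteq> IM N" using ideal_mult_map[OF M N f] by blast
  show "IM N \<subseteq> f ` IM M"
  proof (rule ideal_mult_least[OF module_map_image[OF M N f submodule_ideal_mult[OF M]]])
    fix a y assume ay: "a \<in> I" "y \<in> carrier N"
    then obtain x where x: "x \<in> carrier M" "y = f x" using surj by blast
    then have "a \<odot>\<^bsub>N\<^esub> y = f (a \<odot>\<^bsub>M\<^esub> x)" using I.Icarr[OF ay(1)] by (simp add: module_mapD(3)[OF f])
    then show "a \<odot>\<^bsub>N\<^esub> y \<in> f ` IM M" using ideal_mult_memI[OF ay(1) x(1)] by blast
  qed
qed

lemma ideal_mult_restrict:
  assumes "left_module B X" shows "IM (res X) = {\<zero>\<^bsub>X\<^esub>}"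
proof -
  interpret X: left_module B X by fact
  have L: "left_module R (res X)" using assms by (simp add: left_module_restrict_iff)
  have "IM (res X) \<subseteq> {\<zero>\<^bsub>res X\<^esub>}"
    by (rule ideal_mult_least[OF submodule_zero[OF L]]) (simp add: coset_zero X.zero_smult)
  then show ?thesis using submoduleD(2)[OF submodule_ideal_mult[OF L]] by auto
qed

lemma ideal_mult_direct_sum:
  assumes M: "left_module R M" and N: "left_module R N"
  shows "IM (direct_sum M N) = IM M \<times> IM N"
proof
  note D = left_module_direct_sum[OF M N]
  note s = submodule_ideal_mult[OF M] submodule_ideal_mult[OF N] submodule_ideal_mult[OF D]
  interpret M: left_module R M by fact
  interpret N: left_module R N by fact
  have "submodule (IM M \<times> IM N) R (direct_sum M N)"
    unfolding submodule_iff[OF D] using submoduleD[OF s(1)] submoduleD[OF s(2)] by auto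
  then show "IM (direct_sum M N) \<subseteq> IM M \<times> IM N"
    by (rule ideal_mult_least) (auto simp: ideal_mult_memI)
  show "IM M \<times> IM N \<subseteq> IM (direct_sum M N)"
  proof clarify
    fix x y assume xy: "x \<in> IM M" "y \<in> IM N"
    have c: "x \<in> carrier M" "y \<in> carrier N" using xy submoduleD(1)[OF s(1)] submoduleD(1)[OF s(2)] by auto
    have "(x, \<zero>\<^bsub>N\<^esub>) \<in> IM (direct_sum M N)" by (rule ideal_mult_map[OF M D module_map_Pair_left[OF N] xy(1)])
    moreover have "(\<zero>\<^bsub>M\<^esub>, y) \<in> IM (direct_sum M N)" by (rule ideal_mult_map[OF N D module_map_Pair_right[OF M] xy(2)])
    ultimately show "(x, y) \<in> IM (direct_sum M N)" using submoduleD(3)[OF s(3)] c by fastforce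
  qed
qed

lemma residue_class_eq:
  assumes M: "left_module R M" and x: "x \<in> carrier M" and y: "y \<in> carrier M"
  shows "q M x = q M y \<longleftrightarrow> x \<ominus>\<^bsub>M\<^esub> y \<in> IM M"
proof
  interpret M: left_module R M by fact
  note s = submodule_ideal_mult[OF M]
  have "x \<in> q M x" using x submoduleD(2)[OF s] by (simp add: residue_class_def a_minus_def M.M.r_neg)
  then show "q M x = q M y \<Longrightarrow> x \<ominus>\<^bsub>M\<^esub> y \<in> IM M" by (simp add: residue_class_def)
  assume xy: "x \<ominus>\<^bsub>M\<^esub> y \<in> IM M"
  have "z \<ominus>\<^bsub>M\<^esub> x \<in> IM M \<longleftrightarrow> z \<ominus>\<^bsub>M\<^esub> y \<in> IM M" if z: "z \<in> carrier M" for z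
  proof -
    have 1: "(z \<ominus>\<^bsub>M\<^esub> x) \<oplus>\<^bsub>M\<^esub> (x \<ominus>\<^bsub>M\<^esub> y) = z \<ominus>\<^bsub>M\<^esub> y" using x y z by (rule M.M.minus_telescope)
    have 2: "(z \<ominus>\<^bsub>M\<^esub> y) \<ominus>\<^bsub>M\<^esub> (x \<ominus>\<^bsub>M\<^esub> y) = z \<ominus>\<^bsub>M\<^esub> x"
      unfolding 1[symmetric] using x y z by (simp add: M.M.add_minus_cancel)
    show ?thesis using submoduleD(3)[OF s _ xy, of "z \<ominus>\<^bsub>M\<^esub> x"] submoduleD(5)[OF s _ xy, of "z \<ominus>\<^bsub>M\<^esub> y"]
      unfolding 1 2 by blast
  qed
  then show "q M x = q M y" by (auto simp: residue_class_def)
qed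

lemma base_change_ops:
  assumes M: "left_module R M"
  shows "carrier (bc M) = q M ` carrier M" and "\<zero>\<^bsub>bc M\<^esub> = q M \<zero>\<^bsub>M\<^esub>"
    and "x \<in> carrier M \<Longrightarrow> y \<in> carrier M \<Longrightarrow> q M x \<oplus>\<^bsub>bc M\<^esub> q M y = q M (x \<oplus>\<^bsub>M\<^esub> y)"
    and "a \<in> carrier R \<Longrightarrow> x \<in> carrier M \<Longrightarrow> (I +>\<^bsub>R\<^esub> a) \<odot>\<^bsub>bc M\<^esub> q M x = q M (a \<odot>\<^bsub>M\<^esub> x)"
proof -
  interpret M: left_module R M by fact
  note s = submodule_ideal_mult[OF M]
  let ?r = "\<lambda>U. SOME x. x \<in> carrier M \<and> q M x = U" and ?s = "\<lambda>C. SOME a. a \<in> carrier R \<and> I +>\<^bsub>R\<^esub> a = C"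
  show "carrier (bc M) = q M ` carrier M" "\<zero>\<^bsub>bc M\<^esub> = q M \<zero>\<^bsub>M\<^esub>"
    by (simp_all add: base_change_def Let_def)
  have r: "?r (q M x) \<in> carrier M" "?r (q M x) \<ominus>\<^bsub>M\<^esub> x \<in> IM M" if x: "x \<in> carrier M" for x
  proof -
    have *: "?r (q M x) \<in> carrier M \<and> q M (?r (q M x)) = q M x" by (rule someI[of _ x]) (simp add: x)
    then show "?r (q M x) \<in> carrier M" by blast
    show "?r (q M x) \<ominus>\<^bsub>M\<^esub> x \<in> IM M" using * residue_class_eq[OF M _ x] by blast
  qed
  have sc: "?s (I +>\<^bsub>R\<^esub> a) \<in> carrier R" "?s (I +>\<^bsub>R\<^esub> a) \<ominus>\<^bsub>R\<^esub> a \<in> I" if a: "a \<in> carrier R" for a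
  proof -
    have *: "?s (I +>\<^bsub>R\<^esub> a) \<in> carrier R \<and> I +>\<^bsub>R\<^esub> (?s (I +>\<^bsub>R\<^esub> a)) = I +>\<^bsub>R\<^esub> a"
      by (rule someI[of _ a]) (simp add: a)
    then show "?s (I +>\<^bsub>R\<^esub> a) \<in> carrier R" by blast
    show "?s (I +>\<^bsub>R\<^esub> a) \<ominus>\<^bsub>R\<^esub> a \<in> I" using * coset_eq[OF _ a] by blast
  qed
  show "q M x \<oplus>\<^bsub>bc M\<^esub> q M y = q M (x \<oplus>\<^bsub>M\<^esub> y)" if x: "x \<in> carrier M" and y: "y \<in> carrier M"
  proof -
    define u v where "u = ?r (q M x)" and "v = ?r (q M y)"
    have uv: "u \<in> carrier M" "v \<in> carrier M" "u \<ominus>\<^bsub>M\<^esub> x \<in> IM M" "v \<ominus>\<^bsub>M\<^esub> y \<in> IM M"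
      using r[OF x] r[OF y] by (simp_all add: u_def v_def)
    have "(u \<oplus>\<^bsub>M\<^esub> v) \<ominus>\<^bsub>M\<^esub> (x \<oplus>\<^bsub>M\<^esub> y) = (u \<ominus>\<^bsub>M\<^esub> x) \<oplus>\<^bsub>M\<^esub> (v \<ominus>\<^bsub>M\<^esub> y)"
      using x y uv by (simp add: a_minus_def M.M.minus_add M.M.a_ac)
    then have "q M (u \<oplus>\<^bsub>M\<^esub> v) = q M (x \<oplus>\<^bsub>M\<^esub> y)"
      using residue_class_eq[OF M, of "u \<oplus>\<^bsub>M\<^esub> v" "x \<oplus>\<^bsub>M\<^esub> y"] submoduleD(3)[OF s uv(3,4)] x y uv by simp
    moreover have "q M x \<oplus>\<^bsub>bc M\<^esub> q M y = q M (u \<oplus>\<^bsub>M\<^esub> v)" by (simp add: base_change_def Let_def u_def v_def)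
    ultimately show ?thesis by simp
  qed
  show "(I +>\<^bsub>R\<^esub> a) \<odot>\<^bsub>bc M\<^esub> q M x = q M (a \<odot>\<^bsub>M\<^esub> x)" if a: "a \<in> carrier R" and x: "x \<in> carrier M"
  proof -
    define u b where "u = ?r (q M x)" and "b = ?s (I +>\<^bsub>R\<^esub> a)"
    have ub: "u \<in> carrier M" "u \<ominus>\<^bsub>M\<^esub> x \<in> IM M" "b \<in> carrier R" "b \<ominus>\<^bsub>R\<^esub> a \<in> I"
      using r[OF x] sc[OF a] by (simp_all add: u_def b_def)
    \<comment> \<open>The difference is split as \<open>b u - a x = (b - a) u + a (u - x)\<close>.
      The first term lies in \<open>I M\<close> since \<open>b - a\<close> is in \<open>I\<close>,
      the second since \<open>u - x\<close> is in the submodule \<open>I M\<close>.\<close>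
    have "b \<odot>\<^bsub>M\<^esub> u = (b \<ominus>\<^bsub>R\<^esub> a) \<odot>\<^bsub>M\<^esub> u \<oplus>\<^bsub>M\<^esub> a \<odot>\<^bsub>M\<^esub> u"
      using ub a M.smult_l_distr[of "b \<ominus>\<^bsub>R\<^esub> a" a u] by (simp add: a_minus_def I.a_assoc I.l_neg)
    moreover have "a \<odot>\<^bsub>M\<^esub> u = a \<odot>\<^bsub>M\<^esub> (u \<ominus>\<^bsub>M\<^esub> x) \<oplus>\<^bsub>M\<^esub> a \<odot>\<^bsub>M\<^esub> x"
      using ub a x M.smult_r_distr[of a "u \<ominus>\<^bsub>M\<^esub> x" x] by (simp add: a_minus_def M.M.a_assoc M.M.l_neg)
    moreover note m = ideal_mult_memI[OF ub(4,1)] submoduleD(6)[OF s a ub(2)]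
    have c: "(b \<ominus>\<^bsub>R\<^esub> a) \<odot>\<^bsub>M\<^esub> u \<in> carrier M" "a \<odot>\<^bsub>M\<^esub> (u \<ominus>\<^bsub>M\<^esub> x) \<in> carrier M" "a \<odot>\<^bsub>M\<^esub> x \<in> carrier M"
      using m submoduleD(1)[OF s] a x by (auto simp: M.smult_closed)
    ultimately have "b \<odot>\<^bsub>M\<^esub> u \<ominus>\<^bsub>M\<^esub> a \<odot>\<^bsub>M\<^esub> x = (b \<ominus>\<^bsub>R\<^esub> a) \<odot>\<^bsub>M\<^esub> u \<oplus>\<^bsub>M\<^esub> a \<odot>\<^bsub>M\<^esub> (u \<ominus>\<^bsub>M\<^esub> x)"
      by (simp add: a_minus_def[of M "(b \<ominus>\<^bsub>R\<^esub> a) \<odot>\<^bsub>M\<^esub> u \<oplus>\<^bsub>M\<^esub> (a \<odot>\<^bsub>M\<^esub> (u \<ominus>\<^bsub>M\<^esub> x) \<oplus>\<^bsub>M\<^esub> a \<odot>\<^bsub>M\<^esub> x)"] M.M.a_assoc M.M.r_neg)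
    then have "q M (b \<odot>\<^bsub>M\<^esub> u) = q M (a \<odot>\<^bsub>M\<^esub> x)"
      using residue_class_eq[OF M, of "b \<odot>\<^bsub>M\<^esub> u" "a \<odot>\<^bsub>M\<^esub> x"] submoduleD(3)[OF s m] a x ub by (simp add: M.smult_closed)
    moreover have "(I +>\<^bsub>R\<^esub> a) \<odot>\<^bsub>bc M\<^esub> q M x = q M (b \<odot>\<^bsub>M\<^esub> u)" by (simp add: base_change_def Let_def u_def b_def)
    ultimately show ?thesis by simp
  qed
qed

lemma left_module_base_change:
  assumes M: "left_module R M" shows "left_module B (bc M)" "left_module R (res (bc M))"
proof -
  note o = base_change_ops[OF M]
  show "left_module R (res (bc M))"
    by (rule left_module_image[OF M, where f = "q M"]) (simp_all add: o)
  then show "left_module B (bc M)" by (simp add: left_module_restrict_iff)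
qed

lemma module_map_residue_class:
  assumes M: "left_module R M" shows "module_map R M (res (bc M)) (q M)"
  unfolding module_map_def by (simp add: base_change_ops[OF M])

lemma residue_class_zero:
  assumes M: "left_module R M" and x: "x \<in> carrier M"
  shows "q M x = \<zero>\<^bsub>bc M\<^esub> \<longleftrightarrow> x \<in> IM M"
proof -
  interpret M: left_module R M by fact
  show ?thesis using residue_class_eq[OF M x, of "\<zero>\<^bsub>M\<^esub>"] x
      M.M.add_minus_cancel[OF x M.M.zero_closed]
    by (simp add: base_change_ops[OF M])
qed

text \<open>A map into a module over the quotient ring kills \<open>I M\<close>. This is the
  adjunction between base change and restriction.\<close>

lemma base_change_lift:
  assumes M: "left_module R M" and X: "left_module B X" and f: "module_map R M (res X) f"
  obtains g where "module_map B (bc M) X g" "\<And>x. x \<in> carrier M \<Longrightarrow> g (q M x) = f x"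
proof -
  interpret M: left_module R M by fact
  have LX: "left_module R (res X)" using X by (simp add: left_module_restrict_iff)
  interpret X: left_module R "res X" by (rule LX)
  note o = base_change_ops[OF M]
  have eq: "f x = f y" if xy: "x \<in> carrier M" "y \<in> carrier M" "q M x = q M y" for x y
  proof -
    have "x \<ominus>\<^bsub>M\<^esub> y \<in> IM M" using xy by (simp add: residue_class_eq[OF M])
    from ideal_mult_map[OF M LX f this] have "f x \<ominus>\<^bsub>res X\<^esub> f y = \<zero>\<^bsub>res X\<^esub>"
      using xy by (simp add: module_map_minus[OF M LX f] ideal_mult_restrict[OF X])
    then show ?thesis using xy module_mapD(1)[OF f] using X.M.minus_eq_zero_iff[of "f x" "f y"] by simp
  qed
  let ?g = "\<lambda>U. f (SOME x. x \<in> carrier M \<and> q M x = U)"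
  have g: "?g (q M x) = f x" if x: "x \<in> carrier M" for x
  proof -
    have "(SOME y. y \<in> carrier M \<and> q M y = q M x) \<in> carrier M \<and> q M (SOME y. y \<in> carrier M \<and> q M y = q M x) = q M x"
      by (rule someI[of _ x]) (simp add: x)
    then show ?thesis using eq x by blast
  qed
  have "module_map R (res (bc M)) (res X) ?g"
    unfolding module_map_def
    using module_mapD[OF f] by (simp add: o g M.smult_closed)
  then show thesis by (intro that[of ?g]) (simp_all add: module_map_restrict_iff g)
qed

lemma base_change_iso:
  assumes M: "left_module R M" and X: "left_module B X" and f: "module_map R M (res X) f"
    and surj: "f ` carrier M = carrier X" and ker: "\<And>x. x \<in> carrier M \<Longrightarrow> f x = \<zero>\<^bsub>X\<^esub> \<Longrightarrow> x \<in> IM M"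
  shows "mod_isomorphic B (bc M) X"
proof -
  obtain g where g: "module_map B (bc M) X g" "\<And>x. x \<in> carrier M \<Longrightarrow> g (q M x) = f x"
    by (rule base_change_lift[OF M X f]) (rule that)
  note L = left_module_base_change(1)[OF M]
  note o = base_change_ops[OF M]
  have "inj_on g (carrier (bc M))"
    unfolding module_map_inj_iff[OF L X g(1)] using ker by (auto simp: o(1) g(2) residue_class_zero[OF M])
  moreover have "g ` carrier (bc M) = carrier X"
    using surj by (simp add: o(1) image_image g(2))
  ultimately show ?thesis using g(1) L X by (auto simp: mod_isomorphic_iff bij_betw_def)
qed

lemma fg_base_change:
  assumes "fg_module R M" shows "fg_module B (bc M)"
proof -
  note M = fg_module_left_module[OF assms]
  show ?thesis unfolding fg_restrict_iff
    by (rule fg_module_image[OF assms left_module_base_change(2)[OF M] module_map_residue_class[OF M]])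
      (simp add: base_change_ops[OF M])
qed

lemma base_change_cong:
  assumes M: "left_module R M" and N: "left_module R N" and iso: "mod_isomorphic R M N"
  shows "mod_isomorphic B (bc M) (bc N)"
proof -
  obtain f where f: "module_map R M N f" "bij_betw f (carrier M) (carrier N)"
    using iso M N by (auto simp: mod_isomorphic_iff)
  have surj: "f ` carrier M = carrier N" and inj: "inj_on f (carrier M)" using f(2) by (simp_all add: bij_betw_def)
  show ?thesis
  proof (rule base_change_iso[OF M left_module_base_change(1)[OF N] module_map_comp[OF f(1) module_map_residue_class[OF N]]])
    show "(\<lambda>x. q N (f x)) ` carrier M = carrier (bc N)"
      unfolding base_change_ops(1)[OF N] surj[symmetric] image_image ..
    fix x assume x: "x \<in> carrier M" "q N (f x) = \<zero>\<^bsub>bc N\<^esub>"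
    then have "f x \<in> f ` IM M"
      using residue_class_zero[OF N] module_mapD(1)[OF f(1)] unfolding ideal_mult_surj[OF M N f(1) surj] by simp
    then show "x \<in> IM M"
      using x(1) inj submoduleD(1)[OF submodule_ideal_mult[OF M]] by (auto dest: inj_onD)
  qed
qed

lemma base_change_direct_sum:
  assumes M: "left_module R M" and N: "left_module R N"
  shows "mod_isomorphic B (bc (direct_sum M N)) (direct_sum (bc M) (bc N))"
proof (rule base_change_iso[OF left_module_direct_sum[OF M N], where f = "map_prod (q M) (q N)"])
  note L = left_module_base_change[OF M] left_module_base_change[OF N]
  show "left_module B (direct_sum (bc M) (bc N))" by (rule left_module_direct_sum[OF L(1,3)])
  show "module_map R (direct_sum M N) (res (direct_sum (bc M) (bc N))) (map_prod (q M) (q N))"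
    unfolding restrict_scalars_direct_sum
    by (rule module_map_map_prod[OF module_map_residue_class[OF M] module_map_residue_class[OF N]])
  show "map_prod (q M) (q N) ` carrier (direct_sum M N) = carrier (direct_sum (bc M) (bc N))"
    by (simp add: map_prod_surj_on base_change_ops[OF M] base_change_ops[OF N])
  fix p assume "p \<in> carrier (direct_sum M N)" "map_prod (q M) (q N) p = \<zero>\<^bsub>direct_sum (bc M) (bc N)\<^esub>"
  then show "p \<in> IM (direct_sum M N)"
    by (auto simp: ideal_mult_direct_sum[OF M N] residue_class_zero[OF M] residue_class_zero[OF N])
qed

lemma base_change_restrict:
  assumes X: "left_module B X" shows "mod_isomorphic B (bc (res X)) X"
  by (rule base_change_iso[OF _ X, where f = "\<lambda>x. x"])
    (use X in \<open>simp_all add: left_module_restrict_iff[symmetric] module_map_def ideal_mult_restrict\<close>)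

lemma restrict_base_change:
  assumes M: "left_module R M" and "IM M \<subseteq> {\<zero>\<^bsub>M\<^esub>}"
  shows "mod_isomorphic R M (res (bc M))"
proof -
  note L = left_module_base_change(2)[OF M]
  note f = module_map_residue_class[OF M]
  have "inj_on (q M) (carrier M)"
    unfolding module_map_inj_iff[OF M L f] using assms(2) residue_class_zero[OF M] by auto
  then have "bij_betw (q M) (carrier M) (carrier (res (bc M)))"
    by (simp add: bij_betw_def base_change_ops[OF M])
  then show ?thesis using f M L by (auto simp: mod_isomorphic_iff)
qed

text \<open>The map is lifted over \<open>R\<close> after restriction and then factored through the
  quotient: base change is left adjoint to an exact functor.\<close>

lemma projective_base_change:
  assumes P: "left_module R P" "projective R P"
  shows "projective B (bc P)"
proof (rule projectiveI[OF left_module_base_change(1)[OF P(1)]])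
  fix M N g f
  assume *: "M \<in> mod_cat B" "N \<in> mod_cat B" "module_map B M N g" "module_map B (bc P) N f"
    "g ` carrier M = carrier N"
  have fg: "fg_module R (res M)" "fg_module R (res N)" using * by (simp_all add: mod_cat_fg fg_restrict_iff)
  have LM: "left_module B M" using *(1) by (simp add: mod_cat_fg fg_module_left_module)
  have g: "module_map R (res M) (res N) g" and f: "module_map R (res (bc P)) (res N) f"
    using *(3,4) by (simp_all add: module_map_restrict_iff)
  obtain h where h: "module_map R P (res M) h" "\<And>x. x \<in> carrier P \<Longrightarrow> g (h x) = f (q P x)"
    by (rule projective_lift[OF P(2,1) fg g _ module_map_comp[OF module_map_residue_class[OF P(1)] f]])
      (use *(5) in auto)
  obtain k where k: "module_map B (bc P) M k" "\<And>x. x \<in> carrier P \<Longrightarrow> k (q P x) = h x"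
    by (rule base_change_lift[OF P(1) LM h(1)]) (rule that)
  then show "\<exists>h. module_map B (bc P) M h \<and> (\<forall>x \<in> carrier (bc P). g (h x) = f x)"
    using h(2) by (intro exI[of _ k]) (auto simp: base_change_ops[OF P(1)])
qed

text \<open>Base change on formal sums; by \<open>bc_map_relations\<close> it preserves classes in
  the stable groups.\<close>

definition bc_map where "bc_map = frag_extend (\<lambda>M. mod_class B (bc M))"

lemma bc_map_relations: "x \<in> K0_relations R \<Longrightarrow> bc_map x \<in> K0_relations B"
  unfolding bc_map_def
proof (rule frag_extend_K0_relations)
  fix A C D assume *: "A \<in> mod_cat R" "C \<in> mod_cat R" "D \<in> mod_cat R" "mod_isomorphic R D (direct_sum A C)"
  have fg: "fg_module R A" "fg_module R C" "fg_module R D" using * by (simp_all add: mod_cat_fg)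
  note L = fg[THEN fg_module_left_module]
  note LAC = left_module_direct_sum[OF L(1,2)]
  note T = fg_base_change[OF fg(1)] fg_base_change[OF fg(2)] fg_base_change[OF fg(3)]
  have "mod_isomorphic B (bc D) (direct_sum (bc A) (bc C))"
    by (rule mod_isomorphic_trans[OF left_module_base_change(1)[OF L(3)] left_module_base_change(1)[OF LAC]
          left_module_direct_sum[OF left_module_base_change(1)[OF L(1)] left_module_base_change(1)[OF L(2)]]
          base_change_cong[OF L(3) LAC *(4)] base_change_direct_sum[OF L(1,2)]])
  from K0_eq_trans[OF BF.mod_class_iso[OF T(3) fg_module_direct_sum[OF T(1,2)] this] BF.mod_class_sum[OF T(1,2)]]
  show "K0_eq B (mod_class B (bc D)) (mod_class B (bc A) + mod_class B (bc C))" .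
next
  fix P assume P: "P \<in> mod_cat R" "projective R P"
  then have fg: "fg_module R P" by (simp add: mod_cat_fg)
  show "mod_class B (bc P) \<in> K0_relations B"
    by (rule BF.mod_class_projective[OF fg_base_change[OF fg] projective_base_change[OF fg_module_left_module[OF fg] P(2)]])
qed

lemma bc_map_diff: "bc_map (x - y) = bc_map x - bc_map y"
  by (simp add: bc_map_def frag_extend_diff)

lemma bc_map_eq: "K0_eq R x y \<Longrightarrow> K0_eq B (bc_map x) (bc_map y)"
  using bc_map_relations[of "x - y"] by (simp add: K0_eq_def bc_map_diff)

lemma bc_map_class:
  assumes fg: "fg_module R M" shows "K0_eq B (bc_map (mod_class R M)) (mod_class B (bc M))"
proof -
  note L = fg_module_left_module[OF fg] mod_rep_left_module[OF fg]
  show ?thesis unfolding bc_map_def frag_extend_of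
    by (rule BF.mod_class_iso[OF fg_base_change[OF mod_rep_fg[OF fg]] fg_base_change[OF fg]
          base_change_cong[OF L(2,1) mod_isomorphic_sym[OF L mod_rep(2)[OF fg]]]])
qed

text \<open>The hypothesis \<open>flat\<close> says that Tor in degree one of the quotient ring with
  \<open>M\<close> vanishes. It makes the kernel of \<open>p\<close> remain a kernel after base
  change, so that the induced projective surjection over the quotient has the expected
  syzygy.\<close>

lemma base_change_syzygy:
  assumes fg: "fg_module R P" "fg_module R M" and proj: "projective R P" and p: "module_map R P M p"
    and surj: "p ` carrier P = carrier M"
    and flat: "\<And>x. x \<in> carrier P \<Longrightarrow> p x = \<zero>\<^bsub>M\<^esub> \<Longrightarrow> x \<in> IM P \<Longrightarrow> x \<in> IM (ker_mod P p M)"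
  shows "K0_eq B (syzygy_map B (mod_class B (bc M))) (mod_class B (bc (ker_mod P p M)))"
proof -
  note L = fg[THEN fg_module_left_module]
  interpret P: left_module R P by (rule L(1))
  interpret M: left_module R M by (rule L(2))
  note T = left_module_base_change(1)[OF L(1)] left_module_base_change(1)[OF L(2)]
  note qP = module_map_residue_class[OF L(1)]
  let ?K = "ker_mod P p M"
  note LK = left_module_ker[OF L p]
  obtain t where t: "module_map B (bc P) (bc M) t" "\<And>x. x \<in> carrier P \<Longrightarrow> t (q P x) = q M (p x)"
    by (rule base_change_lift[OF L(1) T(2) module_map_comp[OF p module_map_residue_class[OF L(2)]]]) (rule that)
  have t_surj: "t ` carrier (bc P) = carrier (bc M)"
    unfolding base_change_ops(1)[OF L(1)] base_change_ops(1)[OF L(2)] surj[symmetric] image_image using t(2) by simp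
  note fgB = fg_base_change[OF fg(1)] fg_base_change[OF fg(2)]
  let ?KB = "ker_mod (bc P) t (bc M)"
  note fgKB = BF.fg_ker[OF fgB(1) T(2) t(1)]
  have z0: "q M \<zero>\<^bsub>M\<^esub> = \<zero>\<^bsub>bc M\<^esub>" by (simp add: base_change_ops[OF L(2)])
  have in_ker: "q P x \<in> carrier ?KB" if x: "x \<in> carrier ?K" for x
    using x t(2)[of x] by (simp add: base_change_ops[OF L(1)] z0)
  have "mod_isomorphic B (bc ?K) ?KB"
  proof (rule base_change_iso[OF LK fg_module_left_module[OF fgKB], where f = "q P"])
    show "module_map R ?K (res ?KB) (q P)"
      unfolding module_map_def using in_ker module_mapD[OF qP] by auto
    show "q P ` carrier ?K = carrier ?KB"
    proof
      show "q P ` carrier ?K \<subseteq> carrier ?KB" using in_ker by blast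
      show "carrier ?KB \<subseteq> q P ` carrier ?K"
      proof
        fix U assume U: "U \<in> carrier ?KB"
        then obtain x where x: "x \<in> carrier P" "U = q P x" by (auto simp: base_change_ops[OF L(1)])
        have px: "p x \<in> carrier M" using x by (simp add: module_mapD[OF p])
        have "q M (p x) = \<zero>\<^bsub>bc M\<^esub>" using U x t(2) by simp
        then have "p x \<in> IM M" using residue_class_zero[OF L(2) px] by simp
        \<comment> \<open>\<open>x\<close> is corrected by an element of \<open>I P\<close> with the
          same image under \<open>p\<close>: its residue class is unchanged, and
          \<open>x - y\<close> lies in the kernel.\<close>
        then obtain y where y: "y \<in> IM P" "p x = p y" unfolding ideal_mult_surj[OF L p surj, symmetric] by blast
        have yc: "y \<in> carrier P" using y submoduleD(1)[OF submodule_ideal_mult[OF L(1)]] by blast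
        have "x \<ominus>\<^bsub>P\<^esub> y \<in> carrier ?K"
          using x y yc px by (simp add: module_map_minus[OF L p] M.M.minus_eq_zero_iff)
        moreover have "q P x = q P (x \<ominus>\<^bsub>P\<^esub> y)"
        proof -
          have "x \<ominus>\<^bsub>P\<^esub> (x \<ominus>\<^bsub>P\<^esub> y) = y" using x(1) yc by (simp add: a_minus_def P.M.minus_add P.M.r_neg2)
          then show ?thesis using residue_class_eq[OF L(1) x(1), of "x \<ominus>\<^bsub>P\<^esub> y"] x(1) y yc by simp
        qed
        ultimately show "U \<in> q P ` carrier ?K" using x(2) by blast
      qed
    qed
    fix x assume "x \<in> carrier ?K" "q P x = \<zero>\<^bsub>?KB\<^esub>"
    then show "x \<in> IM ?K" using flat[of x] residue_class_zero[OF L(1), of x] by simp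
  qed
  then have iso: "mod_isomorphic B ?KB (bc ?K)"
    by (rule mod_isomorphic_sym[OF left_module_base_change(1)[OF LK] fg_module_left_module[OF fgKB]])
  have "K0_eq B (syzygy_map B (mod_class B (bc M))) (mod_class B ?KB)"
    by (rule BF.syzygy_map_class[OF fgB projective_base_change[OF L(1) proj] t(1) t_surj])
  also have "K0_eq B \<dots> (mod_class B (bc ?K))"
    by (rule BF.mod_class_iso[OF fgKB fg_base_change[OF fg_ker[OF fg(1) L(2) p]] iso])
  finally show ?thesis .
qed

end

section \<open>Strong idempotent ideals\<close>

lemma module_map_uminus:
  assumes "left_module R M" "left_module R N" and f: "module_map R M N f"
  shows "module_map R M N (\<lambda>x. \<ominus>\<^bsub>N\<^esub> f x)"
proof -
  interpret N: left_module R N by fact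
  have "\<ominus>\<^bsub>N\<^esub> (a \<odot>\<^bsub>N\<^esub> y) = a \<odot>\<^bsub>N\<^esub> (\<ominus>\<^bsub>N\<^esub> y)" if "a \<in> carrier R" "y \<in> carrier N" for a y
  proof (rule N.M.minus_equality)
    show "a \<odot>\<^bsub>N\<^esub> (\<ominus>\<^bsub>N\<^esub> y) \<oplus>\<^bsub>N\<^esub> (a \<odot>\<^bsub>N\<^esub> y) = \<zero>\<^bsub>N\<^esub>"
      using that N.smult_r_distr[of a "\<ominus>\<^bsub>N\<^esub> y" y] by (simp add: N.M.l_neg N.smult_zero)
  qed (use that in \<open>simp_all add: N.smult_closed\<close>)
  then show ?thesis unfolding module_map_def
    using module_mapD[OF f] by (simp add: N.M.minus_add N.M.a_comm)
qed

text \<open>In positive degree the coboundaries are composites with the differential. Writing the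
  cosets out turns membership in a cohomology class into an equation between functions.\<close>

lemma Ext_coset:
  fixes S :: "('s, 't) ring_scheme" and X :: "('s, 'm) module" and Y :: "('s, 'n) module"
  shows "coboundaries (Suc i) S X Y #>\<^bsub>hom_group S (res_obj S X (Suc i)) Y\<^esub> u =
    {\<lambda>x \<in> carrier (res_obj S X (Suc i)). h (res_diff S X i x) \<oplus>\<^bsub>Y\<^esub> u x |h. h \<in> mod_hom S (res_obj S X i) Y}"
proof -
  have "(\<lambda>x \<in> carrier P. compose (carrier P) h d x \<oplus>\<^bsub>Y\<^esub> u x) = (\<lambda>x \<in> carrier P. h (d x) \<oplus>\<^bsub>Y\<^esub> u x)"
    for P :: "('s, 's univ) module" and h d by (rule restrict_ext) (simp add: compose_def)
  then show ?thesis by (auto simp: r_coset_def coboundaries_def hom_group_def)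
qed

lemma Ext_carrier:
  "carrier (Ext i S X Y) = {coboundaries i S X Y #>\<^bsub>hom_group S (res_obj S X i) Y\<^esub> u |u. u \<in> cocycles i S X Y}"
  by (auto simp: Ext_def FactGroup_def RCOSETS_def r_coset_def)

context quotient_setting
begin

text \<open>The choice in \<open>comparison_map\<close> can be met: the chosen resolution over
  \<open>R\<close> is a complex of projectives, and the one over the quotient stays exact after
  restriction.\<close>

lemma comparison_map_props:
  assumes X: "fg_module B X"
  shows "comparison_map R I X i \<in> mod_hom R (res_obj R (res X) i) (res (res_obj B X i))"
    and "x \<in> carrier (res_obj R (res X) (Suc i)) \<Longrightarrow>
      res_diff B X i (comparison_map R I X (Suc i) x) = comparison_map R I X i (res_diff R (res X) i x)"
proof -
  have fgX: "fg_module R (res X)" using X by (simp add: fg_restrict_iff)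
  note PR = proj_resolutionD[OF chosen_resolution[OF finite_length fgX]]
  note PB = proj_resolutionD[OF chosen_resolution[OF finite_length_B X]]
  let ?P = "res_obj R (res X)" and ?d = "res_diff R (res X)" and ?e = "res_aug R (res X)"
  let ?Q = "res_obj B X" and ?\<delta> = "res_diff B X" and ?\<epsilon> = "res_aug B X"
  have P: "fg_module R (?P i)" "projective R (?P i)" "?d i \<in> mod_hom R (?P (Suc i)) (?P i)"
    "?d (Suc i) ` carrier (?P (Suc (Suc i))) = {x \<in> carrier (?P (Suc i)). ?d i x = \<zero>\<^bsub>?P i\<^esub>}" for i
    by (rule PR)+
  have Q: "fg_module B (?Q i)" "?\<delta> i \<in> mod_hom B (?Q (Suc i)) (?Q i)"
    "?\<delta> (Suc i) ` carrier (?Q (Suc (Suc i))) = {x \<in> carrier (?Q (Suc i)). ?\<delta> i x = \<zero>\<^bsub>?Q i\<^esub>}" for i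
    by (rule PB)+
  have e: "?e \<in> mod_hom R (?P 0) (res X)" "?d 0 ` carrier (?P 1) = {x \<in> carrier (?P 0). ?e x = \<zero>\<^bsub>X\<^esub>}"
    using PR(4,6) by simp_all
  have \<epsilon>: "?\<epsilon> \<in> mod_hom B (?Q 0) X" "?\<epsilon> ` carrier (?Q 0) = carrier X"
    "?\<delta> 0 ` carrier (?Q 1) = {x \<in> carrier (?Q 0). ?\<epsilon> x = \<zero>\<^bsub>X\<^esub>}"
    by (rule PB)+
  have "\<exists>f. (\<forall>i. f i \<in> mod_hom R (?P i) (res (?Q i))) \<and> (\<forall>x \<in> carrier (?P 0). ?\<epsilon> (f 0 x) = ?e x) \<and>
    (\<forall>i. \<forall>x \<in> carrier (?P (Suc i)). ?\<delta> i (f (Suc i) x) = f i (?d i x))"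
  proof (rule comparison_lift[where X = "res X"])
    show "?d i (?d (Suc i) x) = \<zero>\<^bsub>?P i\<^esub>" if "x \<in> carrier (?P (Suc (Suc i)))" for i x
    proof -
      have "?d (Suc i) x \<in> ?d (Suc i) ` carrier (?P (Suc (Suc i)))" using that by blast
      then show ?thesis unfolding P(4) by simp
    qed
    show "?e (?d 0 x) = \<zero>\<^bsub>res X\<^esub>" if "x \<in> carrier (?P 1)" for x
    proof -
      have "?d 0 x \<in> ?d 0 ` carrier (?P 1)" using that by blast
      then show ?thesis unfolding e(2) by simp
    qed
    show "module_map R (?P (Suc i)) (?P i) (?d i)" for i by (rule module_map_of_hom[OF P(3)])
    show "module_map R (?P 0) (res X) ?e" by (rule module_map_of_hom[OF e(1)])
    show "module_map R (res (?Q (Suc i))) (res (?Q i)) (?\<delta> i)" for i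
      using module_map_of_hom[OF Q(2)] unfolding module_map_restrict_iff .
    show "module_map R (res (?Q 0)) (res X) ?\<epsilon>"
      using module_map_of_hom[OF \<epsilon>(1)] unfolding module_map_restrict_iff .
    show "?\<epsilon> ` carrier (res (?Q 0)) = carrier (res X)" using \<epsilon>(2) by simp
    show "?\<delta> 0 ` carrier (res (?Q 1)) = {x \<in> carrier (res (?Q 0)). ?\<epsilon> x = \<zero>\<^bsub>res X\<^esub>}"
      unfolding restrict_scalars_sel by (rule \<epsilon>(3))
    show "?\<delta> (Suc i) ` carrier (res (?Q (Suc (Suc i)))) =
        {x \<in> carrier (res (?Q (Suc i))). ?\<delta> i x = \<zero>\<^bsub>res (?Q i)\<^esub>}" for i
      unfolding restrict_scalars_sel by (rule Q(3))
    show "fg_module R (res (?Q i))" for i using Q(1) by (simp add: fg_restrict_iff)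
  qed (use P fgX in \<open>simp_all add: fg_module_left_module\<close>)
  from someI_ex[OF this]
  have "(\<forall>i. comparison_map R I X i \<in> mod_hom R (?P i) (res (?Q i))) \<and>
    (\<forall>x \<in> carrier (?P 0). ?\<epsilon> (comparison_map R I X 0 x) = ?e x) \<and>
    (\<forall>i. \<forall>x \<in> carrier (?P (Suc i)). ?\<delta> i (comparison_map R I X (Suc i) x) = comparison_map R I X i (?d i x))"
    unfolding comparison_map_def Let_def .
  then show "comparison_map R I X i \<in> mod_hom R (res_obj R (res X) i) (res (res_obj B X i))"
    "x \<in> carrier (res_obj R (res X) (Suc i)) \<Longrightarrow>
      res_diff B X i (comparison_map R I X (Suc i) x) = comparison_map R I X i (res_diff R (res X) i x)"
    by blast+
qed

text \<open>Adding \<open>k\<close> to the function composed with the differential maps one coset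
  into the other, and adding the negative of \<open>k\<close> maps it back.\<close>

lemma Ext_coset_eq:
  assumes X: "fg_module R X" and Y: "left_module R Y"
    and k: "module_map R (res_obj R X i) Y k"
    and u: "\<And>x. x \<in> carrier (res_obj R X (Suc i)) \<Longrightarrow> u x \<in> carrier Y"
    and v: "\<And>x. x \<in> carrier (res_obj R X (Suc i)) \<Longrightarrow> v x = k (res_diff R X i x) \<oplus>\<^bsub>Y\<^esub> u x"
  shows "coboundaries (Suc i) R X Y #>\<^bsub>hom_group R (res_obj R X (Suc i)) Y\<^esub> v =
    coboundaries (Suc i) R X Y #>\<^bsub>hom_group R (res_obj R X (Suc i)) Y\<^esub> u"
proof -
  let ?P = "res_obj R X" and ?d = "res_diff R X i"
  interpret Y: left_module R Y by fact
  note PR = chosen_resolution[OF finite_length X]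
  note LP = fg_module_left_module[OF proj_resolutionD(1)[OF PR, of i]]
  note d = module_mapD(1)[OF module_map_of_hom[OF proj_resolutionD(3)[OF PR, of i]]]
  have sub: "coboundaries (Suc i) R X Y #>\<^bsub>hom_group R (?P (Suc i)) Y\<^esub> v \<subseteq>
      coboundaries (Suc i) R X Y #>\<^bsub>hom_group R (?P (Suc i)) Y\<^esub> u"
    if k: "module_map R (?P i) Y k" and u: "\<And>x. x \<in> carrier (?P (Suc i)) \<Longrightarrow> u x \<in> carrier Y"
      and v: "\<And>x. x \<in> carrier (?P (Suc i)) \<Longrightarrow> v x = k (?d x) \<oplus>\<^bsub>Y\<^esub> u x" for k u v
    unfolding Ext_coset
  proof clarify
    fix h assume "h \<in> mod_hom R (?P i) Y"
    then have h: "module_map R (?P i) Y h" by (rule module_map_of_hom)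
    let ?h = "restrict (\<lambda>x. h x \<oplus>\<^bsub>Y\<^esub> k x) (carrier (?P i))"
    have "?h \<in> mod_hom R (?P i) Y" by (rule mod_hom_restrict[OF LP Y module_map_add[OF LP Y h k]])
    moreover have "(\<lambda>x \<in> carrier (?P (Suc i)). h (?d x) \<oplus>\<^bsub>Y\<^esub> v x) = (\<lambda>x \<in> carrier (?P (Suc i)). ?h (?d x) \<oplus>\<^bsub>Y\<^esub> u x)"
      by (rule restrict_ext) (simp add: d v u module_mapD(1)[OF h] module_mapD(1)[OF k] Y.M.a_assoc)
    ultimately show "\<exists>h'. (\<lambda>x \<in> carrier (?P (Suc i)). h (?d x) \<oplus>\<^bsub>Y\<^esub> v x) =
        (\<lambda>x \<in> carrier (?P (Suc i)). h' (?d x) \<oplus>\<^bsub>Y\<^esub> u x) \<and> h' \<in> mod_hom R (?P i) Y" by blast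
  qed
  show ?thesis
  proof
    show "coboundaries (Suc i) R X Y #>\<^bsub>hom_group R (?P (Suc i)) Y\<^esub> v \<subseteq>
      coboundaries (Suc i) R X Y #>\<^bsub>hom_group R (?P (Suc i)) Y\<^esub> u" by (rule sub[OF k u v])
    show "coboundaries (Suc i) R X Y #>\<^bsub>hom_group R (?P (Suc i)) Y\<^esub> u \<subseteq>
      coboundaries (Suc i) R X Y #>\<^bsub>hom_group R (?P (Suc i)) Y\<^esub> v"
      by (rule sub[OF module_map_uminus[OF LP Y k]])
        (simp_all add: u v d module_mapD(1)[OF k] Y.M.r_neg1)
  qed
qed

end

locale strong_idempotent_setting = quotient_setting +
  assumes strong: "strong_idempotent_ideal I R"
begin

text \<open>This is surjectivity of \<open>Ext_map\<close> in positive degree, unfolded from cosets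
  to an equation between functions. Here the strong idempotence enters.\<close>

lemma Ext_surjective:
  assumes X: "X \<in> mod_cat B" and Y: "Y \<in> mod_cat B" and u: "u \<in> cocycles (Suc i) R (res X) (res Y)"
  obtains g h where "g \<in> cocycles (Suc i) B X Y" "module_map R (res_obj R (res X) i) (res Y) h"
    "\<And>x. x \<in> carrier (res_obj R (res X) (Suc i)) \<Longrightarrow>
      u x = h (res_diff R (res X) i x) \<oplus>\<^bsub>Y\<^esub> g (comparison_map R I X (Suc i) x)"
proof -
  let ?P = "res_obj R (res X)" and ?d = "res_diff R (res X)" and ?Q = "res_obj B X" and ?\<delta> = "res_diff B X"
  let ?\<phi> = "comparison_map R I X"
  have fgX: "fg_module B X" and LY: "left_module B Y" using X Y by (simp_all add: mod_cat_fg fg_module_left_module)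
  have fgX': "fg_module R (res X)" and LY': "left_module R (res Y)"
    using fgX LY by (simp_all add: fg_restrict_iff left_module_restrict_iff)
  interpret Y: left_module R "res Y" by (rule LY')
  note \<phi> = comparison_map_props[OF fgX]
  note \<phi>m = module_map_of_hom[OF \<phi>(1)]
  let ?CR = "\<lambda>u. coboundaries (Suc i) R (res X) (res Y) #>\<^bsub>hom_group R (?P (Suc i)) (res Y)\<^esub> u"
  let ?CB = "\<lambda>g. coboundaries (Suc i) B X Y #>\<^bsub>hom_group B (?Q (Suc i)) Y\<^esub> g"
  let ?comp = "\<lambda>g. compose (carrier (?P (Suc i))) g (?\<phi> (Suc i))"
  have "Ext_map (Suc i) R I X Y \<in> iso (Ext (Suc i) B X Y) (Ext (Suc i) R (res X) (res Y))"
    using strong X Y by (simp add: strong_idempotent_ideal_def)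
  then have surj: "Ext_map (Suc i) R I X Y ` carrier (Ext (Suc i) B X Y) = carrier (Ext (Suc i) R (res X) (res Y))"
    by (simp add: iso_def bij_betw_def)
  have "?CR u \<in> carrier (Ext (Suc i) R (res X) (res Y))" unfolding Ext_carrier using u by blast
  then have "?CR u \<in> Ext_map (Suc i) R I X Y ` carrier (Ext (Suc i) B X Y)" by (simp only: surj)
  then obtain g where g: "g \<in> cocycles (Suc i) B X Y" "?CR u = Ext_map (Suc i) R I X Y (?CB g)"
    unfolding Ext_carrier by blast
  have gm: "module_map B (?Q (Suc i)) Y g" using g(1) by (auto simp: cocycles_def intro: module_map_of_hom)
  have gc: "g x \<in> carrier Y" if "x \<in> carrier (?Q (Suc i))" for x using module_mapD(1)[OF gm that] .
  have \<phi>c: "?\<phi> k x \<in> carrier (?Q k)" if "x \<in> carrier (?P k)" for k x using module_mapD(1)[OF \<phi>m that] by simp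
  \<comment> \<open>Well-definedness of \<open>Ext_map\<close> on the coset of \<open>g\<close>: a
    cohomologous \<open>g'\<close> differs by a coboundary, which the chain map carries to a
    coboundary over \<open>R\<close>.\<close>
  have eq: "?CR (?comp g') = ?CR (?comp g)" if g': "g' \<in> ?CB g" for g'
  proof -
    obtain h where h: "h \<in> mod_hom B (?Q i) Y" "g' = (\<lambda>x \<in> carrier (?Q (Suc i)). h (?\<delta> i x) \<oplus>\<^bsub>Y\<^esub> g x)"
      using g' unfolding Ext_coset by blast
    have hm: "module_map R (res (?Q i)) (res Y) h"
      using module_map_of_hom[OF h(1)] by (simp add: module_map_restrict_iff)
    show ?thesis
      by (rule Ext_coset_eq[OF fgX' LY' module_map_comp[OF \<phi>m hm]])
        (simp_all add: compose_def \<phi>c gc h(2) \<phi>(2))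
  qed
  note LQ = fg_module_left_module[OF proj_resolutionD(1)[OF chosen_resolution[OF finite_length_B fgX], of i]]
  have "?CB g \<noteq> {}"
    unfolding Ext_coset using mod_hom_restrict[OF LQ LY module_map_const_zero[OF LY]] by blast
  then obtain g0 where g0: "g0 \<in> ?CB g" by blast
  have "(\<lambda>g'. ?CR (?comp g')) ` ?CB g = (\<lambda>_. ?CR (?comp g)) ` ?CB g" by (rule image_cong[OF refl eq])
  also have "\<dots> = {?CR (?comp g)}" by (rule image_constant[OF g0])
  finally have "Ext_map (Suc i) R I X Y (?CB g) = ?CR (?comp g)" by (simp add: Ext_map_def Let_def)
  then have "?CR u = ?CR (?comp g)" using g(2) by simp
  moreover have "u \<in> ?CR u"
  proof -
    have um: "u \<in> mod_hom R (?P (Suc i)) (res Y)" using u by (simp add: cocycles_def)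
    note PR = chosen_resolution[OF finite_length fgX']
    note LP = fg_module_left_module[OF proj_resolutionD(1)[OF PR, of i]]
    let ?z = "restrict (\<lambda>_. \<zero>\<^bsub>res Y\<^esub>) (carrier (?P i))"
    have z: "?z \<in> mod_hom R (?P i) (res Y)"
      by (rule mod_hom_restrict[OF LP LY' module_map_const_zero[OF LY']])
    note dP = module_mapD(1)[OF module_map_of_hom[OF proj_resolutionD(3)[OF PR, of i]]]
    have "u x = (\<lambda>x \<in> carrier (?P (Suc i)). ?z (?d i x) \<oplus>\<^bsub>res Y\<^esub> u x) x" for x
    proof (cases "x \<in> carrier (?P (Suc i))")
      case True
      then show ?thesis using module_mapD(1)[OF module_map_of_hom[OF um] True] dP[OF True] Y.M.l_zero[of "u x"] by simp
    next
      case False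
      then show ?thesis using um by (auto simp: mod_hom_def)
    qed
    then have "u = (\<lambda>x \<in> carrier (?P (Suc i)). ?z (?d i x) \<oplus>\<^bsub>res Y\<^esub> u x)" by (rule ext)
    then show ?thesis unfolding Ext_coset using z by blast
  qed
  ultimately have "u \<in> ?CR (?comp g)" by simp
  then obtain h where h: "h \<in> mod_hom R (?P i) (res Y)"
    "u = (\<lambda>x \<in> carrier (?P (Suc i)). h (?d i x) \<oplus>\<^bsub>res Y\<^esub> ?comp g x)" unfolding Ext_coset by blast
  show thesis
  proof (rule that[OF g(1) module_map_of_hom[OF h(1)]])
    fix x assume x: "x \<in> carrier (?P (Suc i))"
    have "u x = (\<lambda>x \<in> carrier (?P (Suc i)). h (?d i x) \<oplus>\<^bsub>res Y\<^esub> ?comp g x) x" using h(2) by (rule fun_cong)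
    then show "u x = h (?d i x) \<oplus>\<^bsub>Y\<^esub> g (?\<phi> (Suc i) x)" using x by (simp add: compose_def)
  qed
qed

text \<open>The base change of the resolution of \<open>X\<close> stays exact. For the image \<open>K\<close> of the differential, the
  projection from the resolution to \<open>K / I K\<close> is a cocycle. By surjectivity on Ext it is cohomologous to
  one pulled back from the resolution over the quotient, and both parts vanish on
  elements that the differential sends into \<open>I P\<close>.\<close>

lemma resolution_flat:
  assumes X: "X \<in> mod_cat B"
    and y: "y \<in> res_diff R (res X) i ` carrier (res_obj R (res X) (Suc i))" "y \<in> IM (res_obj R (res X) i)"
  shows "y \<in> IM (res_obj R (res X) i\<lparr>carrier := res_diff R (res X) i ` carrier (res_obj R (res X) (Suc i))\<rparr>)"
proof -
  let ?P = "res_obj R (res X)" and ?d = "res_diff R (res X)" and ?Q = "res_obj B X" and ?\<delta> = "res_diff B X"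
  let ?\<phi> = "comparison_map R I X"
  let ?K = "?P i\<lparr>carrier := ?d i ` carrier (?P (Suc i))\<rparr>"
  have fgX: "fg_module B X" using X by (simp add: mod_cat_fg)
  then have fgX': "fg_module R (res X)" by (simp add: fg_restrict_iff)
  note PR = proj_resolutionD[OF chosen_resolution[OF finite_length fgX']]
  note PB = proj_resolutionD[OF chosen_resolution[OF finite_length_B fgX]]
  have P: "fg_module R (?P k)" "?d k \<in> mod_hom R (?P (Suc k)) (?P k)"
    "?d (Suc k) ` carrier (?P (Suc (Suc k))) = {x \<in> carrier (?P (Suc k)). ?d k x = \<zero>\<^bsub>?P k\<^esub>}" for k
    by (rule PR)+
  have Q: "fg_module B (?Q k)" "?\<delta> (Suc k) ` carrier (?Q (Suc (Suc k))) = {x \<in> carrier (?Q (Suc k)). ?\<delta> k x = \<zero>\<^bsub>?Q k\<^esub>}" for k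
    by (rule PB)+
  note LP = P(1)[THEN fg_module_left_module] and dm = module_map_of_hom[OF P(2)]
  note LQ = Q(1)[THEN fg_module_left_module]
  note \<phi> = comparison_map_props[OF fgX]
  note \<phi>m = module_map_of_hom[OF \<phi>(1)]
  have sK: "submodule (?d i ` carrier (?P (Suc i))) R (?P i)"
    by (rule module_map_image[OF LP LP dm submodule_carrier[OF LP]])
  have fgK: "fg_module R ?K" by (rule fg_submodule[OF finite_length P(1) sK])
  note LK = fg_module_left_module[OF fgK]
  have dK: "module_map R (?P (Suc i)) ?K (?d i)"
    using dm[of i] submoduleD(1)[OF sK] by (simp add: module_map_into_submodule)
  note fgT = fg_base_change[OF fgK]
  let ?Y = "mod_rep B (bc ?K)"
  have Y: "?Y \<in> mod_cat B" by (rule mod_rep(1)[OF fgT])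
  have LT: "left_module B (bc ?K)" "left_module B ?Y" and LY: "left_module R (res ?Y)"
    using fgT Y by (simp_all add: mod_cat_fg fg_module_left_module left_module_restrict_iff[symmetric])
  obtain \<mu> where \<mu>: "module_map B (bc ?K) ?Y \<mu>" "bij_betw \<mu> (carrier (bc ?K)) (carrier ?Y)"
    using mod_rep(2)[OF fgT] LT by (auto simp: mod_isomorphic_iff)
  have \<mu>0: "\<forall>U \<in> carrier (bc ?K). \<mu> U = \<zero>\<^bsub>?Y\<^esub> \<longrightarrow> U = \<zero>\<^bsub>bc ?K\<^esub>"
    using \<mu>(2) module_map_inj_iff[OF LT \<mu>(1)] by (simp add: bij_betw_def)
  \<comment> \<open>The canonical map onto \<open>K\<close> and on to \<open>K / I K\<close>, moved
    into \<open>mod_cat B\<close> by \<open>\<mu>\<close>. It is a cocycle because consecutive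
    differentials compose to zero.\<close>
  let ?u = "restrict (\<lambda>x. \<mu> (q ?K (?d i x))) (carrier (?P (Suc i)))"
  have um: "module_map R (?P (Suc i)) (res ?Y) (\<lambda>x. \<mu> (q ?K (?d i x)))"
    using module_map_comp[OF module_map_comp[OF dK module_map_residue_class[OF LK]]] \<mu>(1)
    by (simp add: module_map_restrict_iff)
  have "?u \<in> cocycles (Suc i) R (res X) (res ?Y)"
    unfolding cocycles_def
  proof (intro CollectI conjI ballI)
    show "?u \<in> mod_hom R (?P (Suc i)) (res ?Y)" by (rule mod_hom_restrict[OF LP LY um])
    fix x assume "x \<in> carrier (?P (Suc (Suc i)))"
    then have "?d (Suc i) x \<in> ?d (Suc i) ` carrier (?P (Suc (Suc i)))" by blast
    then have dx: "?d (Suc i) x \<in> carrier (?P (Suc i))" "?d i (?d (Suc i) x) = \<zero>\<^bsub>?P i\<^esub>" unfolding P(3) by auto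
    have "q ?K \<zero>\<^bsub>?K\<^esub> = \<zero>\<^bsub>bc ?K\<^esub>" by (simp add: base_change_ops[OF LK])
    then show "?u (?d (Suc i) x) = \<zero>\<^bsub>res ?Y\<^esub>"
      using dx module_map_zero[OF LT \<mu>(1)] by simp
  qed
  then obtain g h where g: "g \<in> cocycles (Suc i) B X ?Y" and h: "module_map R (?P i) (res ?Y) h"
    and u: "\<And>x. x \<in> carrier (?P (Suc i)) \<Longrightarrow> ?u x = h (?d i x) \<oplus>\<^bsub>?Y\<^esub> g (?\<phi> (Suc i) x)"
    by (rule Ext_surjective[OF X Y]) (rule that)
  interpret Y: left_module B ?Y by (rule LT(2))
  obtain x where x: "x \<in> carrier (?P (Suc i))" "y = ?d i x" using y(1) by blast
  \<comment> \<open>\<open>h\<close> sends \<open>I P\<close> into \<open>I Y\<close>, which is zero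
    for a module over the quotient.\<close>
  have hy: "h y = \<zero>\<^bsub>?Y\<^esub>"
    using ideal_mult_map[OF LP LY h y(2)] ideal_mult_restrict[OF LT(2)] by simp
  \<comment> \<open>For the same reason the comparison map kills \<open>y\<close>. Hence
    \<open>?\<phi> (Suc i) x\<close> is a cycle, so a boundary in the exact resolution over the
    quotient, and the cocycle \<open>g\<close> vanishes on it.\<close>
  have "?\<phi> i y = \<zero>\<^bsub>?Q i\<^esub>"
    using ideal_mult_map[OF LP _ \<phi>m y(2)] ideal_mult_restrict[OF LQ] LQ[of i] by (simp add: left_module_restrict_iff)
  then have "?\<delta> i (?\<phi> (Suc i) x) = \<zero>\<^bsub>?Q i\<^esub>" using \<phi>(2)[OF x(1)] x(2) by simp
  then have "?\<phi> (Suc i) x \<in> ?\<delta> (Suc i) ` carrier (?Q (Suc (Suc i)))"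
    unfolding Q(2) using module_mapD(1)[OF \<phi>m x(1)] by simp
  then have "g (?\<phi> (Suc i) x) = \<zero>\<^bsub>?Y\<^esub>" using g by (auto simp: cocycles_def)
  with u[OF x(1)] hy x have "\<mu> (q ?K y) = \<zero>\<^bsub>?Y\<^esub>" by simp
  moreover have "q ?K y \<in> carrier (bc ?K)" using y(1) by (simp add: base_change_ops[OF LK])
  ultimately have "q ?K y = \<zero>\<^bsub>bc ?K\<^esub>" using \<mu>0 by blast
  then show ?thesis using residue_class_zero[OF LK, of y] y(1) by simp
qed

text \<open>Both sides are computed from the chosen resolution of \<open>X\<close> over
  \<open>R\<close>: the images \<open>?K i\<close> represent the syzygies over \<open>R\<close>, and
  by \<open>resolution_flat\<close> their base changes represent the syzygies over the
  quotient.\<close>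

lemma base_change_syzygy_pow:
  assumes X: "X \<in> mod_cat B"
  shows "K0_eq B (bc_map ((syzygy_map R ^^ s) (mod_class R (res X)))) ((syzygy_map B ^^ s) (frag_of X))"
proof -
  let ?P = "res_obj R (res X)" and ?d = "res_diff R (res X)" and ?e = "res_aug R (res X)"
  let ?K = "\<lambda>i. ?P i\<lparr>carrier := ?d i ` carrier (?P (Suc i))\<rparr>"
  have fgX: "fg_module B X" using X by (simp add: mod_cat_fg)
  then have fgX': "fg_module R (res X)" by (simp add: fg_restrict_iff)
  note LX = fg_module_left_module[OF fgX] fg_module_left_module[OF fgX']
  note PR = proj_resolutionD[OF chosen_resolution[OF finite_length fgX']]
  have P: "fg_module R (?P k)" "projective R (?P k)" "?d k \<in> mod_hom R (?P (Suc k)) (?P k)" for k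
    by (rule PR)+
  have ker0: "ker_mod (?P 0) ?e (res X) = ?K 0" using PR(6) by simp
  have e: "module_map R (?P 0) (res X) ?e" "?e ` carrier (?P 0) = carrier (res X)"
    using module_map_of_hom[OF PR(4)] PR(5) by simp_all
  have kerS: "ker_mod (?P (Suc k)) (?d k) (?K k) = ?K (Suc k)" for k using PR(7)[of k] by simp
  note LP = P(1)[THEN fg_module_left_module] and dm = module_map_of_hom[OF P(3)]
  have sK: "submodule (?d i ` carrier (?P (Suc i))) R (?P i)" for i
    by (rule module_map_image[OF LP LP dm submodule_carrier[OF LP]])
  have fgK: "fg_module R (?K i)" for i by (rule fg_submodule[OF finite_length P(1) sK])
  have dK: "module_map R (?P (Suc i)) (?K i) (?d i)" for i
    using dm[of i] submoduleD(1)[OF sK[of i]] by (simp add: module_map_into_submodule)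
  have R0: "K0_eq R (syzygy_map R (mod_class R (res X))) (mod_class R (?K 0))"
    using syzygy_map_class[OF P(1) fgX' P(2) e] unfolding ker0 .
  have RS: "K0_eq R (syzygy_map R (mod_class R (?K k))) (mod_class R (?K (Suc k)))" for k
    using syzygy_map_class[OF P(1) fgK P(2) dK] unfolding kerS by simp
  have B0: "K0_eq B (syzygy_map B (mod_class B (bc (res X)))) (mod_class B (bc (?K 0)))"
  proof -
    have "K0_eq B (syzygy_map B (mod_class B (bc (res X)))) (mod_class B (bc (ker_mod (?P 0) ?e (res X))))"
    proof (rule base_change_syzygy[OF P(1) fgX' P(2) e])
      fix x assume x: "x \<in> carrier (?P 0)" "?e x = \<zero>\<^bsub>res X\<^esub>" "x \<in> IM (?P 0)"
      then have "x \<in> carrier (ker_mod (?P 0) ?e (res X))" by simp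
      then have "x \<in> carrier (?K 0)" unfolding ker0 .
      then show "x \<in> IM (ker_mod (?P 0) ?e (res X))" unfolding ker0 using resolution_flat[OF X _ x(3)] by simp
    qed
    then show ?thesis unfolding ker0 .
  qed
  have BS: "K0_eq B (syzygy_map B (mod_class B (bc (?K k)))) (mod_class B (bc (?K (Suc k))))" for k
  proof -
    have "K0_eq B (syzygy_map B (mod_class B (bc (?K k)))) (mod_class B (bc (ker_mod (?P (Suc k)) (?d k) (?K k))))"
    proof (rule base_change_syzygy[OF P(1) fgK P(2) dK])
      fix x assume x: "x \<in> carrier (?P (Suc k))" "?d k x = \<zero>\<^bsub>?K k\<^esub>" "x \<in> IM (?P (Suc k))"
      then have "x \<in> carrier (ker_mod (?P (Suc k)) (?d k) (?K k))" by simp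
      then have "x \<in> carrier (?K (Suc k))" unfolding kerS .
      then show "x \<in> IM (ker_mod (?P (Suc k)) (?d k) (?K k))"
        unfolding kerS using resolution_flat[OF X _ x(3)] by simp
    qed simp
    then show ?thesis unfolding kerS .
  qed
  have X0: "K0_eq B (mod_class B (bc (res X))) (frag_of X)"
    by (rule K0_eq_trans[OF BF.mod_class_iso[OF fg_base_change[OF fgX'] fgX base_change_restrict[OF LX(1)]]
          BF.mod_class_mod_cat[OF X]])
  show ?thesis
  proof (cases s)
    case 0
    then show ?thesis using K0_eq_trans[OF bc_map_class[OF fgX'] X0] by simp
  next
    case (Suc k)
    have "K0_eq R ((syzygy_map R ^^ Suc k) (mod_class R (res X))) (mod_class R (?K k))"
    proof (induction k)
      case (Suc k)
      show ?case using K0_eq_trans[OF syzygy_map_eq[OF Suc] RS] by simp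
    qed (simp add: R0)
    note K0_eq_trans[OF bc_map_eq[OF this] bc_map_class[OF fgK]]
    moreover have "K0_eq B ((syzygy_map B ^^ Suc k) (mod_class B (bc (res X)))) (mod_class B (bc (?K k)))"
    proof (induction k)
      case (Suc k)
      show ?case using K0_eq_trans[OF BF.syzygy_map_eq[OF Suc] BS] by simp
    qed (simp add: B0)
    moreover have "K0_eq B ((syzygy_map B ^^ Suc k) (mod_class B (bc (res X)))) ((syzygy_map B ^^ Suc k) (frag_of X))"
      by (rule BF.syzygy_map_pow_eq[OF X0])
    ultimately show ?thesis unfolding Suc by (meson K0_eq_sym K0_eq_trans)
  qed
qed

end

section \<open>Comparison of the Igusa-Todorov functions\<close>

context quotient_setting
begin

text \<open>A finitely generated projective module over the quotient is a summand of a finite free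
  one, which is built from copies of the regular module; \<open>pd_le\<close> passes to sums and to
  summands.\<close>

lemma pd_le_restrict_projective:
  assumes reg: "pd_le R d (res (regular_module B))" and fg: "fg_module B P" and proj: "projective B P"
  shows "pd_le R d (res P)"
proof -
  have fgr: "fg_module R (res M)" if "fg_module B M" for M :: "('a set, 'm) module" using that by (simp add: fg_restrict_iff)
  have free: "fg_module B (free_module B n) \<and> pd_le R d (res (free_module B n))" for n
  proof (rule free_module_induct[where S = "\<lambda>M. fg_module B M \<and> pd_le R d (res M)"
        and T = "\<lambda>M. fg_module B M \<and> pd_le R d (res M)" and P = "\<lambda>M. fg_module B M \<and> pd_le R d (res M)", OF ring_B])
    fix M :: "('a set, nat \<Rightarrow> 'a set) module" assume M: "left_module B M" "carrier M = {\<zero>\<^bsub>M\<^esub>}"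
    note fgM = fg_module_zero[OF M]
    have "projective R (res M)"
      by (rule projective_zero) (use M in \<open>simp_all add: left_module_restrict_iff[symmetric]\<close>)
    then show "fg_module B M \<and> pd_le R d (res M)" using fgM pd_le_projective[OF fgr[OF fgM]] by blast
  next
    fix M :: "('a set, 'a set \<times> (nat \<Rightarrow> 'a set)) module" and N :: "('a set, nat \<Rightarrow> 'a set) module"
    assume *: "left_module B M" "left_module B N" "mod_isomorphic B M N" "fg_module B M \<and> pd_le R d (res M)"
    have fgN: "fg_module B N" by (rule fg_module_iso[OF _ *(2,3)]) (use *(4) in blast)
    have "pd_le R d (res N)"
      by (rule pd_le_iso[OF fgr fgr[OF fgN], of M]) (use * in \<open>simp_all add: mod_isomorphic_restrict_iff\<close>)
    then show "fg_module B N \<and> pd_le R d (res N)" using fgN by blast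
  next
    show "fg_module B (regular_module B) \<and> pd_le R d (res (regular_module B))"
      using reg fg_module_regular[OF ring_B] by blast
  next
    fix M :: "('a set, 'a set) module" and N :: "('a set, nat \<Rightarrow> 'a set) module"
    assume "fg_module B M \<and> pd_le R d (res M)" "fg_module B N \<and> pd_le R d (res N)"
    then show "fg_module B (direct_sum M N) \<and> pd_le R d (res (direct_sum M N))"
      unfolding restrict_scalars_direct_sum using pd_le_direct_sum[OF fgr fgr] fg_module_direct_sum by blast
  qed
  obtain n f where f: "module_map B (free_module B n) P f" "f ` carrier (free_module B n) = carrier P"
    using free_module_cover[OF fg] by blast
  let ?F = "free_module B n"
  have fgF: "fg_module B ?F" using free by blast
  note L = fg_module_left_module[OF fgF] fg_module_left_module[OF fg]
  obtain s where s: "module_map B P ?F s" "\<And>x. x \<in> carrier P \<Longrightarrow> f (s x) = x"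
    by (rule projective_lift[OF proj L(2) fgF fg f module_map_id]) (rule that)
  let ?K = "ker_mod ?F f P"
  have fgK: "fg_module B ?K" by (rule BF.fg_ker[OF fgF L(2) f(1)])
  note LK = fg_module_left_module[OF fgK]
  have split: "mod_isomorphic B ?F (direct_sum ?K P)" by (rule split_surjection[OF L f(1) s(1)]) (rule s(2))
  have "mod_isomorphic B ?F (direct_sum P ?K)"
    by (rule mod_isomorphic_trans[OF L(1) left_module_direct_sum[OF LK L(2)] left_module_direct_sum[OF L(2) LK]
          split direct_sum_comm[OF LK L(2)]])
  then have "mod_isomorphic R (res ?F) (direct_sum (res P) (res ?K))"
    by (simp only: mod_isomorphic_restrict_iff restrict_scalars_direct_sum)
  from pd_le_iso[OF fgr[OF fgF] fg_module_direct_sum[OF fgr[OF fg] fgr[OF fgK]] this] free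
  have "pd_le R d (direct_sum (res P) (res ?K))" by blast
  then show ?thesis by (rule pd_le_summand[OF fgr[OF fg] fgr[OF fgK]])
qed

text \<open>Restriction on formal sums. It is guaranteed to respect the relations only after
  \<open>d\<close> syzygies over \<open>R\<close>, which is why it is not turned into a map of
  cosets.\<close>

definition restrict_map where "restrict_map = frag_extend (\<lambda>M. mod_class R (res M))"

lemma restrict_map_diff: "restrict_map (x - y) = restrict_map x - restrict_map y"
  by (simp add: restrict_map_def frag_extend_diff)

text \<open>Moves the syzygies inside the additive extension, so that the criterion on generating
  relations applies to the composite.\<close>

lemma restrict_map_alt:
  "(syzygy_map R ^^ d) (restrict_map x) = frag_extend (\<lambda>M. (syzygy_map R ^^ d) (mod_class R (res M))) x"
proof (induction x rule: frag_induction[OF subset_UNIV])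
  case 1
  have "(syzygy_map R ^^ d) 0 = 0" by (induction d) (simp_all add: syzygy_map_def)
  then show ?case by (simp add: restrict_map_def)
next
  case (3 a b)
  then show ?case by (simp add: restrict_map_diff syzygy_map_pow_diff frag_extend_diff)
qed (simp add: restrict_map_def)

text \<open>Direct sums restrict to direct sums, and a projective restricts to a module of
  projective dimension at most \<open>d\<close>, whose class dies after \<open>d\<close>
  syzygies.\<close>

lemma restrict_map_relations:
  assumes reg: "pd_le R d (res (regular_module B))" and x: "x \<in> K0_relations B"
  shows "(syzygy_map R ^^ d) (restrict_map x) \<in> K0_relations R"
  unfolding restrict_map_alt
proof (rule frag_extend_K0_relations[OF _ _ x])
  fix A C D assume *: "A \<in> mod_cat B" "C \<in> mod_cat B" "D \<in> mod_cat B" "mod_isomorphic B D (direct_sum A C)"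
  have fg: "fg_module R (res A)" "fg_module R (res C)" "fg_module R (res D)"
    using * by (simp_all add: mod_cat_fg fg_restrict_iff)
  have "mod_isomorphic R (res D) (direct_sum (res A) (res C))"
    using *(4) by (simp add: mod_isomorphic_restrict_iff restrict_scalars_direct_sum)
  from K0_eq_trans[OF mod_class_iso[OF fg(3) fg_module_direct_sum[OF fg(1,2)] this] mod_class_sum[OF fg(1,2)]]
  have "K0_eq R (mod_class R (res D)) (mod_class R (res A) + mod_class R (res C))" .
  from syzygy_map_pow_eq[OF this]
  show "K0_eq R ((syzygy_map R ^^ d) (mod_class R (res D)))
      ((syzygy_map R ^^ d) (mod_class R (res A)) + (syzygy_map R ^^ d) (mod_class R (res C)))"
    by (simp add: syzygy_map_pow_add)
next
  fix P assume P: "P \<in> mod_cat B" "projective B P"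
  then have fg: "fg_module B P" "fg_module R (res P)" by (simp_all add: mod_cat_fg fg_restrict_iff)
  note m = mod_rep[OF fg(2)]
  have "pd_le R d (mod_rep R (res P))"
    by (rule pd_le_iso[OF fg(2) mod_rep_fg[OF fg(2)] m(2) pd_le_restrict_projective[OF reg fg(1) P(2)]])
  from syzygy_pow_finite_pd[OF m(1) this]
  have "(syzygy_map R ^^ d) (mod_class R (mod_rep R (res P))) \<in> K0_relations R" .
  then show "(syzygy_map R ^^ d) (mod_class R (res P)) \<in> K0_relations R"
    using K0_eq_relations[OF syzygy_map_pow_eq[OF mod_class_mod_cat[OF m(1)]]] by blast
qed

text \<open>Over \<open>R\<close>, the sequence that defines a syzygy over the quotient has a middle
  term of projective dimension at most \<open>d\<close>. After \<open>d\<close> syzygies its outer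
  terms therefore differ by exactly one more syzygy.\<close>

lemma restrict_map_syzygy:
  assumes reg: "pd_le R d (res (regular_module B))" and "Poly_Mapping.keys x \<subseteq> mod_cat B"
  shows "K0_eq R ((syzygy_map R ^^ d) (restrict_map (syzygy_map B x))) ((syzygy_map R ^^ Suc d) (restrict_map x))"
  using assms(2)
proof (induction x rule: frag_induction)
  case zero
  have "(syzygy_map R ^^ k) 0 = 0" for k by (induction k) (simp_all add: syzygy_map_def)
  then show ?case by (simp add: restrict_map_def syzygy_map_def)
next
  case (one M)
  then have fg: "fg_module B M" "fg_module R (res M)" by (simp_all add: mod_cat_fg fg_restrict_iff)
  obtain P p where P: "P \<in> mod_cat B" "projective B P" "module_map B P M p" "p ` carrier P = carrier M"
    "syzygy B M = ker_mod P p M" by (rule syzygy_kernel[OF finite_length_B fg(1)])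
  have fgP: "fg_module B P" "fg_module R (res P)" using P(1) by (simp_all add: mod_cat_fg fg_restrict_iff)
  have "K0_eq R ((syzygy_map R ^^ d) (mod_class R (ker_mod (res P) p (res M)))) ((syzygy_map R ^^ Suc d) (mod_class R (res M)))"
    by (rule syzygy_pow_exact[OF fgP(2) fg(2)])
      (use P pd_le_restrict_projective[OF reg fgP(1)] in \<open>simp_all add: module_map_restrict_iff\<close>)
  then show ?case by (simp add: syzygy_map_def restrict_map_def P(5) restrict_scalars_ker)
next
  case (diff a b)
  then show ?case by (simp add: syzygy_map_diff restrict_map_diff syzygy_map_pow_diff K0_eq_diff del: funpow.simps)
qed

lemma restrict_map_syzygy_pow:
  assumes reg: "pd_le R d (res (regular_module B))" and x: "Poly_Mapping.keys x \<subseteq> mod_cat B"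
  shows "K0_eq R ((syzygy_map R ^^ d) (restrict_map ((syzygy_map B ^^ k) x))) ((syzygy_map R ^^ (k + d)) (restrict_map x))"
proof (induction k)
  case (Suc k)
  have "K0_eq R ((syzygy_map R ^^ d) (restrict_map ((syzygy_map B ^^ Suc k) x)))
      ((syzygy_map R ^^ Suc d) (restrict_map ((syzygy_map B ^^ k) x)))"
    using restrict_map_syzygy[OF reg BF.syzygy_map_pow_keys[OF x]] by simp
  from K0_eq_trans[OF this, of "syzygy_map R ((syzygy_map R ^^ (k + d)) (restrict_map x))"] syzygy_map_eq[OF Suc]
  show ?case by simp
qed simp

text \<open>A decomposition over \<open>R\<close> is one over the quotient: the factors of a module
  annihilated by the ideal are annihilated too, so base change returns them unchanged.\<close>

lemma indecomposable_restrict: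
  assumes N: "N \<in> mod_cat B" and indec: "indecomposable B N"
  shows "indecomposable R (mod_rep R (res N))"
proof -
  have fg: "fg_module B N" "fg_module R (res N)" using N by (simp_all add: mod_cat_fg fg_restrict_iff)
  note LN = fg[THEN fg_module_left_module]
  note LM = mod_rep_left_module[OF fg(2)]
  let ?M = "mod_rep R (res N)"
  have "carrier ?M \<noteq> {\<zero>\<^bsub>?M\<^esub>}"
    using zero_iso[OF LM LN(2) mod_isomorphic_sym[OF LN(2) LM mod_rep(2)[OF fg(2)]]] indec
    by (auto simp: indecomposable_def)
  moreover have "carrier A = {\<zero>\<^bsub>A\<^esub>} \<or> carrier C = {\<zero>\<^bsub>C\<^esub>}"
    if A: "A \<in> mod_cat R" and C: "C \<in> mod_cat R" and iso: "mod_isomorphic R ?M (direct_sum A C)" for A C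
  proof -
    have fgA: "fg_module R A" "fg_module R C" using A C by (simp_all add: mod_cat_fg)
    note L = fgA[THEN fg_module_left_module]
    note LD = left_module_direct_sum[OF L]
    have iso': "mod_isomorphic R (res N) (direct_sum A C)"
      by (rule mod_isomorphic_trans[OF LN(2) LM LD mod_rep(2)[OF fg(2)] iso])
    then obtain f where f: "module_map R (res N) (direct_sum A C) f" "f ` carrier (res N) = carrier (direct_sum A C)"
      using LN(2) LD by (auto simp: mod_isomorphic_iff bij_betw_def simp del: direct_sum_sel restrict_scalars_sel)
    have "IM A \<times> IM C = {\<zero>\<^bsub>direct_sum A C\<^esub>}"
      using ideal_mult_surj[OF LN(2) LD f] module_map_zero[OF LN(2) LD f(1)]
      unfolding ideal_mult_direct_sum[OF L] ideal_mult_restrict[OF LN(1)] by simp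
    then have "fst ` (IM A \<times> IM C) \<subseteq> {\<zero>\<^bsub>A\<^esub>}" "snd ` (IM A \<times> IM C) \<subseteq> {\<zero>\<^bsub>C\<^esub>}" by simp_all
    moreover have "IM A \<noteq> {}" "IM C \<noteq> {}"
      using submoduleD(2)[OF submodule_ideal_mult[OF L(1)]] submoduleD(2)[OF submodule_ideal_mult[OF L(2)]] by auto
    ultimately have z: "IM A \<subseteq> {\<zero>\<^bsub>A\<^esub>}" "IM C \<subseteq> {\<zero>\<^bsub>C\<^esub>}" by (simp_all add: fst_image_times snd_image_times)
    note isoA = restrict_base_change[OF L(1) z(1)] restrict_base_change[OF L(2) z(2)]
    note LT = left_module_base_change[OF L(1)] left_module_base_change[OF L(2)]
    note fgT = fg_base_change[OF fgA(1)] fg_base_change[OF fgA(2)]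
    have "mod_isomorphic R (res N) (direct_sum (res (bc A)) (res (bc C)))"
      by (rule mod_isomorphic_trans[OF LN(2) LD left_module_direct_sum[OF LT(2,4)] iso'
            mod_isomorphic_direct_sum[OF L(1) LT(2) L(2) LT(4) isoA]])
    then have NB: "mod_isomorphic B N (direct_sum (bc A) (bc C))"
      by (simp only: mod_isomorphic_restrict_iff restrict_scalars_direct_sum)
    note rT = mod_rep[OF fgT(1)] mod_rep[OF fgT(2)]
    note LrT = BF.mod_rep_left_module[OF fgT(1)] BF.mod_rep_left_module[OF fgT(2)]
    have "mod_isomorphic B N (direct_sum (mod_rep B (bc A)) (mod_rep B (bc C)))"
      by (rule mod_isomorphic_trans[OF LN(1) left_module_direct_sum[OF LT(1,3)] left_module_direct_sum[OF LrT] NB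
            mod_isomorphic_direct_sum[OF LT(1) LrT(1) LT(3) LrT(2) rT(2,4)]])
    with indec rT(1,3) have "carrier (mod_rep B (bc A)) = {\<zero>\<^bsub>mod_rep B (bc A)\<^esub>} \<or>
        carrier (mod_rep B (bc C)) = {\<zero>\<^bsub>mod_rep B (bc C)\<^esub>}" unfolding indecomposable_def by blast
    then have "carrier (bc A) = {\<zero>\<^bsub>bc A\<^esub>} \<or> carrier (bc C) = {\<zero>\<^bsub>bc C\<^esub>}"
      using zero_iso[OF LrT(1) LT(1) mod_isomorphic_sym[OF LT(1) LrT(1) rT(2)]]
        zero_iso[OF LrT(2) LT(3) mod_isomorphic_sym[OF LT(3) LrT(2) rT(4)]] by blast
    then show ?thesis
      using zero_iso[OF LT(2) L(1) mod_isomorphic_sym[OF L(1) LT(2) isoA(1)]]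
        zero_iso[OF LT(4) L(2) mod_isomorphic_sym[OF L(2) LT(4) isoA(2)]] by auto
  qed
  ultimately show ?thesis unfolding indecomposable_def by blast
qed

lemma indec_summands_restrict:
  assumes X: "left_module B X" and N: "N \<in> indec_summands B X"
  shows "mod_rep R (res N) \<in> indec_summands R (res X)"
proof -
  obtain N' where N': "N \<in> mod_cat B" "indecomposable B N" "N' \<in> mod_cat B" "mod_isomorphic B X (direct_sum N N')"
    using N by (auto simp: indec_summands_def)
  have fg: "fg_module R (res N)" "fg_module R (res N')" using N' by (simp_all add: mod_cat_fg fg_restrict_iff)
  note L = fg[THEN fg_module_left_module] fg[THEN mod_rep_left_module]
  have LX: "left_module R (res X)" using X by (simp add: left_module_restrict_iff)
  have 1: "mod_isomorphic R (res X) (direct_sum (res N) (res N'))"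
    using N'(4) by (simp add: mod_isomorphic_restrict_iff restrict_scalars_direct_sum)
  have "mod_isomorphic R (res X) (direct_sum (mod_rep R (res N)) (mod_rep R (res N')))"
    by (rule mod_isomorphic_trans[OF LX left_module_direct_sum[OF L(1,2)] left_module_direct_sum[OF L(3,4)] 1
          mod_isomorphic_direct_sum[OF L(1,3,2,4) mod_rep(2)[OF fg(1)] mod_rep(2)[OF fg(2)]]])
  then show ?thesis
    using indecomposable_restrict[OF N'(1,2)] mod_rep(1)[OF fg(1)] mod_rep(1)[OF fg(2)]
    by (auto simp: indec_summands_def)
qed

lemma restrict_map_keys:
  assumes "left_module B X" "Poly_Mapping.keys z \<subseteq> indec_summands B X"
  shows "Poly_Mapping.keys (restrict_map z) \<subseteq> indec_summands R (res X)"
  using keys_frag_extend[of "\<lambda>M. mod_class R (res M)" z] indec_summands_restrict[OF assms(1)] assms(2)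
  by (auto simp: restrict_map_def)

end

context strong_idempotent_setting
begin

lemma bc_restrict_map:
  assumes "Poly_Mapping.keys z \<subseteq> mod_cat B"
  shows "K0_eq B (bc_map ((syzygy_map R ^^ s) (restrict_map z))) ((syzygy_map B ^^ s) z)"
  using assms
proof (induction z rule: frag_induction)
  case zero
  have "(syzygy_map R ^^ k) 0 = 0" "(syzygy_map B ^^ k) 0 = 0" for k by (induction k) (simp_all add: syzygy_map_def)
  then show ?case by (simp add: restrict_map_def bc_map_def)
next
  case (one M)
  then show ?case using base_change_syzygy_pow[OF one, of s] by (simp add: restrict_map_def)
next
  case (diff a b)
  then show ?case by (simp add: restrict_map_diff syzygy_map_pow_diff bc_map_diff K0_eq_diff)
qed

lemma syzygy_injective_quotient:
  assumes reg: "pd_le R d (res (regular_module B))" and X: "left_module B X"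
    and inj: "\<And>t. t \<ge> s \<Longrightarrow> syzygy_injective R (res X) t"
  shows "syzygy_injective B X s"
  unfolding syzygy_injective_def
proof (intro allI impI)
  fix z assume z: "Poly_Mapping.keys z \<subseteq> indec_summands B X" "(syzygy_map B ^^ Suc s) z \<in> K0_relations B"
  have zB: "Poly_Mapping.keys z \<subseteq> mod_cat B" using z(1) by (auto simp: indec_summands_def)
  let ?y = "restrict_map z"
  have y: "Poly_Mapping.keys ?y \<subseteq> indec_summands R (res X)" by (rule restrict_map_keys[OF X z(1)])
  have "(syzygy_map R ^^ (s + Suc d)) ?y \<in> K0_relations R"
    using restrict_map_relations[OF reg z(2)] K0_eq_relations[OF restrict_map_syzygy_pow[OF reg zB, of "Suc s"]] by simp
  \<comment> \<open>The \<open>Suc d\<close> extra syzygies are removed one at a time by injectivity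
    at the stages from \<open>s + d\<close> down to \<open>s\<close>, all of which
    \<open>inj\<close> covers.\<close>
  moreover have "(syzygy_map R ^^ s) ?y \<in> K0_relations R" if "(syzygy_map R ^^ (s + k)) ?y \<in> K0_relations R" for k
    using that
  proof (induction k)
    case (Suc k)
    have "(syzygy_map R ^^ Suc (s + k)) ?y \<in> K0_relations R" using Suc.prems by simp
    then have "(syzygy_map R ^^ (s + k)) ?y \<in> K0_relations R"
      using inj[of "s + k"] y unfolding syzygy_injective_def by (simp del: funpow.simps)
    then show ?case by (rule Suc.IH)
  qed simp
  ultimately have "(syzygy_map R ^^ s) ?y \<in> K0_relations R" by blast
  from bc_map_relations[OF this] K0_eq_relations[OF bc_restrict_map[OF zB]]
  show "(syzygy_map B ^^ s) z \<in> K0_relations B" by blast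
qed

lemma IT_phi_quotient_le:
  assumes reg: "pd_le R d (res (regular_module B))" and X: "fg_module B X"
  shows "IT_phi B X \<le> IT_phi R (res X)"
proof (rule BF.IT_phi_le)
  fix s assume s: "s \<ge> IT_phi R (res X)"
  have fg: "fg_module R (res X)" using X by (simp add: fg_restrict_iff)
  show "syzygy_injective B X s"
    by (rule syzygy_injective_quotient[OF reg fg_module_left_module[OF X]])
      (use s in \<open>simp add: syzygy_injective_IT_phi[OF fg]\<close>)
qed

text \<open>\<open>res X\<close> does not have the element type of \<open>mod_cat R\<close>. The
  supremum is compared through its copy there, on which \<open>\<phi>\<close> has the same value
  because isomorphic modules have the same indecomposable summands.\<close>

lemma IT_phi_dim_quotient_le:
  assumes reg: "pd_le R d (res (regular_module B))"
  shows "IT_phi_dim B \<le> IT_phi_dim R"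
  unfolding IT_phi_dim_def
proof (rule SUP_least)
  fix X assume "X \<in> mod_cat B"
  then have X: "fg_module B X" and fg: "fg_module R (res X)" by (simp_all add: mod_cat_fg fg_restrict_iff)
  note L = fg_module_left_module[OF fg] mod_rep_left_module[OF fg]
  have "syzygy_injective R (res X) s = syzygy_injective R (mod_rep R (res X)) s" for s
    unfolding syzygy_injective_def indec_summands_iso[OF L mod_rep(2)[OF fg]] ..
  then have "IT_phi R (res X) = IT_phi R (mod_rep R (res X))" by (simp add: IT_phi_alt)
  with IT_phi_quotient_le[OF reg X] have "enat (IT_phi B X) \<le> enat (IT_phi R (mod_rep R (res X)))" by simp
  also have "\<dots> \<le> (SUP M \<in> mod_cat R. enat (IT_phi R M))" by (rule SUP_upper[OF mod_rep(1)[OF fg]])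
  finally show "enat (IT_phi B X) \<le> (SUP M \<in> mod_cat R. enat (IT_phi R M))" .
qed

end

section \<open>Artin algebras have finite length\<close>

lemma submodule_regular_iff_ideal:
  fixes R (structure)
  assumes "cring R"
  shows "submodule K R (regular_module R) \<longleftrightarrow> ideal K R"
proof -
  interpret cring R by fact
  have L: "left_module R (regular_module R)" by (rule left_module_regular[OF ring_axioms])
  show ?thesis
  proof
    assume K: "submodule K R (regular_module R)"
    have sub: "K \<subseteq> carrier R" using submoduleD(1)[OF K] by simp
    have "subgroup K (add_monoid R)"
    proof (rule add.subgroupI)
      fix a assume a: "a \<in> K"
      then have "(\<ominus> \<one>) \<otimes> a \<in> K" using submoduleD(6)[OF K, of "\<ominus> \<one>" a] by simp
      then show "\<ominus> a \<in> K" using a sub by (auto simp: l_minus)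
    qed (use sub submoduleD(2,3)[OF K] in auto)
    moreover have left: "x \<otimes> a \<in> K" if "a \<in> K" "x \<in> carrier R" for a x
      using submoduleD(6)[OF K that(2,1)] by simp
    moreover have "a \<otimes> x \<in> K" if "a \<in> K" "x \<in> carrier R" for a x
      using left[OF that] that sub m_comm[of a x] by auto
    ultimately show "ideal K R" by (rule idealI[OF ring_axioms])
  next
    assume "ideal K R"
    then interpret K: ideal K R .
    show "submodule K R (regular_module R)"
      unfolding submodule_iff[OF L] using K.Icarr K.I_l_closed K.zero_closed K.a_closed by auto
  qed
qed

lemma artinian_cringD:
  "artinian_cring R \<Longrightarrow> (\<And>n::nat. ideal (I n) R) \<Longrightarrow> (\<And>n. I (Suc n) \<subseteq> I n) \<Longrightarrow>
    \<exists>n. \<forall>m\<ge>n. I m = I n"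
  by (simp add: artinian_cring_def)

lemma wf_order_False_artinian:
  assumes "artinian_cring R"
  shows "wf (submodule_order False R (regular_module R))"
  unfolding wf_iff_no_infinite_down_chain
proof
  have R: "cring R" using assms by (simp add: artinian_cring_def)
  assume "\<exists>f. \<forall>i. (f (Suc i), f i) \<in> submodule_order False R (regular_module R)"
  then obtain f where f: "\<And>i. (f (Suc i), f i) \<in> submodule_order False R (regular_module R)" by blast
  then have "ideal (f i) R \<and> f (Suc i) \<subset> f i" for i
    by (simp add: submodule_order_def submodule_regular_iff_ideal[OF R])
  then have "\<forall>n. ideal (f n) R \<and> f (Suc n) \<subseteq> f n" and ne: "f (Suc n) \<noteq> f n" for n by blast+
  with assms obtain n where stable: "\<And>m. m \<ge> n \<Longrightarrow> f m = f n" unfolding artinian_cring_def by blast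
  have "f (Suc n) = f n" by (rule stable) simp
  with ne show False by blast
qed

text \<open>A minimal ideal \<open>I\<close> for which the ascending chain condition fails is either annihilated or
  mapped onto itself by each ring element. So it is a vector space over the quotient by its
  annihilator, and it has a hyperplane \<open>U\<close>. As \<open>U\<close> satisfies the chain condition, so does \<open>I\<close>.\<close>

lemma wf_order_True_artinian:
  fixes R (structure)
  assumes art: "artinian_cring R"
  shows "wf (submodule_order True R (regular_module R))"
proof (rule ccontr)
  assume bad: "\<not> ?thesis"
  interpret cring R using art by (simp add: artinian_cring_def)
  let ?M = "regular_module R"
  let ?sub = "\<lambda>K. ?M\<lparr>carrier := K\<rparr>"
  let ?acc = "\<lambda>K. wf (submodule_order True R (?sub K))"
  have L: "left_module R ?M" by (rule left_module_regular[OF ring_axioms])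
  note dcc = wf_order_False_artinian[OF art]
  have eq: "?sub (carrier R) = ?M" by (simp add: regular_module_def)
  have "carrier R \<in> {K. submodule K R ?M \<and> \<not> ?acc K}"
    unfolding mem_Collect_eq eq using bad submodule_carrier[OF L] by simp
  then obtain I where I: "I \<in> {K. submodule K R ?M \<and> \<not> ?acc K}"
    and min: "\<And>J. (J, I) \<in> submodule_order False R ?M \<Longrightarrow> J \<notin> {K. submodule K R ?M \<and> \<not> ?acc K}"
    by (rule wfE_min[OF dcc]) (rule that)
  have sI: "submodule I R ?M" and badI: "\<not> ?acc I" using I by auto
  have acc: "?acc J" if "submodule J R ?M" "J \<subset> I" for J
    using min[of J] that sI by (auto simp: submodule_order_def)
  have IR: "x \<in> carrier R" if "x \<in> I" for x using submoduleD(1)[OF sI] that by auto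
  have Ia: "x \<oplus> y \<in> I" if "x \<in> I" "y \<in> I" for x y using submoduleD(3)[OF sI that] by simp
  have Im: "a \<otimes> x \<in> I" if "a \<in> carrier R" "x \<in> I" for a x using submoduleD(6)[OF sI that] by simp
  have LI: "left_module R (?sub I)" by (rule left_module_submodule[OF L sI])
  \<comment> \<open>Otherwise the kernel and the image of multiplication by \<open>a\<close> are
    both proper in \<open>I\<close>, so they satisfy the chain condition by minimality of
    \<open>I\<close>, and the exact sequence that they form gives it for \<open>I\<close>.\<close>
  have dich: "(\<forall>x \<in> I. a \<otimes> x = \<zero>) \<or> (\<lambda>x. a \<otimes> x) ` I = I" if a: "a \<in> carrier R" for a
  proof (rule ccontr)
    assume "\<not> ?thesis"
    then have ne: "\<not> (\<forall>x \<in> I. a \<otimes> x = \<zero>)" "(\<lambda>x. a \<otimes> x) ` I \<noteq> I" by auto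
    let ?f = "\<lambda>x. a \<otimes> x" and ?K = "{x \<in> I. a \<otimes> x = \<zero>}"
    have f: "module_map R (?sub I) (?sub I) ?f"
      using a Im IR by (auto simp: module_map_def r_distr m_lcomm)
    have sK: "submodule ?K R (?sub I)" using module_map_ker[OF LI LI f] by simp
    have sJ: "submodule (?f ` I) R (?sub I)" using module_map_image[OF LI LI f submodule_carrier[OF LI]] by simp
    have K: "submodule ?K R ?M" and J: "submodule (?f ` I) R ?M" "?f ` I \<subseteq> I"
      using sK sJ unfolding submodule_trans[OF L sI] by auto
    have "?K \<subset> I" using ne(1) by auto
    note accK = acc[OF K this]
    have "?f ` I \<subset> I" using ne(2) J(2) by blast
    note accJ = acc[OF J(1) this]
    have fJ: "module_map R (?sub I) (?sub (?f ` I)) ?f" using f J(2) by (auto simp: module_map_def)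
    have i: "module_map R (?sub ?K) (?sub I) (\<lambda>x. x)" by (simp add: module_map_def)
    have "?acc I"
      by (rule wf_submodule_order_exact[OF left_module_submodule[OF L K] LI left_module_submodule[OF L J(1)] i fJ _ accK accJ])
        auto
    then show False using badI by blast
  qed
  have "I \<noteq> {\<zero>}" using wf_submodule_order_zero[OF LI, of True] badI by auto
  then obtain z where z: "z \<in> I" "z \<noteq> \<zero>" using submoduleD(2)[OF sI] by auto
  \<comment> \<open>The descending powers of \<open>r\<close> give \<open>r^k = r^(k+1) s\<close>
    for some \<open>k\<close> and \<open>s\<close>, so \<open>r^k\<close> kills
    \<open>1 - r s\<close>. Since \<open>r^k\<close> maps \<open>I\<close> onto itself,
    \<open>1 - r s\<close> cannot map \<open>I\<close> onto the nonzero \<open>I\<close>; by the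
    dichotomy it annihilates \<open>I\<close>, and \<open>s\<close> inverts \<open>r\<close>
    there.\<close>
  have inverse: "\<exists>s \<in> carrier R. \<forall>y \<in> I. s \<otimes> (r \<otimes> y) = y"
    if r: "r \<in> carrier R" and nz: "\<exists>x \<in> I. r \<otimes> x \<noteq> \<zero>" for r
  proof -
    have rI: "(\<lambda>x. r \<otimes> x) ` I = I" using dich[OF r] nz by blast
    have pow: "r [^] k \<in> carrier R" for k :: nat using r by simp
    let ?J = "\<lambda>k::nat. (\<lambda>x. r [^] k \<otimes> x) ` carrier R"
    have J: "ideal (?J k) R" for k
    proof -
      have "module_map R ?M ?M (\<lambda>x. r [^] k \<otimes> x)" using pow by (auto simp: module_map_def r_distr m_lcomm)
      from module_map_image[OF L L this submodule_carrier[OF L]] show ?thesis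
        by (simp add: submodule_regular_iff_ideal[OF is_cring])
    qed
    have "?J (Suc k) \<subseteq> ?J k" for k
    proof clarify
      fix x assume x: "x \<in> carrier R"
      then have "r [^] Suc k \<otimes> x = r [^] k \<otimes> (r \<otimes> x)" using r by (simp add: m_assoc)
      then show "r [^] Suc k \<otimes> x \<in> ?J k" using x r by simp
    qed
    then have "\<exists>n. \<forall>m\<ge>n. ?J m = ?J n" by (rule artinian_cringD[OF art J])
    then obtain k where stable: "\<And>m. m \<ge> k \<Longrightarrow> ?J m = ?J k" by blast
    have eq: "?J (Suc k) = ?J k" by (rule stable) simp
    have "r [^] k \<in> ?J k" using pow by (intro image_eqI[of _ _ "\<one>"]) simp_all
    then obtain s where s: "s \<in> carrier R" "r [^] k = r [^] Suc k \<otimes> s" unfolding eq[symmetric] by blast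
    let ?t = "\<one> \<ominus> r \<otimes> s"
    have t: "?t \<in> carrier R" using r s by simp
    have "r [^] k \<otimes> ?t = r [^] k \<ominus> r [^] Suc k \<otimes> s"
      using r s(1) pow by (simp add: a_minus_def r_distr r_minus m_assoc)
    also have "\<dots> = \<zero>" unfolding s(2)[symmetric] using pow by (simp add: a_minus_def r_neg)
    finally have rt: "r [^] k \<otimes> ?t = \<zero>" .
    have rkI: "(\<lambda>x. r [^] k \<otimes> x) ` I = I" for k :: nat
    proof (induction k)
      case 0
      have "(\<lambda>x. \<one> \<otimes> x) ` I = (\<lambda>x. x) ` I" by (rule image_cong) (simp_all add: IR)
      then show ?case by simp
    next
      case (Suc k)
      have "(\<lambda>x. r [^] Suc k \<otimes> x) ` I = (\<lambda>x. r [^] k \<otimes> (r \<otimes> x)) ` I"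
        by (rule image_cong) (simp_all add: IR r m_assoc)
      also have "\<dots> = (\<lambda>x. r [^] k \<otimes> x) ` (\<lambda>x. r \<otimes> x) ` I" by (simp add: image_image)
      finally show ?case using Suc rI by simp
    qed
    have "\<forall>x \<in> I. ?t \<otimes> x = \<zero>"
    proof (rule ccontr)
      assume "\<not> ?thesis"
      then have tI: "(\<lambda>x. ?t \<otimes> x) ` I = I" using dich[OF t] by blast
      from z(1) obtain x where x: "x \<in> I" "z = r [^] k \<otimes> x" using rkI by blast
      from x(1) tI obtain y where y: "y \<in> I" "x = ?t \<otimes> y" by blast
      have "z = (r [^] k \<otimes> ?t) \<otimes> y" using x y IR[OF y(1)] t pow by (simp add: m_assoc)
      then show False using rt z(2) IR[OF y(1)] by simp
    qed
    moreover have "s \<otimes> (r \<otimes> y) = y" if "y \<in> I" "?t \<otimes> y = \<zero>" for y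
    proof -
      have y: "y \<in> carrier R" by (rule IR[OF that(1)])
      have "y = (?t \<oplus> r \<otimes> s) \<otimes> y" using r s(1) y by (simp add: a_minus_def a_assoc l_neg)
      also have "\<dots> = ?t \<otimes> y \<oplus> (r \<otimes> s) \<otimes> y" using r s(1) t y by (intro l_distr) simp_all
      also have "\<dots> = (r \<otimes> s) \<otimes> y" using that(2) r s(1) y by simp
      also have "\<dots> = s \<otimes> (r \<otimes> y)" using r s(1) y by (simp add: m_ac)
      finally show ?thesis ..
    qed
    ultimately show ?thesis using s(1) by blast
  qed
  let ?Z = "{U. submodule U R ?M \<and> U \<subseteq> I \<and> z \<notin> U}"
  \<comment> \<open>Zorn's lemma finds the hyperplane as a submodule of \<open>I\<close> that is
    maximal among those avoiding the nonzero element \<open>z\<close>.\<close>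
  have "\<exists>U \<in> ?Z. \<forall>X \<in> ?Z. U \<subseteq> X \<longrightarrow> X = U"
  proof (rule subset_Zorn_nonempty)
    have "{\<zero>} \<in> ?Z" using submodule_zero[OF L] submoduleD(2)[OF sI] z(2) by simp
    then show "?Z \<noteq> {}" by blast
    fix C assume C: "C \<noteq> {}" "subset.chain ?Z C"
    have CZ: "submodule U R ?M" "U \<subseteq> I" "z \<notin> U" if "U \<in> C" for U
      using C(2) that by (auto simp: subset.chain_def)
    have tot: "U \<subseteq> V \<or> V \<subseteq> U" if "U \<in> C" "V \<in> C" for U V using C(2) that by (auto simp: subset.chain_def)
    have "submodule (\<Union>C) R ?M"
      unfolding submodule_iff[OF L]
    proof (intro conjI ballI)
      show "\<Union>C \<subseteq> carrier ?M" using CZ(2) IR by auto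
      show "\<zero>\<^bsub>?M\<^esub> \<in> \<Union>C" using C(1) submoduleD(2)[OF CZ(1)] by blast
      fix x y assume "x \<in> \<Union>C" "y \<in> \<Union>C"
      then obtain U V where UV: "U \<in> C" "V \<in> C" "x \<in> U" "y \<in> V" by blast
      then consider "y \<in> U" | "x \<in> V" using tot[of U V] by blast
      then show "x \<oplus>\<^bsub>?M\<^esub> y \<in> \<Union>C"
      proof cases
        case 1
        from submoduleD(3)[OF CZ(1)[OF UV(1)] UV(3) 1] show ?thesis by (rule UnionI[OF UV(1)])
      next
        case 2
        from submoduleD(3)[OF CZ(1)[OF UV(2)] 2 UV(4)] show ?thesis by (rule UnionI[OF UV(2)])
      qed
    next
      fix a x assume a: "a \<in> carrier R" and "x \<in> \<Union>C"
      then obtain V where V: "V \<in> C" "x \<in> V" by blast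
      from submoduleD(6)[OF CZ(1)[OF V(1)] a V(2)] show "a \<odot>\<^bsub>?M\<^esub> x \<in> \<Union>C" by (rule UnionI[OF V(1)])
    qed
    then show "\<Union>C \<in> ?Z" using CZ(2,3) by blast
  qed
  then obtain U where UZ: "U \<in> ?Z" and mx: "\<forall>X \<in> ?Z. U \<subseteq> X \<longrightarrow> X = U" by (rule bexE)
  have U: "submodule U R ?M" "U \<subseteq> I" "z \<notin> U" using UZ by simp_all
  have max: "X = U" if "submodule X R ?M" "X \<subseteq> I" "z \<notin> X" "U \<subseteq> X" for X
    using mx[THEN bspec, of X] that by simp
  have UR: "x \<in> carrier R" if "x \<in> U" for x using U(2) IR that by blast
  have Ua: "x \<oplus> y \<in> U" if "x \<in> U" "y \<in> U" for x y using submoduleD(3)[OF U(1) that] by simp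
  have Um: "a \<otimes> x \<in> U" if "a \<in> carrier R" "x \<in> U" for a x using submoduleD(6)[OF U(1) that] by simp
  have U0: "\<zero> \<in> U" using submoduleD(2)[OF U(1)] by simp
  \<comment> \<open>By maximality, \<open>U\<close> together with any \<open>v\<close> outside it
    generates a submodule that contains \<open>z\<close>.\<close>
  have z_span: "\<exists>u \<in> U. \<exists>r \<in> carrier R. z = u \<oplus> r \<otimes> v" if v: "v \<in> I" "v \<notin> U" for v
  proof (rule ccontr)
    assume nz: "\<not> ?thesis"
    let ?X = "{u \<oplus> r \<otimes> v |u r. u \<in> U \<and> r \<in> carrier R}"
    have vR: "v \<in> carrier R" by (rule IR[OF v(1)])
    have "submodule ?X R ?M"
      unfolding submodule_iff[OF L]
    proof (intro conjI ballI)
      show "?X \<subseteq> carrier ?M" using UR vR by auto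
      have "\<zero> = \<zero> \<oplus> \<zero> \<otimes> v" using vR by simp
      then show "\<zero>\<^bsub>?M\<^esub> \<in> ?X" using U0 by (simp only: regular_module_sel) blast
    next
      fix x y assume "x \<in> ?X" "y \<in> ?X"
      then obtain u r u' r' where *: "u \<in> U" "r \<in> carrier R" "x = u \<oplus> r \<otimes> v"
        "u' \<in> U" "r' \<in> carrier R" "y = u' \<oplus> r' \<otimes> v" by blast
      have "x \<oplus> y = (u \<oplus> u') \<oplus> (r \<oplus> r') \<otimes> v"
        using * UR vR by (simp add: l_distr a_ac)
      moreover have "u \<oplus> u' \<in> U" "r \<oplus> r' \<in> carrier R" using * Ua by auto
      ultimately show "x \<oplus>\<^bsub>?M\<^esub> y \<in> ?X" by (simp only: regular_module_sel) blast
    next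
      fix a x assume a: "a \<in> carrier R" and "x \<in> ?X"
      then obtain u r where *: "u \<in> U" "r \<in> carrier R" "x = u \<oplus> r \<otimes> v" by blast
      have "a \<otimes> x = (a \<otimes> u) \<oplus> (a \<otimes> r) \<otimes> v"
        using * UR vR a by (simp add: r_distr m_assoc)
      moreover have "a \<otimes> u \<in> U" "a \<otimes> r \<in> carrier R" using * a Um by auto
      ultimately show "a \<odot>\<^bsub>?M\<^esub> x \<in> ?X" by (simp only: regular_module_sel) blast
    qed
    moreover have "?X \<subseteq> I" using Ia Im U(2) v(1) by blast
    moreover have "z \<notin> ?X" using nz by blast
    moreover have "U \<subseteq> ?X"
    proof
      fix u assume u: "u \<in> U"
      then have "u = u \<oplus> \<zero> \<otimes> v" using UR vR by simp
      then show "u \<in> ?X" using u by blast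
    qed
    ultimately have "?X = U" by (rule max)
    moreover have "v = \<zero> \<oplus> \<one> \<otimes> v" using vR by simp
    then have "v \<in> ?X" using U0 by blast
    ultimately show False using v(2) by simp
  qed
  \<comment> \<open>A \<open>y\<close> outside \<open>U\<close> generates \<open>z\<close> modulo
    \<open>U\<close>, and so does \<open>v\<close>. Comparing the two expressions and inverting the
    coefficient of \<open>y\<close> writes \<open>y\<close> through \<open>U\<close> and
    \<open>v\<close>: codimension one.\<close>
  have span: "\<exists>u \<in> U. \<exists>r \<in> carrier R. y = u \<oplus> r \<otimes> v" if v: "v \<in> I" "v \<notin> U" and y: "y \<in> I" for v y
  proof (cases "y \<in> U")
    case True
    then have "y = y \<oplus> \<zero> \<otimes> v" using IR y v by simp
    then show ?thesis using True by blast
  next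
    case False
    obtain u r where *: "u \<in> U" "r \<in> carrier R" "z = u \<oplus> r \<otimes> v" using z_span[OF v] by blast
    obtain u' r' where **: "u' \<in> U" "r' \<in> carrier R" "z = u' \<oplus> r' \<otimes> y" using z_span[OF y False] by blast
    have "r' \<otimes> y \<noteq> \<zero>" using **(1,3) U(3) UR by auto
    then obtain s where s: "s \<in> carrier R" "s \<otimes> (r' \<otimes> y) = y" using inverse[OF **(2)] y by blast
    note c = UR[OF *(1)] UR[OF **(1)] *(2) **(2) IR[OF v(1)] IR[OF y] s(1)
    have "r' \<otimes> y = \<ominus> u' \<oplus> z" unfolding **(3) using c by (simp add: r_neg1)
    then have "y = s \<otimes> (\<ominus> u' \<oplus> (u \<oplus> r \<otimes> v))" using s(2) *(3) by simp
    also have "\<dots> = s \<otimes> (\<ominus> u' \<oplus> u) \<oplus> (s \<otimes> r) \<otimes> v" using c by (simp add: r_distr a_assoc m_assoc)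
    finally have eq: "y = s \<otimes> (\<ominus> u' \<oplus> u) \<oplus> (s \<otimes> r) \<otimes> v" .
    have "\<ominus> u' = (\<ominus> \<one>) \<otimes> u'" using c by (simp add: l_minus)
    then have "\<ominus> u' \<in> U" using Um[of "\<ominus> \<one>" u'] **(1) by simp
    then have "s \<otimes> (\<ominus> u' \<oplus> u) \<in> U" using Um Ua *(1) s(1) by simp
    then show ?thesis using eq c by blast
  qed
  have "U \<subset> I" using U(2,3) z(1) by blast
  note accU = acc[OF U(1) this]
  have "?acc I"
    unfolding wf_iff_no_infinite_down_chain
  proof
    assume "\<exists>f. \<forall>i. (f (Suc i), f i) \<in> submodule_order True R (?sub I)"
    then obtain f where f: "\<And>i. (f (Suc i), f i) \<in> submodule_order True R (?sub I)" by blast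
    have sf: "submodule (f i) R ?M" "f i \<subseteq> I" for i
      using f[of i] unfolding submodule_order_def by (auto simp: submodule_trans[OF L sI])
    have inc: "f i \<subset> f (Suc i)" for i using f[of i] by (simp add: submodule_order_def)
    have mono: "f i \<subseteq> f j" if "i \<le> j" for i j by (rule lift_Suc_mono_le[of f, OF _ that]) (use inc in blast)
    have flU: "finite_length R (?sub U)"
      unfolding finite_length_def
    proof
      fix up show "wf (submodule_order up R (?sub U))"
        using accU wf_submodule_order_submodule[OF L U(1) dcc] by (cases up) simp_all
    qed
    have "\<exists>n. \<forall>m\<ge>n. f m \<inter> U = f n \<inter> U"
    proof (rule finite_length_chain[OF flU])
      show "submodule (f n \<inter> U) R (?sub U)" for n
        unfolding submodule_trans[OF L U(1)] using submodule_Int[OF L sf(1) U(1)] by simp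
      show "(\<forall>n. f n \<inter> U \<subseteq> f (Suc n) \<inter> U) \<or> (\<forall>n. f (Suc n) \<inter> U \<subseteq> f n \<inter> U)" using inc by blast
    qed
    then obtain n where n: "\<And>m. m \<ge> n \<Longrightarrow> f m \<inter> U = f n \<inter> U" by blast
    \<comment> \<open>From stage \<open>n\<close> on the traces on \<open>U\<close> are constant.
      Once the chain contains some \<open>v\<close> outside \<open>U\<close>, each later element is
      a multiple of \<open>v\<close> plus an element of that trace, so nothing new is added.\<close>
    show False
    proof (cases "\<exists>i v. v \<in> f i \<and> v \<notin> U")
      case False
      then have "f i \<inter> U = f i" for i by blast
      then have "f (Suc n) = f n" using n[of "Suc n"] by simp
      then show False using inc[of n] by simp
    next
      case True
      then obtain i v where v: "v \<in> f i" "v \<notin> U" by blast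
      define m where "m = n + i"
      have vm: "v \<in> f m" using v(1) mono[of i m] by (auto simp: m_def)
      have "f (Suc m) \<subseteq> f m"
      proof
        fix y assume y: "y \<in> f (Suc m)"
        have vI: "v \<in> I" "y \<in> I" using sf(2) v(1) y by blast+
        obtain u r where ur: "u \<in> U" "r \<in> carrier R" "y = u \<oplus> r \<otimes> v" using span[OF vI(1) v(2) vI(2)] by blast
        note c = UR[OF ur(1)] ur(2) IR[OF vI(1)] IR[OF vI(2)]
        have vS: "v \<in> f (Suc m)" using vm mono[of m "Suc m"] by auto
        have "(\<ominus> r) \<otimes> v \<in> f (Suc m)" using submoduleD(6)[OF sf(1) _ vS, of "\<ominus> r"] c by simp
        then have "y \<oplus> (\<ominus> r) \<otimes> v \<in> f (Suc m)" using submoduleD(3)[OF sf(1) y] by simp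
        moreover have "y \<oplus> (\<ominus> r) \<otimes> v = u" unfolding ur(3) using c by (simp add: l_minus a_assoc r_neg)
        ultimately have "u \<in> f (Suc m) \<inter> U" using ur(1) by simp
        moreover have "f (Suc m) \<inter> U = f m \<inter> U" using n[of "Suc m"] n[of m] by (simp add: m_def)
        ultimately have "u \<in> f m" by blast
        moreover have "r \<otimes> v \<in> f m" using submoduleD(6)[OF sf(1) ur(2) vm] by simp
        ultimately show "y \<in> f m" using submoduleD(3)[OF sf(1)[of m], of u "r \<otimes> v"] ur(3) by simp
      qed
      then show False using inc[of m] by blast
    qed
  qed
  then show False using badI by blast
qed

lemma finite_length_artinian:
  assumes "artinian_cring R" shows "finite_length R (regular_module R)"
  unfolding finite_length_def
proof
  fix up show "wf (submodule_order up R (regular_module R))"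
    using wf_order_True_artinian[OF assms] wf_order_False_artinian[OF assms] by (cases up) simp_all
qed

text \<open>Left ideals are submodules over the ground ring, because \<open>r x = (r 1) x\<close>.
  The chain conditions therefore pass down from \<open>\<Lambda>\<close> as a finitely generated
  module over \<open>R\<close>.\<close>

lemma finite_length_artin_algebra:
  assumes "artin_algebra R \<Lambda>" shows "finite_length \<Lambda> (regular_module \<Lambda>)"
proof -
  have art: "artinian_cring R" and ring: "ring \<Lambda>" and fg: "fg_module R \<Lambda>"
    and assoc: "\<And>r x y. r \<in> carrier R \<Longrightarrow> x \<in> carrier \<Lambda> \<Longrightarrow> y \<in> carrier \<Lambda> \<Longrightarrow>
      (r \<odot>\<^bsub>\<Lambda>\<^esub> x) \<otimes>\<^bsub>\<Lambda>\<^esub> y = r \<odot>\<^bsub>\<Lambda>\<^esub> (x \<otimes>\<^bsub>\<Lambda>\<^esub> y)"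
    using assms by (simp_all add: artin_algebra_def)
  interpret \<Lambda>: ring \<Lambda> by fact
  interpret R: left_module R \<Lambda> using fg by (simp add: fg_module_def)
  note L = left_module_regular[OF ring]
  have sub: "submodule K R \<Lambda>" if K: "submodule K \<Lambda> (regular_module \<Lambda>)" for K
    unfolding submodule_iff[OF R.left_module_axioms]
  proof (intro conjI ballI)
    show KL: "K \<subseteq> carrier \<Lambda>" using submoduleD(1)[OF K] by simp
    show "\<zero>\<^bsub>\<Lambda>\<^esub> \<in> K" using submoduleD(2)[OF K] by simp
    show "x \<oplus>\<^bsub>\<Lambda>\<^esub> y \<in> K" if "x \<in> K" "y \<in> K" for x y using submoduleD(3)[OF K that] by simp
    fix r x assume r: "r \<in> carrier R" and x: "x \<in> K"
    have "r \<odot>\<^bsub>\<Lambda>\<^esub> x = (r \<odot>\<^bsub>\<Lambda>\<^esub> \<one>\<^bsub>\<Lambda>\<^esub>) \<otimes>\<^bsub>\<Lambda>\<^esub> x" using assoc[OF r, of "\<one>\<^bsub>\<Lambda>\<^esub>" x] KL x by auto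
    then show "r \<odot>\<^bsub>\<Lambda>\<^esub> x \<in> K"
      using submoduleD(6)[OF K _ x, of "r \<odot>\<^bsub>\<Lambda>\<^esub> \<one>\<^bsub>\<Lambda>\<^esub>"] R.smult_closed[OF r, of "\<one>\<^bsub>\<Lambda>\<^esub>"] by simp
  qed
  have fl: "finite_length R \<Lambda>" by (rule fg_finite_length[OF finite_length_artinian[OF art] fg])
  show ?thesis unfolding finite_length_def
  proof
    fix up
    have "wf (submodule_order up R \<Lambda>)" using fl by (simp add: finite_length_def)
    then show "wf (submodule_order up \<Lambda> (regular_module \<Lambda>))"
      by (rule wf_subset) (use sub in \<open>auto simp: submodule_order_def\<close>)
  qed
qed

theorem theorem4p3:
  fixes R :: "('r, 'c) ring_scheme" and \<Lambda> :: "('r, 'a) module" and \<AA> :: "'a set"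
  assumes "artin_algebra R \<Lambda>"
    and "strong_idempotent_ideal \<AA> \<Lambda>"
    and "proj_dim \<Lambda> (restrict_scalars \<Lambda> \<AA> (regular_module (\<Lambda> Quot \<AA>))) < \<infinity>"
  shows "(\<forall>X :: ('a set, 'x) module. fg_module (\<Lambda> Quot \<AA>) X \<longrightarrow>
            IT_phi (\<Lambda> Quot \<AA>) X \<le> IT_phi \<Lambda> (restrict_scalars \<Lambda> \<AA> X)) \<and>
         IT_phi_dim (\<Lambda> Quot \<AA>) \<le> IT_phi_dim \<Lambda>"
proof -
  have "ring \<Lambda>" using assms(1) by (simp add: artin_algebra_def)
  moreover have "ideal \<AA> \<Lambda>" using assms(2) by (simp add: strong_idempotent_ideal_def)
  ultimately interpret strong_idempotent_setting \<Lambda> \<AA>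
    by (intro strong_idempotent_setting.intro quotient_setting.intro finite_length_ring.intro
        quotient_setting_axioms.intro strong_idempotent_setting_axioms.intro
        finite_length_artin_algebra[OF assms(1)] assms(2))
  have fg: "fg_module \<Lambda> (res (regular_module B))"
    using fg_module_regular[OF ring_B] by (simp add: fg_restrict_iff)
  \<comment> \<open>Any finite bound serves here, as the final inequalities do not depend on
    \<open>d\<close>.\<close>
  obtain d where d: "pd_le \<Lambda> d (res (regular_module B))"
    by (rule pd_le_of_proj_dim[OF fg assms(3)])
  show ?thesis using IT_phi_quotient_le[OF d] IT_phi_dim_quotient_le[OF d] by blast
qed

end
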